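(* Let $\Gamma$ be a group. If $\Gamma$ has a finite subgroup $\Gamma_0$ such that the $\Gamma_0$-conviviality graph of $\Gamma$ is infinite (has infinitely many vertices), then the class of $\Gamma$-gain-graphic matroids is not $\mathrm{CMSO}_1$-definable.
   Context: **Conviviality graph.** Let $F$ be a finite group and let $H$ be a group which has a copy of $F$ as a subgroup. Let $\mathcal{H}$ be the collection of all pairs $(K,\psi)$ where $K$ is a finite group such that there exists a monomorphism (injective homomorphism) from $K$ into $H$, and $\psi$ is a monomorphism from $F$ into $K$. Write $(K_1,\psi_1)\sim(K_2,\psi_2)$ if there is an isomorphism $\theta\colon K_1\to K_2$ with $\psi_2=\theta\circ\psi_1$. Two pairs $(K_1,\psi_1)$ and $(K_2,\psi_2)$ are $F$-convivial in $H$ if there are monomorphisms $\theta_1\colon K_1\to H$ and $\theta_2\colon K_2\to H$ such that $\theta_1\circ\psi_1=\theta_2\circ\psi_2$; this depends only on the $\sim$-classes of the pairs, and every class is convivial with itself. The elementary $F$-conviviality graph of $H$ has vertex-set $\mathcal{H}/{\sim}$, with two classes (possibly equal) adjacent if and only if they are $F$-convivial; so every vertex is self-adjacent. Define an equivalence relation $\approx$ on its vertices: two vertices are equivalent if they have exactly the same neighbours. The $F$-conviviality graph of $H$ has the $\approx$-classes as its vertices, two classes being adjacent if and only if representatives of them are adjacent in the elementary graph. **Hypergraphs, matroids and logic.** A hypergraph is a pair $(E,\mathcal{I})$ with $E$ a finite set and $\mathcal{I}$ a collection of subsets of $E$ (hyperedges). A matroid is regarded as the hypergraph whose hyperedges are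 its independent sets. Counting monadic second-order logic $\mathrm{CMSO}_1$ of hypergraphs has set variables $Z_1,Z_2,\ldots$ ranging over subsets of $E$; its formulas are built using $\neg$, $\land$ and $\exists Z_i$ from the atomic formulas $Z_i\subseteq Z_j$, $\mathsf{hyp}(Z_i)$ (meaning $Z_i$ is a hyperedge), and $|Z_i|\equiv p\bmod q$ (integers $q>1$, $0\le p<q$), with the usual semantics. A class $\mathcal{M}$ of hypergraphs is $\mathrm{CMSO}_1$-definable if there is a $\mathrm{CMSO}_1$-sentence $\varphi$ such that a hypergraph satisfies $\varphi$ if and only if it belongs to $\mathcal{M}$. **Gain-graphic matroids.** Graphs are finite and may have loops and parallel edges. A $\Gamma$-gaining of a graph $G$ is a function $\sigma$ assigning an element $\sigma(e,u,v)\in\Gamma$ to each triple $(e,u,v)$ where either $e$ is an edge joining distinct vertices $u,v$, or $e$ is a loop at $u$ and $u=v$; it is required that $\sigma(e,u,v)=\sigma(e,v,u)^{-1}$ when $u\neq v$. For a walk $W=v_0,e_0,v_1,\ldots,e_{n-1},v_n$ let $\sigma(W)=\sigma(e_0,v_0,v_1)\cdots\sigma(e_{n-1},v_{n-1},v_n)$. A cycle is balanced if $\sigma$ evaluates to the identity when the cycle is traversed from some (equivalently, any) starting point and direction; $\mathcal{B}(\sigma)$ is the set of balanced cycles. A bicycle is a set $X$ of edges that is minimal subject to the subgraph $G[X]$ (edges $X$ and their incident vertices) being connected and containing at least two cycles. The frame matroid $F(G,\sigma)$ has ground set $E(G)$, and its circuits are the edge-sets of balanced cycles and the bicycles containing no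 balanced cycle. A matroid is $\Gamma$-gain-graphic if it equals $F(G,\sigma)$ for some graph $G$ and some $\Gamma$-gaining $\sigma$ of $G$. *)

theory Defs
  imports "HOL-Algebra.Group" "HOL-Number_Theory.Cong"
begin

section \<open>The conviviality graph\<close>

text \<open>
  The pairs \<open>(K, \<psi>)\<close> would form a proper class. Every finite group is isomorphic to one whose
  elements are natural numbers, so taking \<open>K :: nat monoid\<close> loses no class of \<open>\<sim>\<close>. Values of \<open>\<psi>\<close>
  outside the carrier of \<open>F\<close> and of the product of \<open>K\<close> outside its carrier are irrelevant for \<open>\<sim>\<close>.
\<close>

type_synonym 'f extension = "nat monoid \<times> ('f \<Rightarrow> nat)"

definition extensions ::
    "('f, 'm) monoid_scheme \<Rightarrow> ('h, 'n) monoid_scheme \<Rightarrow> 'f extension set" where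
  "extensions F H =
     {(K, \<psi>). group K \<and> finite (carrier K) \<and> mon K H \<noteq> {} \<and> \<psi> \<in> mon F K}"

definition ext_equiv ::
    "('f, 'm) monoid_scheme \<Rightarrow> ('h, 'n) monoid_scheme \<Rightarrow> 'f extension rel" where
  "ext_equiv F H =
     {((K1, \<psi>1), (K2, \<psi>2)).
        (K1, \<psi>1) \<in> extensions F H \<and> (K2, \<psi>2) \<in> extensions F H \<and>
        (\<exists>\<theta> \<in> iso K1 K2. \<forall>x \<in> carrier F. \<psi>2 x = \<theta> (\<psi>1 x))}"

definition convivial ::
    "('f, 'm) monoid_scheme \<Rightarrow> ('h, 'n) monoid_scheme \<Rightarrow> 'f extension \<Rightarrow> 'f extension \<Rightarrow> bool" where
  "convivial F H =
     (\<lambda>(K1, \<psi>1) (K2, \<psi>2).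
        \<exists>\<theta>1 \<in> mon K1 H. \<exists>\<theta>2 \<in> mon K2 H. \<forall>x \<in> carrier F. \<theta>1 (\<psi>1 x) = \<theta>2 (\<psi>2 x))"

definition elem_verts ::
    "('f, 'm) monoid_scheme \<Rightarrow> ('h, 'n) monoid_scheme \<Rightarrow> 'f extension set set" where
  "elem_verts F H = extensions F H // ext_equiv F H"

definition elem_adj ::
    "('f, 'm) monoid_scheme \<Rightarrow> ('h, 'n) monoid_scheme \<Rightarrow>
     'f extension set \<Rightarrow> 'f extension set \<Rightarrow> bool" where
  "elem_adj F H A B \<longleftrightarrow>
     A \<in> elem_verts F H \<and> B \<in> elem_verts F H \<and> (\<exists>a \<in> A. \<exists>b \<in> B. convivial F H a b)"

definition same_nbrs ::
    "('f, 'm) monoid_scheme \<Rightarrow> ('h, 'n) monoid_scheme \<Rightarrow> 'f extension set rel" where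
  "same_nbrs F H =
     {(A, B). A \<in> elem_verts F H \<and> B \<in> elem_verts F H \<and>
        {C. elem_adj F H A C} = {C. elem_adj F H B C}}"

definition conv_verts ::
    "('f, 'm) monoid_scheme \<Rightarrow> ('h, 'n) monoid_scheme \<Rightarrow> 'f extension set set set" where
  "conv_verts F H = elem_verts F H // same_nbrs F H"

definition conv_adj ::
    "('f, 'm) monoid_scheme \<Rightarrow> ('h, 'n) monoid_scheme \<Rightarrow>
     'f extension set set \<Rightarrow> 'f extension set set \<Rightarrow> bool" where
  "conv_adj F H P Q \<longleftrightarrow>
     P \<in> conv_verts F H \<and> Q \<in> conv_verts F H \<and> (\<exists>A \<in> P. \<exists>B \<in> Q. elem_adj F H A B)"

text \<open>A graph with loops allowed, as its vertex set together with its adjacency relation.\<close>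

definition conviviality_graph ::
    "('f, 'm) monoid_scheme \<Rightarrow> ('h, 'n) monoid_scheme \<Rightarrow>
     'f extension set set set \<times> 'f extension set set rel" where
  "conviviality_graph F H = (conv_verts F H, {(P, Q). conv_adj F H P Q})"


section \<open>Hypergraphs and counting monadic second-order logic\<close>

type_synonym 'e hypergraph = "'e set \<times> 'e set set"

definition is_hypergraph :: "'e hypergraph \<Rightarrow> bool" where
  "is_hypergraph = (\<lambda>(E, I). finite E \<and> I \<subseteq> Pow E)"

datatype cmso =
    Subset nat nat
  | Hyp nat
  | Card_mod nat nat nat  \<comment> \<open>\<open>Card_mod i p q\<close> stands for \<open>|Z\<^sub>i| \<equiv> p mod q\<close>\<close>
  | Neg cmso
  | Conj cmso cmso
  | Exists nat cmso

fun wf_cmso :: "cmso \<Rightarrow> bool" where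
  "wf_cmso (Subset i j) = True"
| "wf_cmso (Hyp i) = True"
| "wf_cmso (Card_mod i p q) = (q > 1 \<and> p < q)"
| "wf_cmso (Neg \<phi>) = wf_cmso \<phi>"
| "wf_cmso (Conj \<phi> \<psi>) = (wf_cmso \<phi> \<and> wf_cmso \<psi>)"
| "wf_cmso (Exists i \<phi>) = wf_cmso \<phi>"

fun free_vars :: "cmso \<Rightarrow> nat set" where
  "free_vars (Subset i j) = {i, j}"
| "free_vars (Hyp i) = {i}"
| "free_vars (Card_mod i p q) = {i}"
| "free_vars (Neg \<phi>) = free_vars \<phi>"
| "free_vars (Conj \<phi> \<psi>) = free_vars \<phi> \<union> free_vars \<psi>"
| "free_vars (Exists i \<phi>) = free_vars \<phi> - {i}"

fun sat :: "'e hypergraph \<Rightarrow> (nat \<Rightarrow> 'e set) \<Rightarrow> cmso \<Rightarrow> bool" where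
  "sat M \<nu> (Subset i j) = (\<nu> i \<subseteq> \<nu> j)"
| "sat M \<nu> (Hyp i) = (\<nu> i \<in> snd M)"
| "sat M \<nu> (Card_mod i p q) = [card (\<nu> i) = p] (mod q)"
| "sat M \<nu> (Neg \<phi>) = (\<not> sat M \<nu> \<phi>)"
| "sat M \<nu> (Conj \<phi> \<psi>) = (sat M \<nu> \<phi> \<and> sat M \<nu> \<psi>)"
| "sat M \<nu> (Exists i \<phi>) = (\<exists>X. X \<subseteq> fst M \<and> sat M (\<nu>(i := X)) \<phi>)"

definition is_sentence :: "cmso \<Rightarrow> bool" where
  "is_sentence \<phi> \<longleftrightarrow> wf_cmso \<phi> \<and> free_vars \<phi> = {}"

text \<open>The truth of a sentence does not depend on the assignment, so the empty one is used.\<close>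

definition models :: "'e hypergraph \<Rightarrow> cmso \<Rightarrow> bool" where
  "models M \<phi> \<longleftrightarrow> sat M (\<lambda>_. {}) \<phi>"

text \<open>
  To be used with an infinite type of elements, such as \<^typ>\<open>nat\<close>, over which every hypergraph
  has an isomorphic copy.
\<close>

definition cmso_definable :: "'e hypergraph set \<Rightarrow> bool" where
  "cmso_definable \<M> \<longleftrightarrow>
     (\<exists>\<phi>. is_sentence \<phi> \<and> (\<forall>M. is_hypergraph M \<longrightarrow> (models M \<phi> \<longleftrightarrow> M \<in> \<M>)))"


section \<open>Gain-graphic matroids\<close>

text \<open>\<open>mends G e\<close> is the set of end-vertices of \<open>e\<close>, which is a singleton exactly if \<open>e\<close> is a loop.\<close>

record ('v, 'e) multigraph =
  mverts :: "'v set"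
  medges :: "'e set"
  mends :: "'e \<Rightarrow> 'v set"

definition is_multigraph :: "('v, 'e) multigraph \<Rightarrow> bool" where
  "is_multigraph G \<longleftrightarrow> finite (mverts G) \<and> finite (medges G) \<and>
     (\<forall>e \<in> medges G. mends G e \<subseteq> mverts G \<and> card (mends G e) \<in> {1, 2})"

text \<open>In the next definition, \<open>u = v\<close> is allowed: then \<open>e\<close> is a loop at \<open>u\<close>.\<close>

definition is_gaining ::
    "('a, 'm) monoid_scheme \<Rightarrow> ('v, 'e) multigraph \<Rightarrow> ('e \<Rightarrow> 'v \<Rightarrow> 'v \<Rightarrow> 'a) \<Rightarrow> bool" where
  "is_gaining \<Gamma> G \<sigma> \<longleftrightarrow>
     (\<forall>e \<in> medges G. \<forall>u v. mends G e = {u, v} \<longrightarrow>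
        \<sigma> e u v \<in> carrier \<Gamma> \<and> (u \<noteq> v \<longrightarrow> \<sigma> e u v = inv\<^bsub>\<Gamma>\<^esub> (\<sigma> e v u)))"

text \<open>
  A walk \<open>v\<^sub>0, e\<^sub>0, v\<^sub>1, \<dots>, e\<^sub>n\<^sub>-\<^sub>1, v\<^sub>n\<close> is represented by the list of its steps
  \<open>(e\<^sub>i, v\<^sub>i, v\<^sub>i\<^sub>+\<^sub>1)\<close>; \<open>walk G u p v\<close> says that \<open>p\<close> is a walk from \<open>u\<close> to \<open>v\<close>.
\<close>

fun walk :: "('v, 'e) multigraph \<Rightarrow> 'v \<Rightarrow> ('e \<times> 'v \<times> 'v) list \<Rightarrow> 'v \<Rightarrow> bool" where
  "walk G u [] v \<longleftrightarrow> u = v"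
| "walk G u ((e, a, b) # p) v \<longleftrightarrow> a = u \<and> e \<in> medges G \<and> mends G e = {a, b} \<and> walk G b p v"

fun walk_gain ::
    "('a, 'm) monoid_scheme \<Rightarrow> ('e \<Rightarrow> 'v \<Rightarrow> 'v \<Rightarrow> 'a) \<Rightarrow> ('e \<times> 'v \<times> 'v) list \<Rightarrow> 'a" where
  "walk_gain \<Gamma> \<sigma> [] = \<one>\<^bsub>\<Gamma>\<^esub>"
| "walk_gain \<Gamma> \<sigma> ((e, a, b) # p) = \<sigma> e a b \<otimes>\<^bsub>\<Gamma>\<^esub> walk_gain \<Gamma> \<sigma> p"

text \<open>
  A traversal of a cycle from some starting point in some direction. Distinctness of the edges
  only matters for closed walks of length two. A loop is a cycle, as is a pair of parallel edges.
\<close>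

definition cycle_traversal :: "('v, 'e) multigraph \<Rightarrow> ('e \<times> 'v \<times> 'v) list \<Rightarrow> bool" where
  "cycle_traversal G p \<longleftrightarrow> p \<noteq> [] \<and> (\<exists>u. walk G u p u) \<and>
     distinct (map (\<lambda>(e, a, b). a) p) \<and> distinct (map (\<lambda>(e, a, b). e) p)"

text \<open>Cycles are identified with their edge sets.\<close>

definition cycles :: "('v, 'e) multigraph \<Rightarrow> 'e set set" where
  "cycles G = {fst ` set p | p. cycle_traversal G p}"

definition balanced_cycles ::
    "('a, 'm) monoid_scheme \<Rightarrow> ('v, 'e) multigraph \<Rightarrow> ('e \<Rightarrow> 'v \<Rightarrow> 'v \<Rightarrow> 'a) \<Rightarrow> 'e set set" where
  "balanced_cycles \<Gamma> G \<sigma> =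
     {fst ` set p | p. cycle_traversal G p \<and> walk_gain \<Gamma> \<sigma> p = \<one>\<^bsub>\<Gamma>\<^esub>}"

definition edge_subgraph :: "('v, 'e) multigraph \<Rightarrow> 'e set \<Rightarrow> ('v, 'e) multigraph" where
  "edge_subgraph G X = \<lparr>mverts = \<Union> (mends G ` X), medges = X, mends = mends G\<rparr>"

definition connected_graph :: "('v, 'e) multigraph \<Rightarrow> bool" where
  "connected_graph G \<longleftrightarrow> (\<forall>u \<in> mverts G. \<forall>v \<in> mverts G. \<exists>p. walk G u p v)"

definition connected_two_cycles :: "('v, 'e) multigraph \<Rightarrow> 'e set \<Rightarrow> bool" where
  "connected_two_cycles G X \<longleftrightarrow> connected_graph (edge_subgraph G X) \<and>
     (\<exists>C \<in> cycles (edge_subgraph G X). \<exists>D \<in> cycles (edge_subgraph G X). C \<noteq> D)"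

definition bicycle :: "('v, 'e) multigraph \<Rightarrow> 'e set \<Rightarrow> bool" where
  "bicycle G X \<longleftrightarrow> X \<subseteq> medges G \<and> connected_two_cycles G X \<and>
     (\<forall>Y. Y \<subset> X \<longrightarrow> \<not> connected_two_cycles G Y)"

definition frame_circuits ::
    "('a, 'm) monoid_scheme \<Rightarrow> ('v, 'e) multigraph \<Rightarrow> ('e \<Rightarrow> 'v \<Rightarrow> 'v \<Rightarrow> 'a) \<Rightarrow> 'e set set" where
  "frame_circuits \<Gamma> G \<sigma> = balanced_cycles \<Gamma> G \<sigma> \<union>
     {X. bicycle G X \<and> \<not> (\<exists>C \<in> balanced_cycles \<Gamma> G \<sigma>. C \<subseteq> X)}"

text \<open>
  The matroid with ground set \<open>E(G)\<close> and the above circuits (that these are the circuits of a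
  matroid is a theorem of Zaslavsky), regarded as the hypergraph of its independent sets, that is,
  of the subsets of the ground set which contain no circuit.
\<close>

definition frame_matroid ::
    "('a, 'm) monoid_scheme \<Rightarrow> ('v, 'e) multigraph \<Rightarrow> ('e \<Rightarrow> 'v \<Rightarrow> 'v \<Rightarrow> 'a) \<Rightarrow> 'e hypergraph" where
  "frame_matroid \<Gamma> G \<sigma> =
     (medges G, {X. X \<subseteq> medges G \<and> \<not> (\<exists>C \<in> frame_circuits \<Gamma> G \<sigma>. C \<subseteq> X)})"

text \<open>As graphs are finite, their vertices may be taken to be natural numbers.\<close>

definition gain_graphic_matroids :: "('a, 'm) monoid_scheme \<Rightarrow> 'e hypergraph set" where
  "gain_graphic_matroids \<Gamma> =
     {frame_matroid \<Gamma> G \<sigma> | (G :: (nat, 'e) multigraph) \<sigma>. is_multigraph G \<and> is_gaining \<Gamma> G \<sigma>}"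

end

theory Submission
  imports Defs "HOL-Library.Nat_Bijection" "HOL-Library.Countable_Set" "HOL-Real_Asymp.Real_Asymp"
begin

text \<open>
  Let \<open>K\<close> be a finite extension of \<open>F\<close> and let \<open>X \<subseteq> K\<close> contain \<open>F\<close>. Join two terminals by parallel links
  with gains in \<open>X\<close>, and
    for each relation \<open>x y\<^sup>-\<^sup>1 z = w\<close> in \<open>X\<close> add a new vertex, with two links to each
  terminal, such that balanced triangles through it enforce the relation. In every representation of
  the resulting matroid over \<open>\<Gamma>\<close> the links carry gains which satisfy these relations, and if \<open>X\<close> is
  spread through \<open>K\<close> this yields a monomorphism from \<open>K\<close> to \<open>\<Gamma>\<close>. Paths between the terminals have
  gains in \<open>X\<close> only. Hence, if gadgets for \<open>(K, X)\<close> and \<open>(L, Y)\<close> are glued along the links with gains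
  in \<open>F\<close> and have no other gains in common, then independence of a set depends on boundedly much
  information about its part in either gadget. So for a given sentence the gadgets have finitely many
  types.

  Embeddings of \<open>K\<close> and \<open>L\<close> which agree on \<open>F\<close> can have images that meet outside \<open>F\<close>. A random
  two-colouring of the intersection provides spread sets \<open>X\<close> and \<open>Y\<close> which meet in \<open>F\<close> only, unless
  both groups are small; these sets depend on both embeddings, so the invariant attached to \<open>K\<close> is the
  set of the types of all its gadgets. Infinitely many vertices of the conviviality graph come from
  large \<open>K\<close>, so two extensions with different neighbours have the same invariant. Exchanging a gadget
  for one of the same type then contradicts definability.
\<close>

section \<open>Independence in frame matroids\<close>

text \<open>All glued hypergraphs are restrictions of one predicate on sets of coded edges, with
  formal labels in place of gains. So they can be written down before any group is known to
  represent them, and gluing is a union of ground sets, to which a composition argument for formulas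
  applies.

  A left part has boundedly many states because the line spanned by the terminals has rank two:
  after contraction of one edge in each patch, an independent set keeps at most two points, and only
  joints and points labelled by elements of \<open>F\<close> can recur on the right.

  A representing graph is not given with the matroid. Joints and anchors force the shape of the
  graph around the terminals.

  A random half is spread because three given translates of a point survive with probability at
  least 1/8 and about one ninth of the \<open>n\<close> triples are disjoint, which beats the
  \<open>n^2\<close> pairs of translations.

  The exchange is one-sided: the right gadget stays as it is while the left one passes to an
  extension with the same set of types. Hence the right group may be small, and only the finitely
  many small vertices have to be set aside.\<close>

definition verts_of :: "('v, 'e) multigraph \<Rightarrow> 'e set \<Rightarrow> 'v set" where
  "verts_of G W = \<Union> (mends G ` W)"

text \<open>Reflexive at every vertex, incident with \<open>W\<close> or not, so that
  representatives of classes can be counted inside any vertex set.\<close>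

definition conn :: "('v, 'e) multigraph \<Rightarrow> 'e set \<Rightarrow> 'v rel" where
  "conn G W = {(u, v). \<exists>e \<in> W. mends G e = {u, v}}\<^sup>*"

abbreviation start :: "'e \<times> 'v \<times> 'v \<Rightarrow> 'v" where
  "start \<equiv> \<lambda>s. fst (snd s)"

lemma edge_subgraph_simps [simp]:
  "mverts (edge_subgraph G W) = verts_of G W"
  "medges (edge_subgraph G W) = W"
  "mends (edge_subgraph G W) = mends G"
  by (simp_all add: edge_subgraph_def verts_of_def)

lemma verts_of_mono: "W \<subseteq> W' \<Longrightarrow> verts_of G W \<subseteq> verts_of G W'"
  by (auto simp: verts_of_def)

lemma finite_verts_of:
  assumes "is_multigraph G" "W \<subseteq> medges G"
  shows "finite (verts_of G W)"
proof (rule finite_subset)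
  show "verts_of G W \<subseteq> mverts G"
    using assms by (force simp: is_multigraph_def verts_of_def)
  show "finite (mverts G)" using assms by (simp add: is_multigraph_def)
qed

lemma conn_refl [simp]: "(u, u) \<in> conn G W"
  by (simp add: conn_def)

lemma conn_trans: "(u, v) \<in> conn G W \<Longrightarrow> (v, w) \<in> conn G W \<Longrightarrow> (u, w) \<in> conn G W"
  unfolding conn_def by (rule rtrancl_trans)

lemma conn_sym: "(u, v) \<in> conn G W \<Longrightarrow> (v, u) \<in> conn G W"
  unfolding conn_def
  by (rule symD[OF sym_rtrancl]) (auto simp: sym_def insert_commute)

lemma conn_edge: "e \<in> W \<Longrightarrow> mends G e = {u, v} \<Longrightarrow> (u, v) \<in> conn G W"
  by (auto simp: conn_def)

lemma conn_mono: "W \<subseteq> W' \<Longrightarrow> conn G W \<subseteq> conn G W'"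
  unfolding conn_def by (rule rtrancl_mono) auto

lemma walk_append: "walk G u (p @ q) v \<longleftrightarrow> (\<exists>w. walk G u p w \<and> walk G w q v)"
  by (induction p arbitrary: u) auto

lemma walk_conn:
  "walk G u p v \<Longrightarrow> fst ` set p \<subseteq> W \<Longrightarrow> (u, v) \<in> conn G W"
  by (induction G u p v rule: walk.induct) (auto intro: conn_trans[OF conn_edge])

lemma walk_edges: "walk G u p v \<Longrightarrow> fst ` set p \<subseteq> medges G"
  by (induction G u p v rule: walk.induct) auto

lemma walk_subgraph:
  assumes "W \<subseteq> medges G"
  shows "walk (edge_subgraph G W) u p v \<longleftrightarrow> walk G u p v \<and> fst ` set p \<subseteq> W"
  using assms by (induction "edge_subgraph G W" u p v rule: walk.induct) auto

text \<open>Prepending an edge may revisit a vertex; the path is then cut back to its suffix from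
  that vertex.\<close>

lemma conn_path:
  assumes "(u, v) \<in> conn G W"
  shows "\<exists>p. walk (edge_subgraph G W) u p v \<and> distinct (map start p @ [v])"
  using assms unfolding conn_def
proof (induction rule: converse_rtrancl_induct)
  case base
  show ?case by (rule exI[of _ "[]"]) auto
next
  case (step a u)
  then obtain p e where p: "walk (edge_subgraph G W) u p v" "distinct (map start p @ [v])"
    and e: "e \<in> W" "mends G e = {a, u}" by auto
  show ?case
  proof (cases "a \<in> set (map start p @ [v])")
    case False
    then show ?thesis
      using p e by (intro exI[of _ "(e, a, u) # p"]) auto
  next
    case True
    show ?thesis
    proof (cases "a = v")
      case True
      then show ?thesis by (intro exI[of _ "[]"]) auto
    next
      case False
      with True obtain x where x: "x \<in> set p" "start x = a" by auto
      then obtain q r where q: "p = q @ x # r" by (meson split_list)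
      obtain f c where fx: "x = (f, a, c)" using x by (metis prod.collapse)
      have "walk (edge_subgraph G W) a (x # r) v"
        using p(1) q fx by (auto simp: walk_append)
      moreover have "distinct (map start (x # r) @ [v])" using p(2) q by auto
      ultimately show ?thesis by blast
    qed
  qed
qed

lemma connected_subgraph_iff:
  assumes "W \<subseteq> medges G"
  shows "connected_graph (edge_subgraph G W) \<longleftrightarrow>
    (\<forall>u \<in> verts_of G W. \<forall>v \<in> verts_of G W. (u, v) \<in> conn G W)"
  unfolding connected_graph_def edge_subgraph_simps
  by (metis assms conn_path walk_conn walk_subgraph)

lemma walk_last_vertex:
  assumes "walk G u p v" "(e, x, y) \<in> set p"
  shows "y \<in> set (map start p @ [v])"
  using assms
proof (induction p arbitrary: u)
  case (Cons z p)
  then show ?case by (cases p; cases z) auto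
qed auto

text \<open>If the first edge occurred again, the first vertex would be an end of that later step
  and so recur on the path.\<close>

lemma path_distinct_edges:
  assumes "walk G u p v" "distinct (map start p @ [v])"
  shows "distinct (map fst p)"
  using assms
proof (induction p arbitrary: u)
  case (Cons z p)
  obtain e a b where z: "z = (e, a, b)" by (cases z)
  have w: "walk G b p v" "mends G e = {a, b}" using Cons.prems z by auto
  have "e \<notin> set (map fst p)"
  proof
    assume "e \<in> set (map fst p)"
    then obtain x y where xy: "(e, x, y) \<in> set p" by auto
    have "mends G e = {x, y}"
      using w(1) xy by (induction p arbitrary: b) auto
    then have "a = x \<or> a = y" using w(2) by (metis insertCI insertE singletonD)
    moreover have "x \<in> set (map start p @ [v])" using xy by force
    moreover have "y \<in> set (map start p @ [v])" using walk_last_vertex[OF w(1) xy] .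
    ultimately show False using Cons.prems(2) z by auto
  qed
  then show ?case using Cons z by auto
qed auto

section \<open>Cycles in edge subgraphs\<close>

lemma cycle_traversal_alt:
  "cycle_traversal G p \<longleftrightarrow> p \<noteq> [] \<and> (\<exists>u. walk G u p u) \<and>
     distinct (map start p) \<and> distinct (map fst p)"
  by (simp add: cycle_traversal_def case_prod_unfold)

lemma cycle_traversal_subgraph:
  assumes "W \<subseteq> medges G"
  shows "cycle_traversal (edge_subgraph G W) p \<longleftrightarrow> cycle_traversal G p \<and> fst ` set p \<subseteq> W"
  unfolding cycle_traversal_alt using walk_subgraph[OF assms] by blast

lemma cycles_subgraph_iff:
  assumes "W \<subseteq> medges G"
  shows "C \<in> cycles (edge_subgraph G W) \<longleftrightarrow> C \<in> cycles G \<and> C \<subseteq> W"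
  unfolding cycles_def cycle_traversal_subgraph[OF assms] by auto

lemma cycle_nonempty: "C \<in> cycles G \<Longrightarrow> C \<noteq> {}"
  by (auto simp: cycles_def cycle_traversal_def)

lemma closing_edge_cycle:
  assumes "(a, b) \<in> conn G W" "mends G e = {a, b}" "e \<notin> W"
  shows "\<exists>C. C \<in> cycles (edge_subgraph G (insert e W))"
proof -
  obtain p where p: "walk (edge_subgraph G W) b p a" "distinct (map start p @ [a])"
    using conn_path[OF conn_sym[OF assms(1)]] by blast
  have d: "distinct (map fst p)" using path_distinct_edges[OF p] .
  have s: "fst ` set p \<subseteq> W" using walk_edges[OF p(1)] by simp
  have "walk (edge_subgraph G (insert e W)) b p a"
    using p(1) by (induction p arbitrary: b) auto
  then have "cycle_traversal (edge_subgraph G (insert e W)) ((e, a, b) # p)"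
    unfolding cycle_traversal_alt using p(2) d s assms by auto
  then show ?thesis unfolding cycles_def by blast
qed

section \<open>Counting edges against vertices\<close>

lemma card_ends_cases:
  assumes "card A \<in> {1, 2}"
  obtains a b where "A = {a, b}"
  using assms by (metis card_1_singletonE card_2_iff insertE insert_absorb2 singletonD)

lemma acyclic_transversal:
  assumes "finite W" "W \<subseteq> medges G" "\<And>e. e \<in> W \<Longrightarrow> card (mends G e) \<in> {1, 2}"
    and "\<And>C. C \<in> cycles G \<Longrightarrow> \<not> C \<subseteq> W" "verts_of G W \<subseteq> U" "finite U"
  shows "\<exists>S \<subseteq> U. (\<forall>u \<in> U. \<exists>s \<in> S. (u, s) \<in> conn G W) \<and> card S + card W \<le> card U"
  using assms
proof (induction W rule: finite_induct)
  case empty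
  show ?case by (intro exI[of _ U]) (auto intro: conn_refl)
next
  case (insert e W)
  obtain S where S: "S \<subseteq> U" "\<forall>u \<in> U. \<exists>s \<in> S. (u, s) \<in> conn G W"
    "card S + card W \<le> card U"
    using insert.IH insert.prems by (auto simp: verts_of_def) (metis subset_insertI2)
  obtain a b where ab: "mends G e = {a, b}"
    using insert.prems(2) card_ends_cases by (metis insertI1)
  have "a \<in> U" "b \<in> U" using insert.prems(4) ab by (auto simp: verts_of_def)
  then obtain s s' where s: "s \<in> S" "(a, s) \<in> conn G W" "s' \<in> S" "(b, s') \<in> conn G W"
    using S by meson
  have sub: "insert e W \<subseteq> medges G" by (rule insert.prems(1))
  have ne: "s \<noteq> s'"
  proof
    assume "s = s'"
    then have "(a, b) \<in> conn G W" using s conn_trans conn_sym by metis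
    then show False
      using closing_edge_cycle[OF _ ab insert.hyps(2)] insert.prems(3)
        cycles_subgraph_iff[OF sub] by blast
  qed
  have m: "conn G W \<subseteq> conn G (insert e W)" by (rule conn_mono) auto
  have ss: "(s', s) \<in> conn G (insert e W)"
  proof -
    have "(b, a) \<in> conn G (insert e W)" using conn_edge[of e "insert e W" G a b] ab conn_sym by fast
    moreover have "(s', b) \<in> conn G (insert e W)" "(a, s) \<in> conn G (insert e W)"
      using s m conn_sym by fast+
    ultimately show ?thesis by (meson conn_trans)
  qed
  have "\<forall>u \<in> U. \<exists>t \<in> S - {s'}. (u, t) \<in> conn G (insert e W)"
  proof (intro ballI)
    fix u assume "u \<in> U"
    then obtain t where t: "t \<in> S" "(u, t) \<in> conn G (insert e W)" using S(2) m by blast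
    show "\<exists>t \<in> S - {s'}. (u, t) \<in> conn G (insert e W)"
    proof (cases "t = s'")
      case True
      then have "(u, s) \<in> conn G (insert e W)"
        using t(2) ss by (meson conn_trans)
      then show ?thesis using s(1) ne by blast
    qed (use t in blast)
  qed
  moreover have "finite S" using S insert.prems finite_subset by blast
  then have "card (S - {s'}) + card (insert e W) \<le> card U"
    using S(3) s insert.hyps
      by (simp add: card_Diff_singleton) (metis One_nat_def Suc_pred add_Suc card_gt_0_iff empty_iff)
  moreover have "S - {s'} \<subseteq> U" using S by auto
  ultimately show ?case by blast
qed

text \<open>A nonempty forest has at least one component and hence fewer edges than
  vertices.\<close>

lemma exists_cycle:
  assumes "finite W" "W \<noteq> {}" "W \<subseteq> medges G" "\<And>e. e \<in> W \<Longrightarrow> card (mends G e) \<in> {1, 2}"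
    and "card (verts_of G W) \<le> card W"
  shows "\<exists>C \<in> cycles G. C \<subseteq> W"
proof (rule ccontr)
  assume "\<not> ?thesis"
  then have nc: "\<And>C. C \<in> cycles G \<Longrightarrow> \<not> C \<subseteq> W" by blast
  have fin: "finite (verts_of G W)"
    using assms(1,4) by (force simp: verts_of_def intro: card_ge_0_finite)
  obtain S where S: "S \<subseteq> verts_of G W" "\<forall>u \<in> verts_of G W. \<exists>s \<in> S. (u, s) \<in> conn G W"
    "card S + card W \<le> card (verts_of G W)"
    using acyclic_transversal[OF assms(1,3,4) nc order_refl fin] by blast
  obtain e where e: "e \<in> W" using assms(2) by auto
  then have "mends G e \<noteq> {}" using assms(4)[OF e] by auto
  then have "S \<noteq> {}" using S(2) e by (auto simp: verts_of_def)
  then have "card S > 0" using S(1) fin by (meson card_gt_0_iff finite_subset)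
  then show False using S(3) assms(5) by simp
qed

text \<open>The opposite bound, for arbitrary edge sets: a new edge merges at most two classes, so
  dropping one representative restores a set of pairwise unconnected vertices.\<close>

lemma disconnected_set:
  assumes "finite W" "finite U" "\<And>e. e \<in> W \<Longrightarrow> card (mends G e) \<in> {1, 2}"
  shows "\<exists>S \<subseteq> U. card U \<le> card S + card W \<and>
    (\<forall>s \<in> S. \<forall>t \<in> S. (s, t) \<in> conn G W \<longrightarrow> s = t)"
  using assms
proof (induction W rule: finite_induct)
  case empty
  have "conn G {} = Id" by (simp add: conn_def)
  then show ?case by (intro exI[of _ U]) auto
next
  case (insert e W)
  then obtain S where S: "S \<subseteq> U" "card U \<le> card S + card W"
    "\<And>s t. s \<in> S \<Longrightarrow> t \<in> S \<Longrightarrow> (s, t) \<in> conn G W \<Longrightarrow> s = t" by auto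
  obtain a b where ab: "mends G e = {a, b}"
    using insert.prems card_ends_cases by (metis insertI1)
  have new: "(u, v) \<in> conn G W \<or> (u, a) \<in> conn G W \<and> (v, b) \<in> conn G W
      \<or> (u, b) \<in> conn G W \<and> (v, a) \<in> conn G W"
    if "(u, v) \<in> conn G (insert e W)" for u v
    using that unfolding conn_def[of G "insert e W"]
  proof (induction rule: rtrancl_induct)
    case (step y z)
    then obtain f where f: "f \<in> insert e W" "mends G f = {y, z}" by auto
    show ?case
    proof (cases "f = e")
      case True
      then have "y = a \<and> z = b \<or> y = b \<and> z = a" using f ab by (auto simp: doubleton_eq_iff)
      then show ?thesis using step.IH conn_refl conn_trans conn_sym by metis
    next
      case False
      then have "(y, z) \<in> conn G W" using f conn_edge by (metis insertE)
      then show ?thesis using step.IH conn_trans conn_sym by metis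
    qed
  qed auto
  show ?case
  proof (cases "\<exists>s \<in> S. (s, a) \<in> conn G W")
    case True
    then obtain s where s: "s \<in> S" "(s, a) \<in> conn G W" by auto
    have "\<forall>x \<in> S - {s}. \<forall>y \<in> S - {s}. (x, y) \<in> conn G (insert e W) \<longrightarrow> x = y"
    proof (intro ballI impI)
      fix x y assume xy: "x \<in> S - {s}" "y \<in> S - {s}" "(x, y) \<in> conn G (insert e W)"
      have "(x, a) \<notin> conn G W" "(y, a) \<notin> conn G W"
        using S(3) s xy conn_trans conn_sym by (metis Diff_iff insertI1)+
      then show "x = y" using new[OF xy(3)] S(3) xy by blast
    qed
    moreover have "finite S" using S(1) insert.prems finite_subset by blast
    then have "card U \<le> card (S - {s}) + card (insert e W)"
      using S(2) s insert.hyps by (simp add: card_Diff_singleton)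
    moreover have "S - {s} \<subseteq> U" using S by auto
    ultimately show ?thesis by blast
  next
    case False
    then have "\<forall>x \<in> S. \<forall>y \<in> S. (x, y) \<in> conn G (insert e W) \<longrightarrow> x = y"
      using new S(3) by blast
    moreover have "card U \<le> card S + card (insert e W)" using S(2) insert.hyps by simp
    ultimately show ?thesis using S(1) by blast
  qed
qed

text \<open>The rest of the cycle still connects the ends of the removed edge.\<close>

lemma conn_remove_cycle_edge:
  assumes "C \<in> cycles G" "C \<subseteq> W" "e \<in> C"
  shows "conn G (W - {e}) = conn G W"
proof
  show "conn G (W - {e}) \<subseteq> conn G W" by (rule conn_mono) auto
  obtain p u where p: "C = fst ` set p" "walk G u p u" "distinct (map fst p)"
    using assms(1) unfolding cycles_def cycle_traversal_alt by blast
  obtain a b where "(e, a, b) \<in> set p" using assms(3) p(1) by auto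
  then obtain q r where qr: "p = q @ (e, a, b) # r" by (meson split_list)
  have w: "walk G u q a" "walk G b r u" "mends G e = {a, b}"
    using p(2) qr by (auto simp: walk_append)
  have "fst ` set q \<subseteq> W - {e}" "fst ` set r \<subseteq> W - {e}"
    using p(1,3) qr assms(2) by auto
  then have ab: "(b, a) \<in> conn G (W - {e})"
    using walk_conn w conn_trans by metis
  have "(x, y) \<in> conn G (W - {e})" if xy: "\<exists>f \<in> W. mends G f = {x, y}" for x y
  proof -
    obtain f where f: "f \<in> W" "mends G f = {x, y}" using xy by blast
    show ?thesis
    proof (cases "f = e")
      case True
      then show ?thesis using f w(3) ab conn_sym by (metis doubleton_eq_iff)
    next
      case False
      then show ?thesis using f conn_edge by (metis Diff_iff singletonD)
    qed
  qed
  then have "{(u, v). \<exists>e \<in> W. mends G e = {u, v}} \<subseteq> conn G (W - {e})" by auto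
  then show "conn G W \<subseteq> conn G (W - {e})"
    unfolding conn_def using rtrancl_subset_rtrancl by blast
qed

text \<open>Deleting an edge of \<open>C\<close> outside \<open>D\<close> and then any edge of
  \<open>D\<close> keeps the set connected, and connecting \<open>n\<close> vertices takes at least
  \<open>n - 1\<close> edges.\<close>

lemma connected_two_cycles_card:
  assumes "is_multigraph G" "W \<subseteq> medges G" "connected_two_cycles G W"
  shows "card (verts_of G W) < card W"
proof -
  have fin: "finite W" "finite (verts_of G W)"
    and ends: "\<And>e. e \<in> W \<Longrightarrow> card (mends G e) \<in> {1, 2}"
    using assms finite_verts_of by (auto simp: is_multigraph_def intro: finite_subset)
  obtain C D where CD: "C \<in> cycles G" "C \<subseteq> W" "D \<in> cycles G" "D \<subseteq> W" "C \<noteq> D"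
    and con: "\<And>u v. u \<in> verts_of G W \<Longrightarrow> v \<in> verts_of G W \<Longrightarrow> (u, v) \<in> conn G W"
    using assms(3) cycles_subgraph_iff[OF assms(2)]
    unfolding connected_two_cycles_def connected_subgraph_iff[OF assms(2)] by metis
  have main: ?thesis if C: "C \<in> cycles G" "C \<subseteq> W" "D \<in> cycles G" "D \<subseteq> W"
      and e: "e \<in> C" "e \<notin> D" for C D e
  proof -
    obtain d where d: "d \<in> D" using cycle_nonempty[OF C(3)] by auto
    have "D \<subseteq> W - {e}" using C(4) e by auto
    then have eq: "conn G (W - {e} - {d}) = conn G W"
      using conn_remove_cycle_edge[OF C(3) _ d] conn_remove_cycle_edge[OF C(1,2) e(1)] by simp
    obtain S where S: "S \<subseteq> verts_of G W" "card (verts_of G W) \<le> card S + card (W - {e} - {d})"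
      "\<And>s t. s \<in> S \<Longrightarrow> t \<in> S \<Longrightarrow> (s, t) \<in> conn G W \<Longrightarrow> s = t"
      using disconnected_set[of "W - {e} - {d}" "verts_of G W" G] fin ends eq by auto
    have "card S \<le> 1"
    proof (rule card_le_Suc0_iff_eq[THEN iffD2, folded One_nat_def])
      show "finite S" using S(1) fin finite_subset by blast
    qed (use S con in blast)
    moreover have "e \<in> W" "d \<in> W - {e}" using C d e by auto
    then have "card (W - {e} - {d}) + 2 = card W"
      using fin by (metis Suc_eq_plus1 add_2_eq_Suc' card_Suc_Diff1 finite_Diff)
    ultimately show ?thesis using S(2) by linarith
  qed
  \<comment> \<open>Only \<open>C \<noteq> D\<close> is known, so the edge that lies in one cycle
    alone may belong to either of them.\<close>
  from CD(5) consider e where "e \<in> C" "e \<notin> D" | e where "e \<in> D" "e \<notin> C" by auto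
  then show ?thesis using main CD by cases auto
qed

text \<open>A minimal set with more edges than vertices qualifies. It contains a cycle; without one
  edge of that cycle it still has at least as many edges as vertices, so there is a second cycle. If
  it were disconnected, one of two vertex-disjoint parts would again have more edges than
  vertices.\<close>

lemma exists_connected_two_cycles:
  assumes G: "is_multigraph G" and "W \<subseteq> medges G" "card (verts_of G W) < card W"
  shows "\<exists>X \<subseteq> W. connected_two_cycles G X"
  using assms(2,3)
proof (induction "card W" arbitrary: W rule: less_induct)
  case less
  have fin: "finite W" using G less.prems by (auto simp: is_multigraph_def intro: finite_subset)
  have ends: "\<And>e. e \<in> W \<Longrightarrow> card (mends G e) \<in> {1, 2}"
    using G less.prems by (auto simp: is_multigraph_def)
  have finV: "finite (verts_of G W')" if "W' \<subseteq> W" for W'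
    using finite_verts_of G less.prems that by blast
  show ?case
  proof (cases "\<exists>W' \<subset> W. card (verts_of G W') < card W'")
    case True
    then obtain W' where W': "W' \<subset> W" "card (verts_of G W') < card W'" by auto
    then have "card W' < card W" using fin psubset_card_mono by blast
    then show ?thesis using less.hyps W' less.prems by (meson order_trans psubset_imp_subset)
  next
    case False
    then have small: "card W' \<le> card (verts_of G W')" if "W' \<subset> W" for W'
      using that by (meson not_le)
    obtain C where C: "C \<in> cycles G" "C \<subseteq> W"
      using exists_cycle[OF fin _ less.prems(1) ends] less.prems(2) by fastforce
    obtain e where e: "e \<in> C" using cycle_nonempty[OF C(1)] by auto
    have eW: "e \<in> W" using e C by auto
    have "card (verts_of G (W - {e})) \<le> card (verts_of G W)"
      using finV by (intro card_mono verts_of_mono) auto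
    also have "\<dots> \<le> card (W - {e})" using less.prems(2) eW fin by simp
    finally have le: "card (verts_of G (W - {e})) \<le> card (W - {e})" .
    have "mends G e \<noteq> {}" using ends[OF eW] by auto
    then have "card (verts_of G W) > 0"
      using eW finV[OF order_refl] by (auto simp: verts_of_def card_gt_0_iff)
    then have "card (W - {e}) > 0" using less.prems(2) eW fin by simp
    then have "W - {e} \<noteq> {}" by (metis card.empty less_irrefl)
    then obtain D where D: "D \<in> cycles G" "D \<subseteq> W - {e}"
      using exists_cycle[of "W - {e}" G] fin less.prems(1) ends le by auto
    have con: "(u, v) \<in> conn G W" if u: "u \<in> verts_of G W" and v: "v \<in> verts_of G W" for u v
    proof (rule ccontr)
      assume nuv: "(u, v) \<notin> conn G W"
      \<comment> \<open>The edges in the component of \<open>u\<close>: they share no vertex with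
        the other edges, and both parts are proper.\<close>
      define A where "A = {e \<in> W. \<exists>x \<in> mends G e. (u, x) \<in> conn G W}"
      have Aall: "(u, y) \<in> conn G W" if e: "e \<in> A" and y: "y \<in> mends G e" for e y
      proof -
        obtain x where x: "x \<in> mends G e" "(u, x) \<in> conn G W" and "e \<in> W"
          using e by (auto simp: A_def)
        obtain a b where ab: "mends G e = {a, b}" using ends[OF \<open>e \<in> W\<close>] card_ends_cases by metis
        have "(a, b) \<in> conn G W" using conn_edge[OF \<open>e \<in> W\<close> ab] .
        then have "(x, y) \<in> conn G W" using x(1) y ab conn_sym conn_refl by (metis insertE singletonD)
        then show ?thesis using x(2) conn_trans by metis
      qed
      have AW: "A \<subseteq> W" by (auto simp: A_def)
      obtain f where f: "f \<in> W" "v \<in> mends G f" using v by (auto simp: verts_of_def)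
      have "f \<notin> A" using Aall nuv f by blast
      then have 1: "A \<subset> W" using AW f by auto
      obtain g where g: "g \<in> W" "u \<in> mends G g" using u by (auto simp: verts_of_def)
      then have "g \<in> A" unfolding A_def using conn_refl by fast
      then have 2: "W - A \<subset> W" using g by auto
      have disj: "verts_of G A \<inter> verts_of G (W - A) = {}"
        using Aall by (fastforce simp: verts_of_def A_def)
      have un: "verts_of G A \<union> verts_of G (W - A) = verts_of G W"
        using AW by (auto simp: verts_of_def)
      have "card W = card A + card (W - A)"
        using AW fin by (metis card_Diff_subset card_mono finite_subset le_add_diff_inverse)
      also have "\<dots> \<le> card (verts_of G A) + card (verts_of G (W - A))"
        using small 1 2 by (meson add_mono)
      also have "\<dots> = card (verts_of G W)"
        using disj un finV AW by (metis card_Un_disjoint Diff_subset)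
      finally show False using less.prems(2) by simp
    qed
    have "C \<noteq> D" "D \<subseteq> W" using D e by auto
    moreover have "connected_graph (edge_subgraph G W)"
      using con connected_subgraph_iff[OF less.prems(1)] by simp
    ultimately have "connected_two_cycles G W"
      unfolding connected_two_cycles_def
      using C D(1) cycles_subgraph_iff[OF less.prems(1)] by metis
    then show ?thesis by blast
  qed
qed

lemma exists_bicycle:
  assumes G: "is_multigraph G" and "W \<subseteq> medges G" "card (verts_of G W) < card W"
  shows "\<exists>X \<subseteq> W. bicycle G X"
proof -
  have fin: "finite W" using G assms(2) by (auto simp: is_multigraph_def intro: finite_subset)
  let ?P = "\<lambda>X. X \<subseteq> W \<and> connected_two_cycles G X"
  obtain X0 where "?P X0" using exists_connected_two_cycles[OF assms] by blast
  then have "\<exists>X. ?P X \<and> (\<forall>Y. ?P Y \<longrightarrow> card X \<le> card Y)"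
    by (rule ex_has_least_nat)
  then obtain X where X: "X \<subseteq> W" "connected_two_cycles G X"
    and min: "\<And>Y. Y \<subseteq> W \<Longrightarrow> connected_two_cycles G Y \<Longrightarrow> card X \<le> card Y" by metis
  have "\<not> connected_two_cycles G Y" if "Y \<subset> X" for Y
  proof
    assume "connected_two_cycles G Y"
    then have "card X \<le> card Y" using min X(1) that by (meson order_trans psubset_imp_subset)
    moreover have "card Y < card X"
      using that X(1) fin by (meson finite_subset psubset_card_mono)
    ultimately show False by simp
  qed
  then have "bicycle G X" using X assms(2) unfolding bicycle_def by (meson order_trans)
  then show ?thesis using X(1) by (intro exI[of _ X]) simp
qed

text \<open>Once balanced cycles are excluded, every bicycle is a circuit, and containing no bicycle
  means that no subset has more edges than vertices. From here on this count replaces bicycles, so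
  their possible shapes never have to be listed.\<close>

theorem frame_matroid_indep_iff:
  assumes G: "is_multigraph G"
  shows "Z \<in> snd (frame_matroid \<Gamma> G \<sigma>) \<longleftrightarrow> Z \<subseteq> medges G \<and>
    (\<forall>C \<in> balanced_cycles \<Gamma> G \<sigma>. \<not> C \<subseteq> Z) \<and> (\<forall>W \<subseteq> Z. card W \<le> card (verts_of G W))"
    (is "?L \<longleftrightarrow> ?R")
proof
  assume L: ?L
  then have Z: "Z \<subseteq> medges G" "\<And>C. C \<in> frame_circuits \<Gamma> G \<sigma> \<Longrightarrow> \<not> C \<subseteq> Z"
    by (auto simp: frame_matroid_def)
  have bal: "\<not> C \<subseteq> Z" if "C \<in> balanced_cycles \<Gamma> G \<sigma>" for C
    using Z(2) that by (auto simp: frame_circuits_def)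
  have "card W \<le> card (verts_of G W)" if W: "W \<subseteq> Z" for W
  proof (rule ccontr)
    assume "\<not> ?thesis"
    then obtain X where X: "X \<subseteq> W" "bicycle G X"
      using exists_bicycle[OF G, of W] W Z(1) by auto
    then have "X \<in> frame_circuits \<Gamma> G \<sigma>"
      unfolding frame_circuits_def using bal W by blast
    then show False using Z(2) X W by blast
  qed
  then show ?R using Z bal by blast
next
  assume R: ?R
  have "\<not> C \<subseteq> Z" if C: "C \<in> frame_circuits \<Gamma> G \<sigma>" for C
  proof
    assume CZ: "C \<subseteq> Z"
    then have "bicycle G C" using C R by (auto simp: frame_circuits_def)
    then have "card (verts_of G C) < card C"
      using connected_two_cycles_card[OF G] by (auto simp: bicycle_def)
    then show False using R CZ by (meson not_le)
  qed
  then show ?L using R by (auto simp: frame_matroid_def)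
qed

section \<open>Finite index of definable classes\<close>

text \<open>With \<open>P\<close> fixed, a hypergraph is given by its ground set, and gluing amounts
  to a union of ground sets.\<close>

definition restricted_hypergraph :: "('e set \<Rightarrow> bool) \<Rightarrow> 'e set \<Rightarrow> 'e hypergraph" where
  "restricted_hypergraph P E = (E, {Z. Z \<subseteq> E \<and> P Z})"

lemma restricted_hypergraph_simps [simp]:
  "fst (restricted_hypergraph P E) = E"
  "Z \<in> snd (restricted_hypergraph P E) \<longleftrightarrow> Z \<subseteq> E \<and> P Z"
  by (simp_all add: restricted_hypergraph_def)

lemma is_hypergraph_restricted: "finite E \<Longrightarrow> is_hypergraph (restricted_hypergraph P E)"
  by (auto simp: is_hypergraph_def restricted_hypergraph_def)

definition assigned :: "'e set \<Rightarrow> 'e set \<Rightarrow> (nat \<Rightarrow> 'e set) \<Rightarrow> bool" where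
  "assigned L E \<nu> \<longleftrightarrow> finite E \<and> E \<subseteq> L \<and> (\<forall>i. \<nu> i \<subseteq> E)"

lemma assignedD:
  assumes "assigned L E \<nu>"
  shows "finite E" "E \<subseteq> L" "\<nu> i \<subseteq> E" "finite (\<nu> i)" "\<nu> i \<subseteq> L"
  using assms unfolding assigned_def by (auto intro: finite_subset)

lemma assigned_upd: "assigned L E \<nu> \<Longrightarrow> X \<subseteq> E \<Longrightarrow> assigned L E (\<nu>(i := X))"
  by (simp add: assigned_def)

abbreviation sat_union ::
    "('e set \<Rightarrow> bool) \<Rightarrow> 'e set \<Rightarrow> (nat \<Rightarrow> 'e set) \<Rightarrow> 'e set \<Rightarrow> (nat \<Rightarrow> 'e set) \<Rightarrow> cmso \<Rightarrow> bool" where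
  "sat_union P E \<nu> D \<mu> \<equiv> sat (restricted_hypergraph P (E \<union> D)) (\<lambda>i. \<nu> i \<union> \<mu> i)"

text \<open>\<open>\<tau>\<close> is the type of the left part with its assignment. It is coded as a
  natural number for every formula, so that the sets of types that arise at quantifiers stay in the
  same HOL type.\<close>

definition index_bounded ::
    "('e set \<Rightarrow> bool) \<Rightarrow> 'e set \<Rightarrow> 'e set \<Rightarrow> cmso \<Rightarrow> ('e set \<Rightarrow> (nat \<Rightarrow> 'e set) \<Rightarrow> nat) \<Rightarrow> nat set \<Rightarrow> bool" where
  "index_bounded P L R \<phi> \<tau> S \<longleftrightarrow> finite S \<and> (\<forall>E \<nu>. assigned L E \<nu> \<longrightarrow> \<tau> E \<nu> \<in> S) \<and>
    (\<forall>E \<nu> E' \<nu>' D \<mu>. assigned L E \<nu> \<longrightarrow> assigned L E' \<nu>' \<longrightarrow> assigned R D \<mu> \<longrightarrow> \<tau> E \<nu> = \<tau> E' \<nu>' \<longrightarrow>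
       sat_union P E \<nu> D \<mu> \<phi> = sat_union P E' \<nu>' D \<mu> \<phi>)"

lemma index_boundedI:
  fixes \<tau> :: "'e set \<Rightarrow> (nat \<Rightarrow> 'e set) \<Rightarrow> nat"
  assumes "finite S" "\<And>E \<nu>. assigned L E \<nu> \<Longrightarrow> \<tau> E \<nu> \<in> S"
    and "\<And>E \<nu> E' \<nu>' D \<mu>. assigned L E \<nu> \<Longrightarrow> assigned L E' \<nu>' \<Longrightarrow> assigned R D \<mu> \<Longrightarrow> \<tau> E \<nu> = \<tau> E' \<nu>' \<Longrightarrow>
       sat_union P E \<nu> D \<mu> \<phi> = sat_union P E' \<nu>' D \<mu> \<phi>"
  shows "\<exists>\<tau> S. index_bounded P L R \<phi> \<tau> S"
proof (intro exI)
  show "index_bounded P L R \<phi> \<tau> S"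
    unfolding index_bounded_def by (intro conjI allI impI assms)
qed

lemma index_boundedD:
  assumes "index_bounded P L R \<phi> \<tau> S"
  shows "finite S" "\<And>E \<nu>. assigned L E \<nu> \<Longrightarrow> \<tau> E \<nu> \<in> S"
    and "\<And>E \<nu> E' \<nu>' D \<mu>. assigned L E \<nu> \<Longrightarrow> assigned L E' \<nu>' \<Longrightarrow> assigned R D \<mu> \<Longrightarrow> \<tau> E \<nu> = \<tau> E' \<nu>' \<Longrightarrow>
       sat_union P E \<nu> D \<mu> \<phi> = sat_union P E' \<nu>' D \<mu> \<phi>"
  using assms unfolding index_bounded_def by blast+

text \<open>A composition argument in the manner of Feferman and Vaught. The state
  \<open>s Z\<close> decides how a left set \<open>Z\<close> behaves under \<open>P\<close>, which
  settles the case \<open>Hyp\<close>; cardinalities modulo \<open>q\<close> add up over the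
  disjoint sides; and the type for a quantifier is the set of types of all ways to choose the left
  part of the new set.\<close>

lemma cmso_index_bounded:
  fixes s :: "'e set \<Rightarrow> 'q"
  assumes disj: "L \<inter> R = {}"
    and Q: "finite Q" "\<And>Z. Z \<subseteq> L \<Longrightarrow> finite Z \<Longrightarrow> s Z \<in> Q"
    and P: "\<And>Z Z' Y. Z \<subseteq> L \<Longrightarrow> finite Z \<Longrightarrow> Z' \<subseteq> L \<Longrightarrow> finite Z' \<Longrightarrow> Y \<subseteq> R \<Longrightarrow> finite Y \<Longrightarrow>
              s Z = s Z' \<Longrightarrow> P (Z \<union> Y) = P (Z' \<union> Y)"
    and "wf_cmso \<phi>"
  shows "\<exists>\<tau> S. index_bounded P L R \<phi> \<tau> S"
  using \<open>wf_cmso \<phi>\<close>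
proof (induction \<phi>)
  case (Subset i j)
  have *: "\<nu> i \<union> \<mu> i \<subseteq> \<nu> j \<union> \<mu> j \<longleftrightarrow> \<nu> i \<subseteq> \<nu> j \<and> \<mu> i \<subseteq> \<mu> j"
    if "assigned L E \<nu>" "assigned R D \<mu>" for \<nu> \<mu> E D
    using assignedD(5)[OF that(1), of i] assignedD(5)[OF that(1), of j]
      assignedD(5)[OF that(2), of i] assignedD(5)[OF that(2), of j] disj by blast
  show ?case
  proof (rule index_boundedI[of "{0, 1}" _ "\<lambda>E \<nu>. if \<nu> i \<subseteq> \<nu> j then 1 else 0"])
    fix E \<nu> E' \<nu>' D \<mu>
    assume **: "assigned L E \<nu>" "assigned L E' \<nu>'" "assigned R D \<mu>"
      "(if \<nu> i \<subseteq> \<nu> j then 1 else 0) = (if \<nu>' i \<subseteq> \<nu>' j then 1 else (0 :: nat))"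
    then have "\<nu> i \<subseteq> \<nu> j \<longleftrightarrow> \<nu>' i \<subseteq> \<nu>' j" by (metis zero_neq_one)
    then show "sat_union P E \<nu> D \<mu> (Subset i j) = sat_union P E' \<nu>' D \<mu> (Subset i j)"
      unfolding sat.simps *[OF **(1,3)] *[OF **(2,3)] by simp
  qed auto
next
  case (Hyp i)
  have inj: "inj_on (to_nat_on Q) Q" using Q(1) by (simp add: countable_finite inj_on_to_nat_on)
  show ?case
  proof (rule index_boundedI[of "to_nat_on Q ` Q" _ "\<lambda>E \<nu>. to_nat_on Q (s (\<nu> i))"])
    fix E \<nu> E' \<nu>' D \<mu>
    assume *: "assigned L E \<nu>" "assigned L E' \<nu>'" "assigned R D \<mu>"
      "to_nat_on Q (s (\<nu> i)) = to_nat_on Q (s (\<nu>' i))"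
    then have "s (\<nu> i) = s (\<nu>' i)" using inj Q(2) assignedD(4,5) by (meson inj_onD)
    then have "P (\<nu> i \<union> \<mu> i) = P (\<nu>' i \<union> \<mu> i)"
      using P assignedD(4,5)[OF *(1)] assignedD(4,5)[OF *(2)] assignedD(4,5)[OF *(3)] by metis
    moreover have "\<nu> i \<union> \<mu> i \<subseteq> E \<union> D" "\<nu>' i \<union> \<mu> i \<subseteq> E' \<union> D"
      using * assignedD(3) by (meson Un_mono)+
    ultimately show "sat_union P E \<nu> D \<mu> (Hyp i) = sat_union P E' \<nu>' D \<mu> (Hyp i)"
      by simp
  qed (use Q(1) in simp, intro imageI Q(2) assignedD(4) assignedD(5))
next
  case (Card_mod i p q)
  have q: "q > 0" using Card_mod by simp
  show ?case
  proof (rule index_boundedI[of "{..<q}" _ "\<lambda>E \<nu>. card (\<nu> i) mod q"])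
    fix E \<nu> E' \<nu>' D \<mu>
    assume *: "assigned L E \<nu>" "assigned L E' \<nu>'" "assigned R D \<mu>"
      "card (\<nu> i) mod q = card (\<nu>' i) mod q"
    have "\<nu> i \<inter> \<mu> i = {}" "\<nu>' i \<inter> \<mu> i = {}"
      using assignedD(5)[OF *(1), of i] assignedD(5)[OF *(2), of i] assignedD(5)[OF *(3), of i] disj by blast+
    then have "card (\<nu> i \<union> \<mu> i) = card (\<nu> i) + card (\<mu> i)"
      "card (\<nu>' i \<union> \<mu> i) = card (\<nu>' i) + card (\<mu> i)"
      using * assignedD(4) by (meson card_Un_disjoint)+
    then have "card (\<nu> i \<union> \<mu> i) mod q = card (\<nu>' i \<union> \<mu> i) mod q"
      using *(4) by (metis mod_add_left_eq)
    then show "sat_union P E \<nu> D \<mu> (Card_mod i p q) = sat_union P E' \<nu>' D \<mu> (Card_mod i p q)"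
      by (simp add: unique_euclidean_semiring_class.cong_def)
  qed (use q in auto)
next
  case (Neg \<phi>)
  then obtain \<tau> S where 1: "index_bounded P L R \<phi> \<tau> S" by auto
  show ?case
  proof (rule index_boundedI[of S _ \<tau>])
    fix E \<nu> E' \<nu>' D \<mu>
    assume *: "assigned L E \<nu>" "assigned L E' \<nu>'" "assigned R D \<mu>" "\<tau> E \<nu> = \<tau> E' \<nu>'"
    show "sat_union P E \<nu> D \<mu> (Neg \<phi>) = sat_union P E' \<nu>' D \<mu> (Neg \<phi>)"
      using index_boundedD(3)[OF 1 *] by simp
  qed (use index_boundedD(1,2)[OF 1] in auto)
next
  case (Conj \<phi> \<psi>)
  then obtain \<tau>1 S1 \<tau>2 S2 where 1: "index_bounded P L R \<phi> \<tau>1 S1" and 2: "index_bounded P L R \<psi> \<tau>2 S2"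
    by auto
  show ?case
  proof (rule index_boundedI[of "prod_encode ` (S1 \<times> S2)" _ "\<lambda>E \<nu>. prod_encode (\<tau>1 E \<nu>, \<tau>2 E \<nu>)"])
    fix E \<nu> E' \<nu>' D \<mu>
    assume *: "assigned L E \<nu>" "assigned L E' \<nu>'" "assigned R D \<mu>"
      "prod_encode (\<tau>1 E \<nu>, \<tau>2 E \<nu>) = prod_encode (\<tau>1 E' \<nu>', \<tau>2 E' \<nu>')"
    then have "\<tau>1 E \<nu> = \<tau>1 E' \<nu>'" "\<tau>2 E \<nu> = \<tau>2 E' \<nu>'" by simp_all
    then show "sat_union P E \<nu> D \<mu> (Conj \<phi> \<psi>) = sat_union P E' \<nu>' D \<mu> (Conj \<phi> \<psi>)"
      using index_boundedD(3)[OF 1 *(1-3)] index_boundedD(3)[OF 2 *(1-3)] by simp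
  qed (use index_boundedD(1,2)[OF 1] index_boundedD(1,2)[OF 2] in auto)
next
  case (Exists i \<phi>)
  then obtain \<tau> S where 1: "index_bounded P L R \<phi> \<tau> S" by auto
  let ?A = "\<lambda>E \<nu>. {\<tau> E (\<nu>(i := X)) | X. X \<subseteq> E}"
  have sub: "?A E \<nu> \<subseteq> S" if "assigned L E \<nu>" for E \<nu>
    using index_boundedD(2)[OF 1] assigned_upd[OF that] by auto
  \<comment> \<open>The witness is cut into \<open>X \<inter> E\<close> and
    \<open>X \<inter> D\<close>. The first is replaced by a subset of \<open>E'\<close> of the same
    type, the second is kept.\<close>
  have dir: "sat_union P E' \<nu>' D \<mu> (Exists i \<phi>)"
    if *: "assigned L E \<nu>" "assigned L E' \<nu>'" "assigned R D \<mu>" and eq: "?A E \<nu> = ?A E' \<nu>'"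
      and sat: "sat_union P E \<nu> D \<mu> (Exists i \<phi>)"
    for E \<nu> E' \<nu>' D \<mu>
  proof -
    obtain X where X: "X \<subseteq> E \<union> D"
      "sat (restricted_hypergraph P (E \<union> D)) ((\<lambda>i. \<nu> i \<union> \<mu> i)(i := X)) \<phi>"
      using sat by auto
    have "\<tau> E (\<nu>(i := X \<inter> E)) \<in> ?A E \<nu>" by auto
    then obtain X' where X': "X' \<subseteq> E'" "\<tau> E (\<nu>(i := X \<inter> E)) = \<tau> E' (\<nu>'(i := X'))"
      using eq by auto
    have e1: "(\<lambda>i. \<nu> i \<union> \<mu> i)(i := X) = (\<lambda>j. (\<nu>(i := X \<inter> E)) j \<union> (\<mu>(i := X \<inter> D)) j)"
      using X(1) by (auto simp: fun_eq_iff)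
    have e2: "(\<lambda>i. \<nu>' i \<union> \<mu> i)(i := X' \<union> X \<inter> D) = (\<lambda>j. (\<nu>'(i := X')) j \<union> (\<mu>(i := X \<inter> D)) j)"
      by (auto simp: fun_eq_iff)
    have "sat_union P E (\<nu>(i := X \<inter> E)) D (\<mu>(i := X \<inter> D)) \<phi> = sat_union P E' (\<nu>'(i := X')) D (\<mu>(i := X \<inter> D)) \<phi>"
      by (rule index_boundedD(3)[OF 1]) (rule assigned_upd * X' Int_lower2)+
    then have "sat (restricted_hypergraph P (E' \<union> D)) ((\<lambda>i. \<nu>' i \<union> \<mu> i)(i := X' \<union> X \<inter> D)) \<phi>"
      using X(2) unfolding e1 e2 by simp
    moreover have "X' \<union> X \<inter> D \<subseteq> E' \<union> D" using X' by auto
    ultimately show ?thesis unfolding sat.simps restricted_hypergraph_simps by blast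
  qed
  show ?case
  proof (rule index_boundedI[of "set_encode ` Pow S" _ "\<lambda>E \<nu>. set_encode (?A E \<nu>)"])
    fix E \<nu> E' \<nu>' D \<mu>
    assume *: "assigned L E \<nu>" "assigned L E' \<nu>'" "assigned R D \<mu>"
      and eq': "set_encode (?A E \<nu>) = set_encode (?A E' \<nu>')"
    have "finite (?A E \<nu>)" "finite (?A E' \<nu>')"
      using sub[OF *(1)] sub[OF *(2)] index_boundedD(1)[OF 1] by (meson finite_subset)+
    from set_encode_eq[OF this] have eq: "?A E \<nu> = ?A E' \<nu>'" using eq' by (rule iffD1)
    show "sat_union P E \<nu> D \<mu> (Exists i \<phi>) = sat_union P E' \<nu>' D \<mu> (Exists i \<phi>)"
      using dir[OF *(1-3) eq] dir[OF *(2,1,3) eq[symmetric]] by (rule iffI)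
  next
    fix E \<nu> assume "assigned L E \<nu>"
    then show "set_encode (?A E \<nu>) \<in> set_encode ` Pow S" by (intro imageI PowI sub)
  qed (use index_boundedD(1)[OF 1] in simp)
qed

theorem models_finite_index:
  fixes s :: "'e set \<Rightarrow> 'q"
  assumes "L \<inter> R = {}"
    and "finite Q" "\<And>Z. Z \<subseteq> L \<Longrightarrow> finite Z \<Longrightarrow> s Z \<in> Q"
    and "\<And>Z Z' Y. Z \<subseteq> L \<Longrightarrow> finite Z \<Longrightarrow> Z' \<subseteq> L \<Longrightarrow> finite Z' \<Longrightarrow> Y \<subseteq> R \<Longrightarrow> finite Y \<Longrightarrow>
           s Z = s Z' \<Longrightarrow> P (Z \<union> Y) = P (Z' \<union> Y)"
    and "wf_cmso \<phi>"
  obtains \<tau> :: "'e set \<Rightarrow> nat" and S where "finite S"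
    "\<And>E. finite E \<Longrightarrow> E \<subseteq> L \<Longrightarrow> \<tau> E \<in> S"
    "\<And>E E' D. finite E \<Longrightarrow> E \<subseteq> L \<Longrightarrow> finite E' \<Longrightarrow> E' \<subseteq> L \<Longrightarrow> finite D \<Longrightarrow> D \<subseteq> R \<Longrightarrow> \<tau> E = \<tau> E' \<Longrightarrow>
       models (restricted_hypergraph P (E \<union> D)) \<phi> \<longleftrightarrow> models (restricted_hypergraph P (E' \<union> D)) \<phi>"
proof -
  obtain \<tau> S where 1: "index_bounded P L R \<phi> \<tau> S"
    using cmso_index_bounded[of L R Q s P \<phi>, OF assms] by blast
  have a: "assigned L' E (\<lambda>_. {})" if "finite E" "E \<subseteq> L'" for E L' :: "'e set"
    using that by (simp add: assigned_def)
  show ?thesis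
  proof (rule that[of S "\<lambda>E. \<tau> E (\<lambda>_. {})"])
    fix E E' D
    assume "finite E" "E \<subseteq> L" "finite E'" "E' \<subseteq> L" "finite D" "D \<subseteq> R" "\<tau> E (\<lambda>_. {}) = \<tau> E' (\<lambda>_. {})"
    then show "models (restricted_hypergraph P (E \<union> D)) \<phi> \<longleftrightarrow> models (restricted_hypergraph P (E' \<union> D)) \<phi>"
      using index_boundedD(3)[OF 1 a a a, of E E' D] by (simp add: models_def)
  qed (use index_boundedD[OF 1] a in auto)
qed

section \<open>Gadgets\<close>

text \<open>
  The vertices 0 and 1 are the terminals, called \<open>False\<close> and \<open>True\<close> in kinds, and \<open>i + 2\<close> is the
  vertex of the patch \<open>i\<close>, which is adjacent to the terminals only.
\<close>

datatype kind = At bool | Link | To bool nat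

fun ends_of_kind :: "kind \<Rightarrow> nat set" where
  "ends_of_kind (At c) = {of_bool c}"
| "ends_of_kind Link = {0, 1}"
| "ends_of_kind (To c i) = {of_bool c, i + 2}"

definition patches :: "('e \<Rightarrow> kind) \<Rightarrow> 'e set \<Rightarrow> nat set" where
  "patches \<kappa> Z = {i. \<exists>e \<in> Z. \<exists>c. \<kappa> e = To c i}"

text \<open>Positions on the line spanned by the terminals: the position of a joint, or that of the
  links with a given label.\<close>

datatype 'p point = Joint bool | Point 'p

text \<open>
  Contracting one edge of a patch turns each further edge into a point of the line spanned by the
  terminals, so a patch with \<open>n > 0\<close> edges contributes \<open>n - 1\<close> to the at most two points that an
  independent set has on that line, and a pair of its edges acts as one edge at the terminals.
\<close>

inductive unit_point ::
    "('e \<Rightarrow> kind) \<Rightarrow> ('e \<Rightarrow> 'p) \<Rightarrow> ('e \<Rightarrow> 'e \<Rightarrow> 'p) \<Rightarrow> 'e set \<Rightarrow> 'p point \<Rightarrow> bool"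
  for \<kappa> lab pv where
  At: "\<kappa> e = At c \<Longrightarrow> unit_point \<kappa> lab pv {e} (Joint c)"
| Link: "\<kappa> e = Link \<Longrightarrow> unit_point \<kappa> lab pv {e} (Point (lab e))"
| Same: "e \<noteq> f \<Longrightarrow> \<kappa> e = To c i \<Longrightarrow> \<kappa> f = To c i \<Longrightarrow> unit_point \<kappa> lab pv {e, f} (Joint c)"
| Mixed: "\<kappa> s = To True i \<Longrightarrow> \<kappa> t = To False i \<Longrightarrow> unit_point \<kappa> lab pv {s, t} (Point (pv s t))"

text \<open>After contraction of one edge per patch: at most two points remain on a line of rank
  two, and no point is taken twice. The labels are formal, so the same predicate describes gadgets
  with actual gains and gadgets of which no representation is known.\<close>

definition load_indep ::
    "('e \<Rightarrow> kind) \<Rightarrow> ('e \<Rightarrow> 'p) \<Rightarrow> ('e \<Rightarrow> 'e \<Rightarrow> 'p) \<Rightarrow> 'e set \<Rightarrow> bool" where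
  "load_indep \<kappa> lab pv Z \<longleftrightarrow> card Z \<le> card (patches \<kappa> Z) + 2 \<and>
     (\<forall>U U' v. U \<subseteq> Z \<longrightarrow> U' \<subseteq> Z \<longrightarrow> unit_point \<kappa> lab pv U v \<longrightarrow> unit_point \<kappa> lab pv U' v \<longrightarrow> U = U')"

definition gadget :: "('e \<Rightarrow> kind) \<Rightarrow> 'e set \<Rightarrow> (nat, 'e) multigraph" where
  "gadget \<kappa> E = \<lparr>mverts = {0, 1} \<union> (\<lambda>i. i + 2) ` patches \<kappa> E, medges = E,
     mends = (\<lambda>e. ends_of_kind (\<kappa> e))\<rparr>"

text \<open>Edges are oriented towards the smaller vertex, so links have their gain from 1 to 0.\<close>

definition gadget_gain :: "('a, 'm) monoid_scheme \<Rightarrow> ('e \<Rightarrow> 'a) \<Rightarrow> 'e \<Rightarrow> nat \<Rightarrow> nat \<Rightarrow> 'a" where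
  "gadget_gain \<Gamma> g e u v = (if v \<le> u then g e else inv\<^bsub>\<Gamma>\<^esub> (g e))"

lemma gadget_simps [simp]:
  "medges (gadget \<kappa> E) = E" "mends (gadget \<kappa> E) e = ends_of_kind (\<kappa> e)"
  by (simp_all add: gadget_def)

section \<open>Counting units and patches in a gadget\<close>

lemma patches_finite: "finite Z \<Longrightarrow> finite (patches \<kappa> Z) \<and> card (patches \<kappa> Z) \<le> card Z"
proof -
  assume Z: "finite Z"
  have "patches \<kappa> Z \<subseteq> (\<lambda>e. case \<kappa> e of To c i \<Rightarrow> i | _ \<Rightarrow> 0) ` Z"
    by (force simp: patches_def)
  then show ?thesis using Z by (meson surj_card_le finite_surj)
qed

lemma patches_mono: "W \<subseteq> Z \<Longrightarrow> patches \<kappa> W \<subseteq> patches \<kappa> Z"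
  by (auto simp: patches_def)

lemma patches_Un: "patches \<kappa> (Y \<union> Z) = patches \<kappa> Y \<union> patches \<kappa> Z"
  by (auto simp: patches_def)

lemma is_multigraph_gadget: "finite E \<Longrightarrow> is_multigraph (gadget \<kappa> E)"
proof -
  assume E: "finite E"
  have "ends_of_kind (\<kappa> e) \<subseteq> {0, 1} \<union> (\<lambda>i. i + 2) ` patches \<kappa> E \<and> card (ends_of_kind (\<kappa> e)) \<in> {1, 2}"
    if "e \<in> E" for e
    using that by (cases "\<kappa> e") (auto simp: patches_def of_bool_def card_insert_if)
  then show ?thesis
    using E patches_finite[OF E] by (simp add: is_multigraph_def) (simp add: gadget_def)
qed

lemma is_gaining_gadget:
  assumes "group \<Gamma>" "\<And>e. e \<in> E \<Longrightarrow> g e \<in> carrier \<Gamma>"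
  shows "is_gaining \<Gamma> (gadget \<kappa> E) (gadget_gain \<Gamma> g)"
  using assms by (auto simp: is_gaining_def gadget_gain_def group.inv_inv group.inv_closed)

lemma verts_of_gadget:
  "verts_of (gadget \<kappa> E) W =
     {v \<in> {0, 1}. \<exists>e \<in> W. v \<in> ends_of_kind (\<kappa> e)} \<union> (\<lambda>i. i + 2) ` patches \<kappa> W"
proof (intro subset_antisym subsetI)
  fix v assume "v \<in> verts_of (gadget \<kappa> E) W"
  then obtain e where e: "e \<in> W" "v \<in> ends_of_kind (\<kappa> e)" by (auto simp: verts_of_def)
  then have "v \<in> {0, 1} \<or> v \<in> (\<lambda>i. i + 2) ` patches \<kappa> W"
    by (cases "\<kappa> e") (auto simp: patches_def of_bool_def split: if_splits)
  then show "v \<in> {v \<in> {0, 1}. \<exists>e \<in> W. v \<in> ends_of_kind (\<kappa> e)} \<union> (\<lambda>i. i + 2) ` patches \<kappa> W"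
    using e by blast
next
  fix v assume "v \<in> {v \<in> {0, 1}. \<exists>e \<in> W. v \<in> ends_of_kind (\<kappa> e)} \<union> (\<lambda>i. i + 2) ` patches \<kappa> W"
  then show "v \<in> verts_of (gadget \<kappa> E) W"
    by (force simp: verts_of_def patches_def)
qed

lemma card_verts_of_gadget:
  assumes "finite W"
  shows "card (verts_of (gadget \<kappa> E) W) =
    card {v \<in> {0, 1}. \<exists>e \<in> W. v \<in> ends_of_kind (\<kappa> e)} + card (patches \<kappa> W)"
  unfolding verts_of_gadget using patches_finite[OF assms]
  by (subst card_Un_disjoint) (auto simp: card_image inj_on_def)

text \<open>Such a set has patch edges only, and any two edges of one patch form a unit, at a joint
  if they share the terminal and at a \<open>Point\<close> otherwise. So there is at most one edge
  per patch.\<close>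

lemma no_units_card:
  assumes "finite W" "\<And>U v. U \<subseteq> W \<Longrightarrow> \<not> unit_point \<kappa> lab pv U v"
  shows "card W \<le> card (patches \<kappa> W)"
proof -
  have k: "\<exists>c i. \<kappa> e = To c i" if "e \<in> W" for e
    using assms(2)[of "{e}"] that by (cases "\<kappa> e") (auto intro: unit_point.intros)
  let ?i = "\<lambda>e. case \<kappa> e of To c i \<Rightarrow> i | _ \<Rightarrow> 0"
  have "inj_on ?i W"
  proof (rule inj_onI, rule ccontr)
    fix e f assume ef: "e \<in> W" "f \<in> W" "?i e = ?i f" "e \<noteq> f"
    obtain c i d where cd: "\<kappa> e = To c i" "\<kappa> f = To d i"
      using k[OF ef(1)] k[OF ef(2)] ef(3) by (auto simp del: not_ex)
    have "\<exists>v. unit_point \<kappa> lab pv {e, f} v"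
    proof (cases "c = d")
      case True
      then show ?thesis using unit_point.Same[of e f \<kappa> c i lab pv] cd ef(4) by blast
    next
      case False
      then have "c \<and> \<not> d \<or> d \<and> \<not> c" by blast
      then show ?thesis using cd unit_point.Mixed[of \<kappa> e i f] unit_point.Mixed[of \<kappa> f i e]
        by (auto simp: insert_commute) blast+
    qed
    then show False using assms(2)[of "{e, f}"] ef by auto
  qed
  then have "card W = card (?i ` W)" by (simp add: card_image)
  also have "?i ` W \<subseteq> patches \<kappa> W" using k by (fastforce simp: patches_def)
  then have "card (?i ` W) \<le> card (patches \<kappa> W)" using patches_finite[OF assms(1)] by (meson card_mono)
  finally show ?thesis .
qed

lemma unit_point_finite: "unit_point \<kappa> lab pv U v \<Longrightarrow> finite U \<and> U \<noteq> {}"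
  by (induction rule: unit_point.induct) auto

lemma unit_point_shape:
  assumes "unit_point \<kappa> lab pv U v"
  obtains e where "U = {e}" "patches \<kappa> U = {}"
  | e f i where "U = {e, f}" "e \<noteq> f" "\<And>W. W \<subseteq> U \<Longrightarrow> W \<noteq> {} \<Longrightarrow> patches \<kappa> W = {i}"
  using assms
proof cases
  case (Same e f c i)
  then show ?thesis using that(2)[of e f i] by (fastforce simp: patches_def)
next
  case (Mixed s i t)
  then show ?thesis using that(2)[of s t i] by (fastforce simp: patches_def)
qed (use that(1) in \<open>auto simp: patches_def\<close>)

text \<open>A unit has one edge more than it has patches. Disjoint units add up their excess;
  distinct units that meet are two pairs in one patch, with at least three edges together.\<close>

lemma two_units_card:
  assumes U: "unit_point \<kappa> lab pv U v" "unit_point \<kappa> lab pv U' v'" and ne: "U \<noteq> U'"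
  shows "card (patches \<kappa> (U \<union> U')) + 2 \<le> card (U \<union> U')"
proof -
  have c: "card W = card (patches \<kappa> W) + 1 \<and> finite W \<and> card (patches \<kappa> W) \<le> 1"
    if "unit_point \<kappa> lab pv W w" for W w
    using that by (cases rule: unit_point_shape) auto
  show ?thesis
  proof (cases "U \<inter> U' = {}")
    case True
    then have "card (U \<union> U') = card U + card U'" using c[OF U(1)] c[OF U(2)]
      by (simp add: card_Un_disjoint)
    then show ?thesis
      using c[OF U(1)] c[OF U(2)] card_Un_le[of "patches \<kappa> U" "patches \<kappa> U'"] by (simp add: patches_Un)
  next
    case False
    then obtain e where e: "e \<in> U" "e \<in> U'" by auto
    have one: "patches \<kappa> {e} = patches \<kappa> W" if "unit_point \<kappa> lab pv W w" "e \<in> W" for W w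
      using that by (cases rule: unit_point_shape) auto
    have eq: "patches \<kappa> U = patches \<kappa> U'" using one[OF U(1) e(1)] one[OF U(2) e(2)] by simp
    then have "card U = card U'" using c[OF U(1)] c[OF U(2)] by simp
    moreover have "\<not> U' \<subseteq> U" using ne calculation c[OF U(1)] by (metis card_subset_eq)
    then have "card U < card (U \<union> U')" using c[OF U(1)] c[OF U(2)] by (intro psubset_card_mono) auto
    ultimately show ?thesis using c[OF U(1)] eq by (simp add: patches_Un)
  qed
qed

text \<open>If \<open>W\<close> reaches both terminals, the bound for \<open>Z\<close> passes to
  \<open>W\<close>, because the edges of \<open>Z - W\<close> account for at most one patch each. If
  the terminal \<open>c\<close> is missed, all units in \<open>W\<close> sit at the single point
  \<open>Joint (\<not> c)\<close>, so there is at most one unit, and removing one of its edges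
  leaves no unit at all.\<close>

lemma load_indep_card:
  assumes Z: "finite Z" "load_indep \<kappa> lab pv Z" and W: "W \<subseteq> Z"
  shows "card W \<le> card (verts_of (gadget \<kappa> E) W)"
proof -
  let ?J = "{v \<in> {0, 1 :: nat}. \<exists>e \<in> W. v \<in> ends_of_kind (\<kappa> e)}"
  have fW: "finite W" using W Z(1) finite_subset by blast
  have "card Z \<le> card (patches \<kappa> Z) + 2" using Z(2) by (simp add: load_indep_def)
  also have "patches \<kappa> Z = patches \<kappa> W \<union> patches \<kappa> (Z - W)"
    using W patches_Un[of \<kappa> W "Z - W"] by (simp add: Un_absorb1)
  also have "card (patches \<kappa> W \<union> patches \<kappa> (Z - W)) \<le> card (patches \<kappa> W) + card (Z - W)"
    by (rule order_trans[OF card_Un_le]) (use patches_finite[of "Z - W" \<kappa>] Z(1) in simp)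
  finally have 2: "card W \<le> card (patches \<kappa> W) + 2"
    using card_mono[OF Z(1) W] by (simp add: card_Diff_subset[OF fW W])
  have "card W \<le> card (patches \<kappa> W) + card ?J"
  proof (cases "\<exists>c. of_bool c \<notin> ?J")
    case False
    then have "of_bool False \<in> ?J" "of_bool True \<in> ?J" by blast+
    then have "?J = {0, 1}" by auto
    then show ?thesis using 2 by simp
  next
    case True
    then obtain c where c: "of_bool c \<notin> ?J" by auto
    have k: "\<kappa> e = At (\<not> c) \<or> (\<exists>i. \<kappa> e = To (\<not> c) i)" if "e \<in> W" for e
      using that c by (cases "\<kappa> e") (auto simp: of_bool_def split: if_splits)
    have J: "v = Joint (\<not> c)" if U: "U \<subseteq> W" "unit_point \<kappa> lab pv U v" for U v
      using U(2)
    proof (cases rule: unit_point.cases)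
      case (At e d)
      then show ?thesis using k[of e] U(1) by auto
    next
      case (Link e)
      then show ?thesis using k[of e] U(1) by auto
    next
      case (Same e f d i)
      then show ?thesis using k[of e] U(1) by auto
    next
      case (Mixed s i t)
      then show ?thesis using k[of s] k[of t] U(1) by auto
    qed
    have uniq: "U = U'" if "U \<subseteq> W" "U' \<subseteq> W" "unit_point \<kappa> lab pv U v" "unit_point \<kappa> lab pv U' v'"
      for U U' v v'
    proof -
      have "v = v'" using J that by metis
      then show ?thesis using that Z(2) W unfolding load_indep_def by (meson order_trans)
    qed
    show ?thesis
    proof (cases "\<exists>U v. U \<subseteq> W \<and> unit_point \<kappa> lab pv U v")
      case False
      then show ?thesis using no_units_card[OF fW, of \<kappa> lab pv] by (meson trans_le_add1)
    next
      case True
      then obtain U v where U: "U \<subseteq> W" "unit_point \<kappa> lab pv U v" by auto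
      obtain e where e: "e \<in> U" using unit_point_finite[OF U(2)] by auto
      have "card (W - {e}) \<le> card (patches \<kappa> (W - {e}))"
        by (rule no_units_card[of _ _ lab pv]) (use fW uniq[OF U(1) _ U(2)] e in auto)
      also have "\<dots> \<le> card (patches \<kappa> W)"
        using patches_finite[OF fW] by (intro card_mono patches_mono) auto
      finally have le: "card W \<le> card (patches \<kappa> W) + 1" using e U(1) fW
        by (simp add: card_Diff_singleton_if split: if_splits)
      have eW: "e \<in> W" using e U(1) by blast
      have "of_bool (\<not> c) \<in> ends_of_kind (\<kappa> e)" using k[OF eW] by (elim disjE exE) simp_all
      moreover have "of_bool (\<not> c) \<in> {0, 1 :: nat}" by (simp add: of_bool_def)
      ultimately have "of_bool (\<not> c) \<in> ?J" using eW by blast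
      then have "?J \<noteq> {}" by blast
      moreover have "finite ?J" by simp
      ultimately have "card ?J > 0" using card_gt_0_iff[of ?J] by blast
      then show ?thesis using le by linarith
    qed
  qed
  then show ?thesis using card_verts_of_gadget[OF fW, of \<kappa> E] by simp
qed


section \<open>Gains of walks and the cycles of a gadget\<close>

lemma walk_gain_closed:
  assumes "group \<Gamma>" "is_gaining \<Gamma> G \<sigma>"
  shows "walk G u p v \<Longrightarrow> walk_gain \<Gamma> \<sigma> p \<in> carrier \<Gamma>"
  using assms
proof (induction G u p v rule: walk.induct)
  case (2 G u e a b p v)
  interpret group \<Gamma> using 2 by simp
  have "\<sigma> e a b \<in> carrier \<Gamma>" using 2 by (auto simp: is_gaining_def)
  then show ?case using 2 by auto
qed (simp add: group.is_monoid monoid.one_closed)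

lemma walk_gain_append:
  assumes "group \<Gamma>" "is_gaining \<Gamma> G \<sigma>" "walk G u p w" "walk G w q v"
  shows "walk_gain \<Gamma> \<sigma> (p @ q) = walk_gain \<Gamma> \<sigma> p \<otimes>\<^bsub>\<Gamma>\<^esub> walk_gain \<Gamma> \<sigma> q"
  using assms
proof (induction G u p w rule: walk.induct)
  case (1 G u w)
  interpret group \<Gamma> by (rule 1)
  show ?case using walk_gain_closed[OF 1(1,2,4)] by simp
next
  case (2 G u e a b p w)
  interpret group \<Gamma> using 2 by simp
  have "\<sigma> e a b \<in> carrier \<Gamma>" using 2 by (auto simp: is_gaining_def)
  moreover have "walk_gain \<Gamma> \<sigma> p \<in> carrier \<Gamma>" "walk_gain \<Gamma> \<sigma> q \<in> carrier \<Gamma>"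
    using walk_gain_closed[OF 2(2,3)] 2 by auto
  ultimately show ?case using 2 by (auto simp: m_assoc)
qed

text \<open>Rotating a closed walk conjugates its gain, and conjugates of the identity are
  trivial.\<close>

lemma cycle_traversal_rotate:
  assumes \<Gamma>: "group \<Gamma>" "is_gaining \<Gamma> G \<sigma>"
    and p: "cycle_traversal G p" "walk_gain \<Gamma> \<sigma> p = \<one>\<^bsub>\<Gamma>\<^esub>" and z: "z \<in> set p"
  obtains q where "cycle_traversal G (z # q)"
    "walk_gain \<Gamma> \<sigma> (z # q) = \<one>\<^bsub>\<Gamma>\<^esub>" "fst ` set (z # q) = fst ` set p"
proof -
  interpret group \<Gamma> by (rule \<Gamma>)
  obtain r q where p': "p = r @ z # q" using z by (meson split_list)
  obtain u w where u: "walk G u r w" "walk G w (z # q) u"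
    using p(1) p' unfolding cycle_traversal_alt by (auto simp: walk_append)
  have c: "walk_gain \<Gamma> \<sigma> r \<in> carrier \<Gamma>" "walk_gain \<Gamma> \<sigma> (z # q) \<in> carrier \<Gamma>"
    using walk_gain_closed[OF \<Gamma>] u by blast+
  have "walk_gain \<Gamma> \<sigma> r \<otimes>\<^bsub>\<Gamma>\<^esub> walk_gain \<Gamma> \<sigma> (z # q) = \<one>\<^bsub>\<Gamma>\<^esub>"
    using p(2) walk_gain_append[OF \<Gamma> u] p' by simp
  then have "walk_gain \<Gamma> \<sigma> (z # q) \<otimes>\<^bsub>\<Gamma>\<^esub> walk_gain \<Gamma> \<sigma> r = \<one>\<^bsub>\<Gamma>\<^esub>"
    using c inv_comm by blast
  then have "walk_gain \<Gamma> \<sigma> ((z # q) @ r) = \<one>\<^bsub>\<Gamma>\<^esub>"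
    using walk_gain_append[OF \<Gamma> u(2,1)] by simp
  moreover have "\<exists>v. walk G v ((z # q) @ r) v" using u walk_append by metis
  then have "cycle_traversal G (z # (q @ r))"
    using p(1) p' unfolding cycle_traversal_alt by auto
  ultimately show ?thesis using that[of "q @ r"] p' by auto
qed

text \<open>The passages from one terminal to the other. Their edge sets are the units at a
  \<open>Point\<close>, which can be passed in either direction.\<close>

inductive arc :: "('e \<Rightarrow> kind) \<Rightarrow> bool \<Rightarrow> ('e \<times> nat \<times> nat) list \<Rightarrow> bool" for \<kappa> d where
  Link: "\<kappa> e = Link \<Longrightarrow> arc \<kappa> d [(e, of_bool d, of_bool (\<not> d))]"
| Pair: "\<kappa> e = To d i \<Longrightarrow> \<kappa> f = To (\<not> d) i \<Longrightarrow>
    arc \<kappa> d [(e, of_bool d, i + 2), (f, i + 2, of_bool (\<not> d))]"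

lemma gadget_step:
  assumes "ends_of_kind k = {of_bool c, v}"
  obtains "k = At c" "v = of_bool c" | "k = Link" "v = of_bool (\<not> c)"
  | i where "k = To c i" "v = i + 2"
proof (cases k)
  case (At d)
  then have "d = c" "v = of_bool c" using assms by (cases c; cases d; auto)+
  then show ?thesis using that(1) At by simp
next
  case Link
  then show ?thesis using assms that(2) by (cases c) (auto simp: doubleton_eq_iff)
next
  case (To d i)
  then have "d = c" "v = i + 2"
    using assms by (cases c; cases d; auto simp: doubleton_eq_iff)+
  then show ?thesis using that(3) To by simp
qed

lemma gadget_step_patch:
  assumes "ends_of_kind k = {i + 2, v}"
  obtains c where "k = To c i" "v = of_bool c"
  using assms by (cases k) (auto simp: doubleton_eq_iff of_bool_def split: if_splits)

text \<open>The disjunction admits paths as well as closed traversals, so that the lemma applies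
  both to a closed walk and to what remains of it after the first arc. A patch vertex has only
  terminals as neighbours, so the walk is at a terminal again after at most two steps.\<close>

lemma gadget_walk_first:
  assumes w: "walk (gadget \<kappa> E) (of_bool c) p v" "p \<noteq> []"
    "distinct (map start p @ [v]) \<or> v = of_bool c \<and> distinct (map start p)"
    and v: "v \<in> {0, 1}"
  obtains e where "p = [(e, of_bool c, of_bool c)]" "\<kappa> e = At c"
  | e f i where "p = [(e, of_bool c, i + 2), (f, i + 2, of_bool c)]" "\<kappa> e = To c i" "\<kappa> f = To c i"
  | a q where "p = a @ q" "arc \<kappa> c a" "walk (gadget \<kappa> E) (of_bool (\<not> c)) q v"
proof -
  obtain e b q where p: "p = (e, of_bool c, b) # q" using w by (cases p) auto
  have e: "ends_of_kind (\<kappa> e) = {of_bool c, b}" and q: "walk (gadget \<kappa> E) b q v"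
    using w(1) p by auto
  have qc: "b = of_bool c \<Longrightarrow> q = [] \<and> v = of_bool c"
    using w(3) q p by (cases q) auto
  from e show ?thesis
  proof (cases rule: gadget_step)
    case 1
    then show ?thesis using that(1) p qc by auto
  next
    case 2
    then show ?thesis using that(3)[of "[(e, of_bool c, b)]" q] p q arc.Link[of \<kappa> e c] by auto
  next
    case (3 i)
    then have "q \<noteq> []" using q v by auto
    then obtain f b' r where r: "q = (f, i + 2, b') # r" using q 3 by (cases q) auto
    have f: "ends_of_kind (\<kappa> f) = {i + 2, b'}" and r': "walk (gadget \<kappa> E) b' r v" using q r by auto
    from f obtain d where d: "\<kappa> f = To d i" "b' = of_bool d" by (rule gadget_step_patch)
    show ?thesis
    proof (cases "d = c")
      case True
      then have "r = [] \<and> v = of_bool c" using w(3) p r r' d by (cases r) auto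
      then show ?thesis using that(2) p r d 3 True by auto
    next
      case False
      then have "d = (\<not> c)" by auto
      then show ?thesis
        using that(3)[of
          "[(e, of_bool c, b), (f, i + 2, b')]" r] p r r' d 3 arc.Pair[of \<kappa> e c i f] by auto
    qed
  qed
qed

lemma gadget_closed_walk:
  assumes w: "walk (gadget \<kappa> E) (of_bool c) p (of_bool c)" "p \<noteq> []" "distinct (map start p)"
  obtains e where "p = [(e, of_bool c, of_bool c)]" "\<kappa> e = At c"
  | e f i where "p = [(e, of_bool c, i + 2), (f, i + 2, of_bool c)]" "\<kappa> e = To c i" "\<kappa> f = To c i"
  | a b where "p = a @ b" "arc \<kappa> c a" "arc \<kappa> (\<not> c) b"
proof -
  have 01: "of_bool c \<in> {0, 1 :: nat}" by (simp add: of_bool_def)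
  show ?thesis
  proof (rule gadget_walk_first[OF w(1,2) _ 01])
    show "distinct (map start p @ [of_bool c]) \<or> of_bool c = (of_bool c :: nat) \<and> distinct (map start p)"
      using w(3) by simp
  next
    fix a q assume a: "p = a @ q" "arc \<kappa> c a" "walk (gadget \<kappa> E) (of_bool (\<not> c)) q (of_bool c)"
    have "q \<noteq> []" using a(3) by (cases c) auto
    have "of_bool c \<in> set (map start a)" using a(2) by cases auto
    moreover have "set (map start a) \<inter> set (map start q) = {}" "distinct (map start q)"
      using w(3) a(1) by simp_all
    ultimately have "of_bool c \<notin> set (map start q)" "distinct (map start q)" by blast+
    then have d: "distinct (map start q @ [of_bool c])" by simp
    show ?thesis
    proof (rule gadget_walk_first[OF a(3) \<open>q \<noteq> []\<close> _ 01])
      show "distinct (map start q @ [of_bool c]) \<or> of_bool c = (of_bool (\<not> c) :: nat) \<and> distinct (map start q)"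
        using d by simp
    next
      fix a' q' assume a': "q = a' @ q'" "arc \<kappa> (\<not> c) a'"
        "walk (gadget \<kappa> E) (of_bool (\<not> \<not> c)) q' (of_bool c)"
      have "q' = []" using a'(1,3) d by (cases q') auto
      then show ?thesis using that(3) a a' by auto
    qed (use a(3) in \<open>cases c; auto\<close>)+
  qed (use that in blast)+
qed

text \<open>\<open>g_at\<close> and \<open>g_to\<close> exclude the balanced cycles through only one
  terminal, which are loops and pairs of parallel patch edges. Every other cycle consists of two
  arcs.\<close>

locale gain_gadget = group \<Gamma> for \<Gamma> :: "('a, 'm) monoid_scheme" (structure) +
  fixes E :: "'e set" and \<kappa> :: "'e \<Rightarrow> kind" and g :: "'e \<Rightarrow> 'a"
  assumes finE: "finite E"
    and g_closed: "e \<in> E \<Longrightarrow> g e \<in> carrier \<Gamma>"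
    and g_at: "e \<in> E \<Longrightarrow> \<kappa> e = At c \<Longrightarrow> g e \<noteq> \<one>"
    and g_to: "e \<in> E \<Longrightarrow> f \<in> E \<Longrightarrow> \<kappa> e = To c i \<Longrightarrow> \<kappa> f = To c i \<Longrightarrow> g e = g f \<Longrightarrow> e = f"
begin

text \<open>The gain of the path from terminal 1 through the patch to terminal 0; patch edges have
  their gains read from the patch vertex.\<close>

abbreviation "pair_gain s t \<equiv> inv (g s) \<otimes> g t"
abbreviation "GG \<equiv> gadget \<kappa> E"
abbreviation "\<sigma> \<equiv> gadget_gain \<Gamma> g"

lemma gaining: "is_gaining \<Gamma> GG \<sigma>"
  by (rule is_gaining_gadget[OF is_group g_closed])

lemma arc_gain:
  assumes "arc \<kappa> d p" "fst ` set p \<subseteq> E"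
  shows "\<exists>x \<in> carrier \<Gamma>. unit_point \<kappa> g pair_gain (fst ` set p) (Point x) \<and>
    walk_gain \<Gamma> \<sigma> p = (if d then x else inv x)"
  using assms(1)
proof cases
  case (Link e)
  then have "unit_point \<kappa> g pair_gain (fst ` set p) (Point (g e))"
    using unit_point.Link[of \<kappa> e g pair_gain] by simp
  then show ?thesis using Link assms(2)
    by (intro bexI[of _ "g e"]) (auto simp: gadget_gain_def g_closed)
next
  case (Pair e i f)
  have c: "g e \<in> carrier \<Gamma>" "g f \<in> carrier \<Gamma>" using Pair assms(2) by (auto simp: g_closed)
  show ?thesis
  proof (cases d)
    case True
    then have "unit_point \<kappa> g pair_gain (fst ` set p) (Point (pair_gain e f))"
      using Pair unit_point.Mixed[of \<kappa> e i f g pair_gain] by simp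
    then show ?thesis
      using Pair True c by (intro bexI[of _ "pair_gain e f"]) (auto simp: gadget_gain_def)
  next
    case False
    then have "unit_point \<kappa> g pair_gain (fst ` set p) (Point (pair_gain f e))"
      using Pair unit_point.Mixed[of \<kappa> f i e g pair_gain] by (simp add: insert_commute)
    then show ?thesis
      using Pair False c
        by (intro bexI[of _ "pair_gain f e"]) (auto simp: gadget_gain_def inv_mult_group)
  qed
qed

text \<open>Every edge has a terminal as an end, so a balanced cycle can be started at one. It
  consists of two arcs, and being balanced it gives two disjoint units at the same point.\<close>

lemma load_indep_no_balanced:
  assumes Z: "Z \<subseteq> E" "load_indep \<kappa> g pair_gain Z" and C: "C \<in> balanced_cycles \<Gamma> GG \<sigma>"
  shows "\<not> C \<subseteq> Z"
proof
  assume CZ: "C \<subseteq> Z"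
  obtain p where p: "C = fst ` set p" "cycle_traversal GG p" "walk_gain \<Gamma> \<sigma> p = \<one>"
    using C by (auto simp: balanced_cycles_def)
  have "\<exists>c. of_bool c \<in> start ` set p"
  proof -
    obtain u where u: "walk GG u p u" and "p \<noteq> []" using p(2) by (auto simp: cycle_traversal_alt)
    then obtain e b q where q: "p = (e, u, b) # q" by (cases p) auto
    have e: "ends_of_kind (\<kappa> e) = {u, b}" and w: "walk GG b q u" using u q by auto
    have "b \<in> start ` set p" using w q by (cases q) auto
    moreover have "u \<in> start ` set p" using q by auto
    moreover have ex: "\<exists>c. of_bool c \<in> ends_of_kind k" for k :: kind
    proof (cases k)
      case Link
      then show ?thesis by (intro exI[of _ False]) simp
    qed auto
    obtain c where "of_bool c \<in> {u, b}" using ex[of "\<kappa> e"] unfolding e by (rule exE)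
    ultimately show ?thesis by (metis insertE singletonD)
  qed
  then obtain c z where z: "z \<in> set p" "start z = of_bool c" by auto
  then have "z = (fst z, of_bool c, snd (snd z))" by (metis prod.collapse)
  then obtain e y where "z = (e, of_bool c, y)" by blast
  then obtain q where q: "cycle_traversal GG ((e, of_bool c, y) # q)"
    "walk_gain \<Gamma> \<sigma> ((e, of_bool c, y) # q) = \<one>" "fst ` set ((e, of_bool c, y) # q) = fst ` set p"
    using cycle_traversal_rotate[OF is_group gaining p(2,3) z(1)] by metis
  define r where "r = (e, of_bool c, y) # q"
  have r: "walk GG (of_bool c) r (of_bool c)" "r \<noteq> []" "distinct (map start r)" "distinct (map fst r)"
    "walk_gain \<Gamma> \<sigma> r = \<one>" "fst ` set r \<subseteq> Z"
    using q CZ p(1) by (auto simp: r_def cycle_traversal_alt)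
  have rE: "fst ` set r \<subseteq> E" using r(6) Z(1) by blast
  from r(1,2,3) show False
  proof (cases rule: gadget_closed_walk)
    case (1 e)
    then have "g e = \<one>" using r(5) rE g_closed[of e] by (simp add: gadget_gain_def)
    then show False using g_at[of e c] 1 rE by auto
  next
    case (2 e f i)
    have E: "e \<in> E" "f \<in> E" "e \<noteq> f" using 2 rE r(4) by auto
    have "inv (g e) \<otimes> g f = \<one>"
      using r(5) 2 g_closed E by (auto simp: gadget_gain_def of_bool_def split: if_splits)
    then have "g e = g f" using E g_closed by (metis inv_closed inv_equality inv_inv)
    then show False using g_to 2 E by metis
  next
    case (3 a b)
    have ab: "fst ` set a \<subseteq> E" "fst ` set b \<subseteq> E" using 3 rE by auto
    obtain x where x: "x \<in> carrier \<Gamma>" "unit_point \<kappa> g pair_gain (fst ` set a) (Point x)"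
      "walk_gain \<Gamma> \<sigma> a = (if c then x else inv x)" using arc_gain[OF 3(2) ab(1)] by blast
    obtain y where y: "y \<in> carrier \<Gamma>" "unit_point \<kappa> g pair_gain (fst ` set b) (Point y)"
      "walk_gain \<Gamma> \<sigma> b = (if \<not> c then y else inv y)" using arc_gain[OF 3(3) ab(2)] by blast
    obtain w where w: "walk GG (of_bool c) a w" "walk GG w b (of_bool c)"
      using r(1) 3(1) by (auto simp: walk_append)
    have "walk_gain \<Gamma> \<sigma> a \<otimes> walk_gain \<Gamma> \<sigma> b = \<one>"
      using r(5) walk_gain_append[OF is_group gaining w] 3(1) by simp
    moreover have "x = y" if "x \<otimes> inv y = \<one> \<or> inv x \<otimes> y = \<one>"
      using that x(1) y(1) by (metis inv_closed inv_equality inv_inv)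
    ultimately have "x = y" using x y by (cases c) auto
    then have "fst ` set a = fst ` set b"
      using Z(2) x(2) y(2) r(6) 3(1) unfolding load_indep_def
        by (metis Un_subset_iff image_Un set_append)
    moreover have "fst ` set a \<inter> fst ` set b = {}" using r(4) 3(1) by auto
    moreover have "fst ` set a \<noteq> {}" using unit_point_finite[OF x(2)] by simp
    ultimately show False by auto
  qed
qed


lemma unit_arc:
  assumes U: "U \<subseteq> E" and up: "unit_point \<kappa> g pair_gain U (Point x)"
  shows "x \<in> carrier \<Gamma> \<and> (\<exists>p. fst ` set p = U \<and> walk GG (of_bool d) p (of_bool (\<not> d)) \<and>
    start ` set p = insert (of_bool d) ((\<lambda>i. i + 2) ` patches \<kappa> U) \<and> distinct (map start p) \<and>
    distinct (map fst p) \<and> walk_gain \<Gamma> \<sigma> p = (if d then x else inv x))"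
  using up
proof cases
  case (Link e)
  then have "patches \<kappa> U = {}" "g e \<in> carrier \<Gamma>" using U g_closed by (auto simp: patches_def)
  then show ?thesis using Link U
    by (intro conjI exI[of _ "[(e, of_bool d, of_bool (\<not> d))]"]) (auto simp: gadget_gain_def)
next
  case (Mixed s i t)
  then have p: "patches \<kappa> U = {i}" by (auto simp: patches_def)
  have c: "g s \<in> carrier \<Gamma>" "g t \<in> carrier \<Gamma>" using Mixed U g_closed by auto
  have st: "s \<noteq> t" using Mixed by auto
  show ?thesis
  proof (cases d)
    case True
    then show ?thesis using Mixed U p c st
      by (intro conjI exI[of _ "[(s, 1, i + 2), (t, i + 2, 0)]"])
        (auto simp: gadget_gain_def insert_commute)
  next
    case False
    then show ?thesis using Mixed U p c st
      by (intro conjI exI[of _ "[(t, 0, i + 2), (s, i + 2, 1)]"])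
        (auto simp: gadget_gain_def insert_commute inv_mult_group)
  qed
qed

text \<open>Two units at one point force dependence. At a joint, their union exceeds its patches by
  two but has only one terminal. At a \<open>Point\<close>, units without a common patch close up to
  a balanced cycle, and units in a common patch are four edges on three vertices.\<close>

lemma indep_load:
  assumes Z: "Z \<in> snd (frame_matroid \<Gamma> GG \<sigma>)"
  shows "load_indep \<kappa> g pair_gain Z"
proof -
  have ZE: "Z \<subseteq> E" and bal: "\<And>C. C \<in> balanced_cycles \<Gamma> GG \<sigma> \<Longrightarrow> \<not> C \<subseteq> Z"
    and sparse: "\<And>W. W \<subseteq> Z \<Longrightarrow> card W \<le> card (verts_of GG W)"
    using Z unfolding frame_matroid_indep_iff[OF is_multigraph_gadget[OF finE]] by auto
  have fZ: "finite Z" using ZE finE finite_subset by blast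
  have v: "card (verts_of GG W) \<le> card S + card (patches \<kappa> W)"
    if W: "W \<subseteq> Z" and S: "\<And>e x. e \<in> W \<Longrightarrow> x \<in> {0, 1} \<Longrightarrow> x \<in> ends_of_kind (\<kappa> e) \<Longrightarrow> x \<in> S" "finite S" for W S
  proof -
    have "card {v \<in> {0, 1}. \<exists>e \<in> W. v \<in> ends_of_kind (\<kappa> e)} \<le> card S"
      using S by (intro card_mono) auto
    then show ?thesis using card_verts_of_gadget[of W \<kappa> E] W fZ finite_subset by fastforce
  qed
  have "U = U'" if U: "U \<subseteq> Z" "U' \<subseteq> Z" "unit_point \<kappa> g pair_gain U v"
    "unit_point \<kappa> g pair_gain U' v" for U U' v
  proof (rule ccontr)
    assume ne: "U \<noteq> U'"
    have UE: "U \<subseteq> E" "U' \<subseteq> E" using U ZE by auto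
    have UZ: "U \<union> U' \<subseteq> Z" using U by auto
    show False
    proof (cases v)
      case (Joint c)
      have "card (verts_of GG (U \<union> U')) \<le> card {of_bool c :: nat} + card (patches \<kappa> (U \<union> U'))"
      proof (rule v[OF UZ])
        fix e x assume e: "e \<in> U \<union> U'" "x \<in> {0, 1}" "x \<in> ends_of_kind (\<kappa> e)"
        have "\<kappa> e = At c \<or> (\<exists>i. \<kappa> e = To c i)"
          using e(1) U(3,4) Joint by (auto elim!: unit_point.cases)
        then show "x \<in> {of_bool c}" using e(2,3) by auto
      qed simp
      moreover have "card (patches \<kappa> (U \<union> U')) + 2 \<le> card (U \<union> U')"
        using two_units_card[OF U(3,4) ne] .
      ultimately show False using sparse[OF UZ] by simp
    next
      case (Point x)
      obtain p where p: "fst ` set p = U" "walk GG 1 p 0"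
        "start ` set p = insert 1 ((\<lambda>i. i + 2) ` patches \<kappa> U)"
        "distinct (map start p)" "distinct (map fst p)" "walk_gain \<Gamma> \<sigma> p = x" and x: "x \<in> carrier \<Gamma>"
        using unit_arc[OF UE(1), of x True] U(3) Point by auto
      obtain q where q: "fst ` set q = U'" "walk GG 0 q 1"
        "start ` set q = insert 0 ((\<lambda>i. i + 2) ` patches \<kappa> U')"
        "distinct (map start q)" "distinct (map fst q)" "walk_gain \<Gamma> \<sigma> q = inv x"
        using unit_arc[OF UE(2), of x False] U(4) Point by auto
      have shape: "(\<exists>e. V = {e} \<and> \<kappa> e = Link) \<or>
          (\<exists>s t i. V = {s, t} \<and> \<kappa> s = To True i \<and> \<kappa> t = To False i \<and> x = pair_gain s t)"
        if "unit_point \<kappa> g pair_gain V v" for V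
        using that Point by cases auto
      show False
      proof (cases "patches \<kappa> U \<inter> patches \<kappa> U' = {}")
        case True
        have "U \<inter> U' = {}"
          using shape[OF U(3)] shape[OF U(4)] True ne by (auto simp: patches_def)
        then have "distinct (map fst (p @ q))" using p(1,5) q(1,5) by auto
        moreover have "start ` set p \<inter> start ` set q = {}" using p(3) q(3) True by auto
        then have "distinct (map start (p @ q))" using p(4) q(4) by auto
        moreover have "walk GG 1 (p @ q) 1" using p(2) q(2) walk_append by metis
        moreover have "p @ q \<noteq> []" using p(2) by (cases p) auto
        ultimately have "cycle_traversal GG (p @ q)" unfolding cycle_traversal_alt by blast
        moreover have "walk_gain \<Gamma> \<sigma> (p @ q) = \<one>"
          using walk_gain_append[OF is_group gaining p(2) q(2)] p(6) q(6) x by simp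
        ultimately have "fst ` set (p @ q) \<in> balanced_cycles \<Gamma> GG \<sigma>"
          unfolding balanced_cycles_def by blast
        then have "U \<union> U' \<in> balanced_cycles \<Gamma> GG \<sigma>" using p(1) q(1) by (simp add: image_Un)
        then show False using bal UZ by blast
      next
        case False
        then obtain s t s' t' i where st: "U = {s, t}" "\<kappa> s = To True i" "\<kappa> t = To False i"
          "x = pair_gain s t"
          "U' = {s', t'}" "\<kappa> s' = To True i" "\<kappa> t' = To False i" "x = pair_gain s' t'"
        proof -
          have nl: "\<not> (\<exists>e. V = {e} \<and> \<kappa> e = Link)" if "patches \<kappa> V \<noteq> {}" for V
            using that by (auto simp: patches_def)
          obtain s t i where 1: "U = {s, t}" "\<kappa> s = To True i" "\<kappa> t = To False i" "x = pair_gain s t"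
            using shape[OF U(3)] nl[of U] False by blast
          obtain s' t' j where 2: "U' = {s', t'}" "\<kappa> s' = To True j" "\<kappa> t' = To False j"
            "x = pair_gain s' t'"
            using shape[OF U(4)] nl[of U'] False by blast
          have "patches \<kappa> U = {i}" "patches \<kappa> U' = {j}" using 1 2 by (auto simp: patches_def)
          then have "i = j" using False by auto
          then show ?thesis using that 1 2 by blast
        qed
        have E: "s \<in> E" "t \<in> E" "s' \<in> E" "t' \<in> E" using UE st by auto
        note c = E[THEN g_closed]
        have "g t = g s \<otimes> x" using c by (simp add: st(4) m_assoc[symmetric])
        moreover have "g t' = g s' \<otimes> x" using c by (simp add: st(8) m_assoc[symmetric])
        \<comment> \<open>Both pairs have gain \<open>x\<close>, so either edge of a pair determines
          the other. Distinct pairs are therefore disjoint.\<close>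
        ultimately have "g s = g s' \<longleftrightarrow> g t = g t'" using c x by (metis inv_solve_right m_closed)
        then have "s = s' \<longleftrightarrow> t = t'" using g_to st E by metis
        then have "s \<noteq> s'" "t \<noteq> t'" using ne st(1,5) by auto
        moreover have "s \<noteq> t" "s \<noteq> t'" "s' \<noteq> t" "s' \<noteq> t'" using st by auto
        ultimately have "card (U \<union> U') = 4" using st(1,5) by (simp add: card_insert_if)
        moreover have "patches \<kappa> (U \<union> U') = {i}" using st by (auto simp: patches_def)
        moreover have "card (verts_of GG (U \<union> U')) \<le> card {0, 1 :: nat} + card (patches \<kappa> (U \<union> U'))"
          by (rule v[OF UZ]) auto
        ultimately show False using sparse[OF UZ] by simp
      qed
    qed
  qed
  moreover have "card Z \<le> card (patches \<kappa> Z) + 2"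
    using sparse[OF order_refl] v[OF order_refl, of "{0, 1}"] by auto
  ultimately show ?thesis unfolding load_indep_def by blast
qed

theorem frame_matroid_gadget:
  "frame_matroid \<Gamma> GG \<sigma> = restricted_hypergraph (load_indep \<kappa> g pair_gain) E"
proof -
  have "snd (frame_matroid \<Gamma> GG \<sigma>) = {Z. Z \<subseteq> E \<and> load_indep \<kappa> g pair_gain Z}"
  proof (intro equalityI subsetI)
    fix Z assume Z: "Z \<in> snd (frame_matroid \<Gamma> GG \<sigma>)"
    then have "Z \<subseteq> E" by (auto simp: frame_matroid_def)
    then show "Z \<in> {Z. Z \<subseteq> E \<and> load_indep \<kappa> g pair_gain Z}" using indep_load[OF Z] by simp
  next
    fix Z assume "Z \<in> {Z. Z \<subseteq> E \<and> load_indep \<kappa> g pair_gain Z}"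
    then have Z: "Z \<subseteq> E" "load_indep \<kappa> g pair_gain Z" by auto
    have "finite Z" using Z(1) finE finite_subset by blast
    then show "Z \<in> snd (frame_matroid \<Gamma> GG \<sigma>)"
      unfolding frame_matroid_indep_iff[OF is_multigraph_gadget[OF finE]]
      using Z load_indep_no_balanced[OF Z] load_indep_card by auto
  qed
  then show ?thesis by (simp add: frame_matroid_def restricted_hypergraph_def)
qed

end

section \<open>Recovering gains from a gadget\<close>

lemma unit_point_singleton:
  "unit_point \<kappa> lab pv {e} v \<longleftrightarrow>
     (\<exists>c. \<kappa> e = At c \<and> v = Joint c) \<or> \<kappa> e = Link \<and> v = Point (lab e)"
proof
  assume "unit_point \<kappa> lab pv {e} v"
  then show "(\<exists>c. \<kappa> e = At c \<and> v = Joint c) \<or> \<kappa> e = Link \<and> v = Point (lab e)"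
    by cases (auto simp: singleton_insert_inj_eq')
qed (auto intro: unit_point.intros)

lemma unit_point_pair:
  assumes "unit_point \<kappa> lab pv {e, f} v" "e \<noteq> f"
  shows "\<exists>c d i. \<kappa> e = To c i \<and> \<kappa> f = To d i"
  using assms by cases (auto simp: doubleton_eq_iff)

lemma unit_point_card: "unit_point \<kappa> lab pv U v \<Longrightarrow> card U = 1 \<or> card U = 2"
  by (induction rule: unit_point.induct) (auto simp: card_insert_if)

lemma unit_subset_pair:
  assumes "unit_point \<kappa> lab pv U v" "U \<subseteq> {e, f}"
  shows "U = {e} \<or> U = {f} \<or> U = {e, f}"
  using assms unit_point_finite
    by (metis subset_insert_iff subset_singletonD insert_Diff_if
    insert_is_Un doubleton_eq_iff Diff_eq_empty_iff insert_Diff)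

lemma load_indep_pair:
  assumes "e \<noteq> f" "\<And>v. unit_point \<kappa> lab pv {e} v \<Longrightarrow> \<not> unit_point \<kappa> lab pv {f} v"
  shows "load_indep \<kappa> lab pv {e, f}"
  unfolding load_indep_def
proof (intro conjI allI impI)
  fix U U' v
  assume U: "U \<subseteq> {e, f}" "U' \<subseteq> {e, f}" "unit_point \<kappa> lab pv U v" "unit_point \<kappa> lab pv U' v"
  have no: "\<not> unit_point \<kappa> lab pv {e} w \<and> \<not> unit_point \<kappa> lab pv {f} w"
    if "unit_point \<kappa> lab pv {e, f} v'" for v' w
    using unit_point_pair[OF that assms(1)] by (auto simp: unit_point_singleton)
  show "U = U'"
    using unit_subset_pair[OF U(3,1)] unit_subset_pair[OF U(4,2)] U(3,4) no assms(2) by metis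
qed (use assms in simp)

text \<open>The patch edge pays for itself by opening a patch, and as the only patch edge it belongs
  to no unit.\<close>

lemma load_indep_triple:
  assumes "\<kappa> t = To c i" "unit_point \<kappa> lab pv {e} v1" "unit_point \<kappa> lab pv {f} v2" "v1 \<noteq> v2"
  shows "load_indep \<kappa> lab pv {t, e, f}"
proof -
  have ne: "t \<noteq> e" "t \<noteq> f" "e \<noteq> f" using assms by (auto simp: unit_point_singleton)
  have v: "unit_point \<kappa> lab pv {e} v \<longleftrightarrow> v = v1" "unit_point \<kappa> lab pv {f} v \<longleftrightarrow> v = v2" for v
    using assms(2,3) by (auto simp: unit_point_singleton)
  have t: "\<not> unit_point \<kappa> lab pv {t} v" for v using assms(1) by (auto simp: unit_point_singleton)
  have nonTo: "\<kappa> e \<noteq> To d j" "\<kappa> f \<noteq> To d j" for d j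
    using assms(2,3) by (auto simp: unit_point_singleton)
  have sing: "U = {e} \<or> U = {f}" if U: "U \<subseteq> {t, e, f}" "unit_point \<kappa> lab pv U v" for U v
  proof -
    have "U = {x} \<or> (\<exists>y. U = {x, y} \<and> x \<noteq> y)" if "x \<in> U" for x
      using unit_point_card[OF U(2)] that by (auto simp: card_1_singleton_iff card_2_iff)
    moreover have "\<not> (\<exists>x y. U = {x, y} \<and> x \<noteq> y)"
    proof
      assume "\<exists>x y. U = {x, y} \<and> x \<noteq> y"
      then obtain x y where xy: "U = {x, y}" "x \<noteq> y" by auto
      then obtain c d j where "\<kappa> x = To c j" "\<kappa> y = To d j" using unit_point_pair U(2) by metis
      then show False using U(1) xy nonTo ne by auto
    qed
    moreover obtain x where "x \<in> U" using unit_point_finite[OF U(2)] by auto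
    ultimately have "U = {x}" "x \<in> {t, e, f}" using U(1) by auto
    then show ?thesis using U(2) t by auto
  qed
  have "card (patches \<kappa> {t, e, f}) \<ge> card {i}"
    using assms(1) patches_finite[of "{t, e, f}" \<kappa>] by (intro card_mono) (auto simp: patches_def)
  then have "card {t, e, f} \<le> card (patches \<kappa> {t, e, f}) + 2" using ne by simp
  then show ?thesis
    unfolding load_indep_def using sing v assms(4) by metis
qed

lemma not_load_indep:
  assumes "U \<subseteq> Z" "U' \<subseteq> Z" "unit_point \<kappa> lab pv U v" "unit_point \<kappa> lab pv U' v" "U \<noteq> U'"
  shows "\<not> load_indep \<kappa> lab pv Z"
  using assms unfolding load_indep_def by blast

section \<open>Lines and triangles in an arbitrary representation\<close>

locale frame_rep = group \<Gamma> for \<Gamma> :: "('a, 'm) monoid_scheme" (structure) +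
  fixes G :: "('v, 'e) multigraph" and \<sigma> :: "'e \<Rightarrow> 'v \<Rightarrow> 'v \<Rightarrow> 'a"
  assumes multigraph: "is_multigraph G" and gaining: "is_gaining \<Gamma> G \<sigma>"
begin

abbreviation "E \<equiv> medges G"
abbreviation "V \<equiv> verts_of G"
abbreviation "indep Z \<equiv> Z \<in> snd (frame_matroid \<Gamma> G \<sigma>)"

lemma finE: "finite E" using multigraph by (simp add: is_multigraph_def)

lemma ends: "e \<in> E \<Longrightarrow> card (mends G e) \<in> {1, 2}"
  using multigraph by (simp add: is_multigraph_def)

lemma gain_inv:
  assumes "e \<in> E" "mends G e = {u, v}" "u \<noteq> v"
  shows "\<sigma> e u v \<in> carrier \<Gamma>" "\<sigma> e v u = inv (\<sigma> e u v)"
proof -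
  show "\<sigma> e u v \<in> carrier \<Gamma>" using gaining assms(1,2) unfolding is_gaining_def by blast
  show "\<sigma> e v u = inv (\<sigma> e u v)"
    using gaining assms unfolding is_gaining_def by (metis insert_commute)
qed

lemma indep_card: "indep Z \<Longrightarrow> W \<subseteq> Z \<Longrightarrow> card W \<le> card (V W)"
  using frame_matroid_indep_iff[OF multigraph] by metis

lemma indep_unbalanced: "indep Z \<Longrightarrow> C \<in> balanced_cycles \<Gamma> G \<sigma> \<Longrightarrow> \<not> C \<subseteq> Z"
  using frame_matroid_indep_iff[OF multigraph] by metis

lemma indep_subset: "indep Z \<Longrightarrow> W \<subseteq> Z \<Longrightarrow> indep W"
  unfolding frame_matroid_def by auto (meson order_trans)

text \<open>All proper subsets are independent, so whatever violates independence involves the whole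
  triple: it is a balanced cycle or has more edges than vertices.\<close>

lemma dependent_triple:
  assumes E: "{e, f, h} \<subseteq> E" and dep: "\<not> indep {e, f, h}"
    and "indep {e, f}" "indep {e, h}" "indep {f, h}"
  shows "card (V {e, f, h}) \<le> 2 \<or> {e, f, h} \<in> balanced_cycles \<Gamma> G \<sigma>"
proof -
  have proper: "indep W" if "W \<subset> {e, f, h}" for W
  proof -
    have "W \<subseteq> {e, f} \<or> W \<subseteq> {e, h} \<or> W \<subseteq> {f, h}" using that by auto
    then show ?thesis using assms(3-5) by (auto intro: indep_subset)
  qed
  consider C where "C \<in> balanced_cycles \<Gamma> G \<sigma>" "C \<subseteq> {e, f, h}"
    | W where "W \<subseteq> {e, f, h}" "card (V W) < card W"
    using dep E frame_matroid_indep_iff[OF multigraph] by (meson not_le)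
  then show ?thesis
  proof cases
    case 1
    then have "C = {e, f, h}" using proper indep_unbalanced by blast
    then show ?thesis using 1 by simp
  next
    case 2
    then have "W = {e, f, h}" using proper[of W] indep_card[of W W] by (meson leD order_refl psubsetI)
    moreover have "card {e, f, h} \<le> 3" by (simp add: card_insert_if)
    ultimately have "card (V {e, f, h}) \<le> 2" using 2 by simp
    then show ?thesis ..
  qed
qed

lemma balanced_triangle:
  assumes "{e, f, h} \<in> balanced_cycles \<Gamma> G \<sigma>" "e \<noteq> f" "e \<noteq> h" "f \<noteq> h"
  obtains u v w where "u \<noteq> v" "v \<noteq> w" "u \<noteq> w"
    "mends G e = {u, v}" "mends G f = {v, w}" "mends G h = {w, u}"
    "\<sigma> e u v \<otimes> \<sigma> f v w \<otimes> \<sigma> h w u = \<one>"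
proof -
  obtain p where p: "{e, f, h} = fst ` set p" "cycle_traversal G p" "walk_gain \<Gamma> \<sigma> p = \<one>"
    using assms(1) by (auto simp: balanced_cycles_def)
  have "e \<in> fst ` set p" using p(1) by blast
  then obtain z where z: "z \<in> set p" "fst z = e" by auto
  then obtain q where q: "cycle_traversal G (z # q)"
    "walk_gain \<Gamma> \<sigma> (z # q) = \<one>" "fst ` set (z # q) = {e, f, h}"
    using cycle_traversal_rotate[OF is_group gaining p(2,3)] p(1) by metis
  have "length (map fst (z # q)) = card (set (map fst (z # q)))"
    using q(1) unfolding cycle_traversal_alt by (metis distinct_card)
  also have "set (map fst (z # q)) = {e, f, h}" using q(3) by simp
  finally have "length q = 2" using assms(2-4) by simp
  then obtain x y where xy: "q = [x, y]" by (auto simp: length_Suc_conv numeral_2_eq_2)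
  obtain u v where zz: "z = (e, u, v)" using z(2) by (metis prod.collapse)
  obtain x1 x2 x3 y1 y2 y3 where x: "x = (x1, x2, x3)" and y: "y = (y1, y2, y3)" by (metis prod.exhaust)
  have w: "x2 = v" "y2 = x3" "y3 = u" "mends G e = {u, v}" "mends G x1 = {v, x3}" "mends G y1 = {x3, u}"
    "x1 \<in> E" "y1 \<in> E" "e \<in> E"
    and d: "u \<noteq> v" "v \<noteq> x3" "u \<noteq> x3" "e \<noteq> x1" "e \<noteq> y1" "x1 \<noteq> y1"
    using q(1) unfolding cycle_traversal_alt xy x y zz by auto
  have g: "\<sigma> e u v \<in> carrier \<Gamma>" "\<sigma> x1 v x3 \<in> carrier \<Gamma>" "\<sigma> y1 x3 u \<in> carrier \<Gamma>"
    and gi: "\<sigma> e v u = inv (\<sigma> e u v)" "\<sigma> x1 x3 v = inv (\<sigma> x1 v x3)" "\<sigma> y1 u x3 = inv (\<sigma> y1 x3 u)"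
    using gain_inv w d by metis+
  have gain: "\<sigma> e u v \<otimes> \<sigma> x1 v x3 \<otimes> \<sigma> y1 x3 u = \<one>"
    using q(2) g unfolding xy x y zz w by (simp add: m_assoc)
  have "{x1, y1} = {f, h}" using q(3) d assms(2-4) unfolding xy x y zz by auto
  then consider "x1 = f" "y1 = h" | "x1 = h" "y1 = f" using d by (auto simp: doubleton_eq_iff)
  then show ?thesis
  proof cases
    case 1
    then show ?thesis using that[of u v x3] w d gain by metis
  next
    \<comment> \<open>The traversal runs through \<open>e\<close>, \<open>h\<close>,
      \<open>f\<close>. Reversing it, with \<open>u\<close> and \<open>v\<close> exchanged, gives
      the required order.\<close>
    case 2
    have "inv (\<sigma> y1 x3 u) \<otimes> inv (\<sigma> x1 v x3) \<otimes> inv (\<sigma> e u v) = \<one>"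
      using gain g by (metis inv_mult_group inv_one m_assoc m_closed inv_closed)
    then have "inv (\<sigma> e u v) \<otimes> (inv (\<sigma> y1 x3 u) \<otimes> inv (\<sigma> x1 v x3)) = \<one>"
      using g inv_comm by (meson inv_closed m_closed)
    then have "\<sigma> e v u \<otimes> \<sigma> y1 u x3 \<otimes> \<sigma> x1 x3 v = \<one>"
      using g by (simp add: gi m_assoc)
    then show ?thesis using that[of v u x3] w d 2 by (simp add: insert_commute)
  qed
qed

text \<open>If three of the edges formed a triangle, every further edge of the line would have to be
  parallel to two different sides of it.\<close>
lemma long_line_ends:
  assumes S: "S \<subseteq> E" and pair: "\<And>e f. e \<in> S \<Longrightarrow> f \<in> S \<Longrightarrow> e \<noteq> f \<Longrightarrow> indep {e, f}"
    and triple: "\<And>e f h. e \<in> S \<Longrightarrow> f \<in> S \<Longrightarrow> h \<in> S \<Longrightarrow> e \<noteq> f \<Longrightarrow> e \<noteq> h \<Longrightarrow> f \<noteq> h \<Longrightarrow> \<not> indep {e, f, h}"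
    and four: "card S \<ge> 4"
  obtains u v where "u \<noteq> v" "\<And>e. e \<in> S \<Longrightarrow> mends G e \<subseteq> {u, v}"
proof -
  have finV: "finite (V W)" if "W \<subseteq> S" for W using finite_verts_of[OF multigraph] that S by blast
  have V3: "card (V {e, f, h}) \<le> 2" if efh: "e \<in> S" "f \<in> S" "h \<in> S" "e \<noteq> f" "e \<noteq> h" "f \<noteq> h" for e f h
  proof (rule ccontr)
    assume "\<not> ?thesis"
    then have bal: "{e, f, h} \<in> balanced_cycles \<Gamma> G \<sigma>"
      using dependent_triple[of e f h] efh pair triple S by blast
    have "\<not> S \<subseteq> {e, f, h}"
    proof
      assume "S \<subseteq> {e, f, h}"
      then have "card S \<le> card {e, f, h}" by (intro card_mono) auto
      then show False using four efh by simp
    qed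
    then obtain d where d: "d \<in> S" "d \<noteq> e" "d \<noteq> f" "d \<noteq> h" by auto
    obtain u v w where uvw: "u \<noteq> v" "v \<noteq> w" "u \<noteq> w" "mends G e = {u, v}" "mends G f = {v, w}"
      "mends G h = {w, u}"
      using balanced_triangle[OF bal] efh by metis
    have bal': "{e, x, d} \<in> balanced_cycles \<Gamma> G \<sigma>" if x: "x \<in> {f, h}" for x
    proof -
      have "{u, v, w} \<subseteq> V {e, x, d}" using x uvw by (auto simp: verts_of_def)
      then have "card (V {e, x, d}) \<ge> card {u, v, w}" using finV[of "{e, x, d}"] x efh d
        by (intro card_mono) auto
      then have "\<not> card (V {e, x, d}) \<le> 2" using uvw by simp
      moreover have "x \<in> S" "x \<noteq> e" "x \<noteq> d" using x efh d by auto
      ultimately show ?thesis using dependent_triple[of e x d] efh d pair triple S by blast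
    qed
    have third: "mends G d = (mends G e - mends G x) \<union> (mends G x - mends G e)"
      "mends G x \<noteq> mends G d" if x: "x \<in> {f, h}" for x
    proof -
      have "x \<noteq> e" "x \<noteq> d" using x efh d by auto
      then obtain u v w where *: "u \<noteq> v" "v \<noteq> w" "u \<noteq> w" "mends G e = {u, v}" "mends G x = {v, w}"
        "mends G d = {w, u}"
        using balanced_triangle[OF bal'[OF x]] d by metis
      show "mends G d = (mends G e - mends G x) \<union> (mends G x - mends G e)" "mends G x \<noteq> mends G d"
        using *(1-3) unfolding * by auto
    qed
    have "mends G d = {u, w}" using third(1)[of f] uvw by auto
    then show False using third(2)[of h] uvw by (simp add: insert_commute)
  qed
  have "S \<noteq> {}" using four by auto
  then obtain e where e: "e \<in> S" by auto
  have "\<not> S \<subseteq> {e}"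
  proof
    assume "S \<subseteq> {e}"
    then have "card S \<le> card {e}" by (intro card_mono) auto
    then show False using four by simp
  qed
  then obtain f where "f \<in> S" "e \<noteq> f" by auto
  note ef = e this
  \<comment> \<open>Two independent edges have at least two vertices between them, and no further
    edge of the line adds a third.\<close>
  have ge: "card (V {e, f}) \<ge> 2" using indep_card[OF pair[OF ef] order_refl] ef(3) by simp
  obtain h where h: "h \<in> S" "h \<noteq> e" "h \<noteq> f"
  proof -
    have "\<not> S \<subseteq> {e, f}"
    proof
      assume "S \<subseteq> {e, f}"
      then have "card S \<le> card {e, f}" by (intro card_mono) auto
      then show False using four ef by simp
    qed
    then show ?thesis using that by auto
  qed
  have "card (V {e, f}) \<le> card (V {e, f, h})"
    using finV[of "{e, f, h}"] ef h by (intro card_mono verts_of_mono) auto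
  then have "card (V {e, f}) = 2" using V3[OF ef(1,2) h(1)] ef h ge by fastforce
  then obtain u v where uv: "V {e, f} = {u, v}" "u \<noteq> v" by (auto simp: card_2_iff)
  have "mends G d \<subseteq> {u, v}" if d: "d \<in> S" for d
  proof (cases "d = e \<or> d = f")
    case True
    then show ?thesis using uv(1) by (auto simp: verts_of_def)
  next
    case False
    have sub: "V {e, f} \<subseteq> V {e, f, d}" by (rule verts_of_mono) auto
    moreover have "card (V {e, f, d}) \<le> card (V {e, f})"
    proof -
      have "card (V {e, f, d}) \<le> 2" using V3[OF ef(1,2) d ef(3)] False by blast
      also have "2 = card (V {e, f})" using uv by simp
      finally show ?thesis .
    qed
    ultimately have "V {e, f} = V {e, f, d}"
      using finV[of "{e, f, d}"] ef d by (intro card_seteq) auto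
    then show ?thesis using uv(1) by (auto simp: verts_of_def)
  qed
  then show ?thesis using that uv(2) by blast
qed


text \<open>The joints and links form one line with at least four elements, so they live on two
  vertices. Each joint also lies on a line with its three anchors, which lives on a different pair
  of vertices, so the joint is a loop at their common vertex. Hence the links join the two joint
  vertices, patch edges lead to a third vertex, and each link closes a balanced triangle with the
  pairs of patch edges of its label. Four such triangles around one patch give the relation;
  \<open>\<eta>\<close> is the gain of a link between the joint vertices.\<close>

theorem link_gains:
  assumes H: "\<And>Z. Z \<subseteq> E \<Longrightarrow> indep Z \<longleftrightarrow> load_indep \<kappa> lab pv Z"
    and J: "\<And>c. J c \<in> E" "\<And>c. \<kappa> (J c) = At c"
    and A: "\<And>c. A c \<subseteq> E" "\<And>c. card (A c) = 3" "\<And>c e. e \<in> A c \<Longrightarrow> \<kappa> e = To c (i0 c)"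
    and L: "L = {e \<in> E. \<kappa> e = Link}" "inj_on lab L" "card L \<ge> 2"
  obtains \<eta> where "\<And>l. l \<in> L \<Longrightarrow> \<eta> l \<in> carrier \<Gamma>" "inj_on \<eta> L"
    "\<And>i s1 s2 t1 t2 x y z w. {s1, s2, t1, t2} \<subseteq> E \<Longrightarrow> s1 \<noteq> s2 \<Longrightarrow> t1 \<noteq> t2 \<Longrightarrow>
       \<kappa> s1 = To True i \<Longrightarrow> \<kappa> s2 = To True i \<Longrightarrow> \<kappa> t1 = To False i \<Longrightarrow> \<kappa> t2 = To False i \<Longrightarrow>
       {x, y, z, w} \<subseteq> L \<Longrightarrow> lab x = pv s1 t1 \<Longrightarrow> lab y = pv s2 t1 \<Longrightarrow> lab z = pv s2 t2 \<Longrightarrow> lab w = pv s1 t2 \<Longrightarrow>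
       \<eta> w = \<eta> x \<otimes> inv (\<eta> y) \<otimes> \<eta> z"
proof -
  have finL: "finite L" and LE: "L \<subseteq> E" using L(1) finE by auto
  have Jinj: "J c = J d \<longleftrightarrow> c = d" for c d
  proof
    assume "J c = J d"
    then have "\<kappa> (J c) = \<kappa> (J d)" by (rule arg_cong)
    then show "c = d" unfolding J(2) by (rule kind.inject(1)[THEN iffD1])
  qed (rule arg_cong)
  have UL: "unit_point \<kappa> lab pv {l} v \<longleftrightarrow> v = Point (lab l)" if "l \<in> L" for l v
    using that L(1) by (auto simp: unit_point_singleton)
  have UJ: "unit_point \<kappa> lab pv {J c} v \<longleftrightarrow> v = Joint c" for c v
    using J(2) by (auto simp: unit_point_singleton)
  have UT: "\<not> unit_point \<kappa> lab pv {t} v" if "\<kappa> t = To c i" for t c i v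
    using that by (auto simp: unit_point_singleton)
  have JL: "J c \<notin> L" for c using J(2) L(1) by auto
  have pairI: "indep {e, f}"
    if "e \<in> E" "f \<in> E" "e \<noteq> f" "\<And>v. unit_point \<kappa> lab pv {e} v \<Longrightarrow> \<not> unit_point \<kappa> lab pv {f} v" for e f
    using H[of "{e, f}"] load_indep_pair[OF that(3,4)] that(1,2) by blast
  have finV: "finite (V W)" if "W \<subseteq> E" for W using finite_verts_of[OF multigraph that] .

  \<comment> \<open>Two joints and at least two links: the four elements that
    \<open>long_line_ends\<close> asks for.\<close>
  let ?S = "range J \<union> L"
  have rJ: "range J = {J False, J True}" by (auto simp: UNIV_bool)
  have SE: "?S \<subseteq> E" using J(1) LE by auto
  have "card ?S = card (range J) + card L"
    using finL JL by (intro card_Un_disjoint) (auto simp: rJ)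
  then have S4: "card ?S \<ge> 4" using L(3) by (simp add: rJ Jinj)
  have Spair: "indep {e, f}" if ef: "e \<in> ?S" "f \<in> ?S" "e \<noteq> f" for e f
  proof (rule pairI)
    show "e \<in> E" "f \<in> E" "e \<noteq> f" using ef SE by auto
    fix v assume e: "unit_point \<kappa> lab pv {e} v"
    show "\<not> unit_point \<kappa> lab pv {f} v"
    proof
      assume f: "unit_point \<kappa> lab pv {f} v"
      from ef(1,2) consider "e \<in> L" "f \<in> L" | c where "e \<in> L" "f = J c" | c where "e = J c" "f \<in> L"
        | c d where "e = J c" "f = J d" by blast
      then show False
      proof cases
        case 1
        then have "lab e = lab f" using e f UL by simp
        then show False using L(2) 1 ef(3) by (simp add: inj_on_eq_iff)
      next
        case 2
        then show False using e f UL UJ by simp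
      next
        case 3
        then show False using e f UL UJ by simp
      next
        case (4 c d)
        then show False using e f UJ ef(3) by simp
      qed
    qed
  qed
  have Striple: "\<not> indep {e, f, h}"
    if efh: "e \<in> ?S" "f \<in> ?S" "h \<in> ?S" "e \<noteq> f" "e \<noteq> h" "f \<noteq> h" for e f h
  proof -
    have "\<kappa> x \<noteq> To c i" if "x \<in> ?S" for x c i using that J(2) L(1) by auto
    then have "patches \<kappa> {e, f, h} = {}" using efh by (auto simp: patches_def)
    then have "\<not> load_indep \<kappa> lab pv {e, f, h}" using efh by (simp add: load_indep_def)
    then show ?thesis using H[of "{e, f, h}"] efh SE by blast
  qed
  obtain u v where uv: "u \<noteq> v" "\<And>e. e \<in> ?S \<Longrightarrow> mends G e \<subseteq> {u, v}"
    using long_line_ends[OF SE Spair Striple S4] by blast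
  have L0: "L \<noteq> {}" using L(3) by auto
  then obtain l0 where l0: "l0 \<in> L" by auto

  have toJ: "indep {t, J c}" if "t \<in> E" "\<kappa> t = To d i" for t c d i
    using that J(1)[of c] J(2)[of c] UT[OF that(2)] by (intro pairI) auto
  have tot: "indep {t, t'}" if "t \<in> E" "t' \<in> E" "t \<noteq> t'" "\<kappa> t = To d i" for t t' d i
    using that UT[OF that(4)] by (intro pairI) auto

  \<comment> \<open>Three anchors and the joint again make four elements. An anchor, the joint and a
    link are independent and so span three vertices, hence the vertex pairs of the two lines differ
    and meet in at most one vertex.\<close>
  have "\<exists>x. mends G (J c) = {x}" for c
  proof -
    let ?T = "insert (J c) (A c)"
    have JA: "J c \<notin> A c" using A(3)[of "J c" c] J(2) by auto
    have finA: "finite (A c)" using A(1) finE finite_subset by blast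
    have TE: "?T \<subseteq> E" using J(1) A(1) by auto
    have T4: "card ?T \<ge> 4" using JA finA A(2) by simp
    have Tpair: "indep {e, f}" if ef: "e \<in> ?T" "f \<in> ?T" "e \<noteq> f" for e f
    proof -
      consider "e = J c" "f \<in> A c" | "f = J c" "e \<in> A c" | "e \<in> A c" "f \<in> A c" using ef by auto
      then show ?thesis
      proof cases
        case 1
        then show ?thesis using toJ[of f c "i0 c" c] A(1,3) by (auto simp: insert_commute)
      next
        case 2
        then show ?thesis using toJ[of e c "i0 c" c] A(1,3) by auto
      next
        case 3
        then show ?thesis using tot[of e f c "i0 c"] A(1,3) ef(3) by blast
      qed
    qed
    have dep1: "\<not> indep {J c, e, f}" if "e \<in> A c" "f \<in> A c" "e \<noteq> f" for e f
    proof -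
      have "unit_point \<kappa> lab pv {e, f} (Joint c)"
        using unit_point.Same[of e f \<kappa> c "i0 c" lab pv] that A(3) by blast
      then have "\<not> load_indep \<kappa> lab pv {J c, e, f}"
        using UJ[of c "Joint c"] that JA
        by (intro not_load_indep[where U = "{J c}" and U' = "{e, f}" and v = "Joint c"]) auto
      then show ?thesis using H[of "{J c, e, f}"] that TE by blast
    qed
    have dep2: "\<not> indep {e, f, h}" if "e \<in> A c" "f \<in> A c" "h \<in> A c" "e \<noteq> f" "e \<noteq> h" "f \<noteq> h" for e f h
    proof -
      have "unit_point \<kappa> lab pv {e, f} (Joint c)" "unit_point \<kappa> lab pv {e, h} (Joint c)"
        using unit_point.Same[of e f \<kappa> c "i0 c" lab pv] unit_point.Same[of e h \<kappa> c
          "i0 c" lab pv] that A(3) by blast+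
      then have "\<not> load_indep \<kappa> lab pv {e, f, h}"
        using that
        by (intro not_load_indep[where U = "{e, f}" and U' = "{e, h}" and v = "Joint c"])
          (auto simp: doubleton_eq_iff)
      then show ?thesis using H[of "{e, f, h}"] that TE by blast
    qed
    have Ttriple: "\<not> indep {e, f, h}"
      if efh: "e \<in> ?T" "f \<in> ?T" "h \<in> ?T" "e \<noteq> f" "e \<noteq> h" "f \<noteq> h" for e f h
    proof -
      consider "e = J c" "f \<in> A c" "h \<in> A c" | "f = J c" "e \<in> A c" "h \<in> A c"
        | "h = J c" "e \<in> A c" "f \<in> A c" | "e \<in> A c" "f \<in> A c" "h \<in> A c" using efh by auto
      then show ?thesis
      proof cases
        case 1
        then show ?thesis using dep1[of f h] efh by simp
      next
        case 2
        then show ?thesis using dep1[of e h] efh by (simp add: insert_commute)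
      next
        case 3
        then show ?thesis using dep1[of e f] efh by (simp add: insert_commute)
      next
        case 4
        then show ?thesis using dep2 efh by blast
      qed
    qed
    obtain u' v' where uv': "u' \<noteq> v'" "\<And>e. e \<in> ?T \<Longrightarrow> mends G e \<subseteq> {u', v'}"
      using long_line_ends[OF TE Tpair Ttriple T4] by blast
    obtain t where t: "t \<in> A c" using A(2)[of c] by fastforce
    have "load_indep \<kappa> lab pv {t, J c, l0}"
      using A(3)[OF t] UJ[of c "Joint c"] UL[OF l0, of "Point (lab l0)"]
      by (intro load_indep_triple[of \<kappa> t c "i0 c" lab pv "J c" "Joint c" l0 "Point (lab l0)"]) auto
    moreover have tE: "{t, J c, l0} \<subseteq> E" using A(1) t J(1) l0 LE by blast
    ultimately have ind: "indep {t, J c, l0}" using H by blast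
    have "t \<noteq> l0" using A(3)[OF t] l0 L(1) by auto
    moreover have "t \<noteq> J c" "J c \<noteq> l0" using t JA l0 JL by auto
    ultimately have "card (V {t, J c, l0}) \<ge> 3" using indep_card[OF ind order_refl] by simp
    moreover have "V {t, J c, l0} \<subseteq> {u, v} \<union> {u', v'}"
      using uv(2) uv'(2) t l0 by (auto simp: verts_of_def)
    then have "card (V {t, J c, l0}) \<le> card ({u, v} \<union> {u', v'})" by (intro card_mono) auto
    ultimately have "card ({u, v} \<union> {u', v'}) \<ge> 3" by linarith
    moreover have "card {u, v} \<le> 2" by (simp add: card_insert_if)
    ultimately have "{u, v} \<noteq> {u', v'}" using Un_absorb[of "{u, v}"] by force
    moreover have "mends G (J c) \<subseteq> {u, v}" "mends G (J c) \<subseteq> {u', v'}" using uv(2) uv'(2) by auto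
    moreover have "mends G (J c) \<noteq> {}" using ends[OF J(1)[of c]] by auto
    ultimately show ?thesis using uv(1) uv'(1) by auto
  qed
  then obtain x where x: "\<And>c. mends G (J c) = {x c}" by metis
  have "card (V {J False, J True}) \<ge> 2"
    using indep_card[OF Spair[of "J False" "J True"] order_refl] by (simp add: Jinj)
  then have xne: "x False \<noteq> x True" using x by (auto simp: verts_of_def)
  then have uvx: "{u, v} = {x False, x True}" using uv(2)[of "J False"] uv(2)[of "J True"] x by auto
  have link: "mends G l = {x True, x False}" if l: "l \<in> L" for l
  proof -
    have "mends G l \<noteq> {x c}" for c
    proof
      assume "mends G l = {x c}"
      then have "card (V {l, J c}) = 1" using x by (simp add: verts_of_def)
      moreover have "l \<noteq> J c" using l JL by auto
      then have "card (V {l, J c}) \<ge> 2"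
        using indep_card[OF Spair[of l "J c"] order_refl] l by simp
      ultimately show False by simp
    qed
    then have "mends G l \<noteq> {x False}" "mends G l \<noteq> {x True}" by blast+
    moreover have "mends G l \<in> Pow {x False, x True}" using uv(2)[of l] l uvx by auto
    moreover have "mends G l \<noteq> {}" using ends[of l] l LE by auto
    ultimately show ?thesis by (auto simp: Pow_insert)
  qed
  define \<eta> where "\<eta> l = \<sigma> l (x True) (x False)" for l
  have \<eta>: "\<eta> l \<in> carrier \<Gamma>" "\<sigma> l (x False) (x True) = inv (\<eta> l)" if "l \<in> L" for l
    using gain_inv[of l "x True" "x False"] link[OF that] that LE xne by (auto simp: \<eta>_def)
  have inj: "inj_on \<eta> L"
  proof (rule inj_onI, rule ccontr)
    fix l l' assume l: "l \<in> L" "l' \<in> L" "\<eta> l = \<eta> l'" "l \<noteq> l'"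
    have "cycle_traversal G [(l, x True, x False), (l', x False, x True)]"
      using link[OF l(1)] link[OF l(2)] l LE xne by (auto simp: cycle_traversal_alt insert_commute)
    moreover have "walk_gain \<Gamma> \<sigma> [(l, x True, x False), (l', x False, x True)] = \<one>"
      using \<eta>[OF l(1)] \<eta>[OF l(2)] l(3) by (simp add: \<eta>_def[symmetric])
    ultimately have "fst ` set [(l, x True, x False), (l', x False, x True)] \<in> balanced_cycles \<Gamma> G \<sigma>"
      unfolding balanced_cycles_def by blast
    then show False using indep_unbalanced[OF Spair[of l l']] l by auto
  qed

  \<comment> \<open>With the joint a loop, the dependent triple of \<open>J c\<close>,
    \<open>t\<close> and \<open>t'\<close> is no triangle, so it has two vertices. Independence of
    \<open>t\<close> from both joints makes the vertex \<open>a\<close> new. At this stage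
    \<open>t\<close> could still be a loop at \<open>a\<close>; \<open>triangle\<close> excludes
    this.\<close>
  have patch_end: "\<exists>a. a \<in> mends G t \<and> a \<noteq> x False \<and> a \<noteq> x True \<and> mends G t \<subseteq> {x c, a}"
    if t: "t \<in> E" "t' \<in> E" "t \<noteq> t'" "\<kappa> t = To c i" "\<kappa> t' = To c i" for t t' c i
  proof -
    have ne: "J c \<noteq> t" "J c \<noteq> t'" using J(2) t by auto
    have "unit_point \<kappa> lab pv {t, t'} (Joint c)" using unit_point.Same[of t t' \<kappa> c i lab pv] t by blast
    then have "\<not> load_indep \<kappa> lab pv {J c, t, t'}"
      using UJ[of c "Joint c"] ne
      by (intro not_load_indep[where U = "{J c}" and U' = "{t, t'}" and v = "Joint c"]) auto
    then have "\<not> indep {J c, t, t'}" using H[of "{J c, t, t'}"] t J(1) by blast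
    moreover have "{J c, t, t'} \<notin> balanced_cycles \<Gamma> G \<sigma>"
    proof
      assume "{J c, t, t'} \<in> balanced_cycles \<Gamma> G \<sigma>"
      then obtain u v where "u \<noteq> v" "mends G (J c) = {u, v}"
        using balanced_triangle[OF _ ne t(3)] by metis
      then show False using x by (metis doubleton_eq_iff insert_absorb2)
    qed
    ultimately have "card (V {J c, t, t'}) \<le> 2"
      using dependent_triple[of "J c" t t'] toJ[of t] toJ[of t'] tot t J(1)
        by (auto simp: insert_commute)
    moreover have "card (V {t, J c}) \<le> card (V {J c, t, t'})"
      using finV[of "{J c, t, t'}"] t J(1) by (intro card_mono verts_of_mono) auto
    moreover have "card {t, J c} = 2" using ne by auto
    then have "card (V {t, J c}) \<ge> 2" using indep_card[OF toJ[OF t(1,4), of c] order_refl] by simp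
    ultimately have "card (V {t, J c}) = 2" by simp
    moreover have V: "V {t, J c} = insert (x c) (mends G t)" using x by (auto simp: verts_of_def)
    ultimately obtain a where a: "insert (x c) (mends G t) = {x c, a}" "a \<noteq> x c"
      by (metis card_2_iff insertI1 doubleton_eq_iff insertE singletonD)
    then have at: "a \<in> mends G t" "mends G t \<subseteq> {x c, a}" by auto
    have "load_indep \<kappa> lab pv {t, J False, J True}"
      using t(4) UJ[of False "Joint False"] UJ[of True "Joint True"]
      by (intro load_indep_triple[of \<kappa> t c i lab pv "J False" "Joint False" "J True" "Joint True"]) auto
    then have ind: "indep {t, J False, J True}" using H[of "{t, J False, J True}"] t(1) J(1) by blast
    have "t \<noteq> J d" for d using J(2)[of d] t(4) by auto
    then have "card {t, J False, J True} = 3" using Jinj[of False True] by simp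
    then have "card (V {t, J False, J True}) \<ge> 3" using indep_card[OF ind order_refl] by simp
    moreover have "V {t, J False, J True} = {x False, x True, a}"
      using x a at by (cases c) (auto simp: verts_of_def)
    ultimately have "card {x False, x True, a} \<ge> 3" by simp
    then have "a \<noteq> x False" "a \<noteq> x True" by (auto simp: card_insert_if split: if_splits)
    then show ?thesis using at by blast
  qed

  \<comment> \<open>The link has both joint vertices and \<open>t\<close> contributes a third, so
    the dependent triple \<open>{s, l, t}\<close> must be a balanced triangle. The partners
    \<open>s'\<close> and \<open>t'\<close> serve only to apply \<open>patch_end\<close>.\<close>
  have triangle:
    "mends G t \<noteq> {} \<and> (\<exists>a. a \<notin> {x False, x True} \<and> mends G s = {a, x True} \<and> mends G t = {a, x False} \<and>
      \<sigma> s a (x True) \<otimes> \<eta> l = \<sigma> t a (x False))"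
    if st: "{s, t, s', t'} \<subseteq> E" "s \<noteq> s'" "t \<noteq> t'" "\<kappa> s = To True i" "\<kappa> s' = To True i"
      "\<kappa> t = To False i" "\<kappa> t' = To False i" and l: "l \<in> L" "lab l = pv s t" for s t s' t' i l
  proof -
    obtain a where a: "a \<in> mends G t" "a \<noteq> x False" "a \<noteq> x True"
      using patch_end[of t t' False i] st by auto
    have lst: "l \<noteq> s" "l \<noteq> t" "s \<noteq> t" using l st L(1) by auto
    have "unit_point \<kappa> lab pv {s, t} (Point (lab l))"
      using unit_point.Mixed[of \<kappa> s i t lab pv] st l by simp
    then have "\<not> load_indep \<kappa> lab pv {s, l, t}"
      using UL[OF l(1)] lst
      by (intro not_load_indep[where U = "{l}" and U' = "{s, t}" and v = "Point (lab l)"]) auto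
    then have dep: "\<not> indep {s, l, t}" using H[of "{s, l, t}"] st l LE by blast
    have lt: "indep {e, l}" if "e \<in> E" "\<kappa> e = To c i" for e c
      using that l LE L(1) UT[OF that(2)] by (intro pairI) auto
    have "{x False, x True, a} \<subseteq> V {s, l, t}" using link[OF l(1)] a by (auto simp: verts_of_def)
    then have "card {x False, x True, a} \<le> card (V {s, l, t})"
      using finV[of "{s, l, t}"] st l LE by (intro card_mono) auto
    then have "\<not> card (V {s, l, t}) \<le> 2" using a xne by auto
    then have "{s, l, t} \<in> balanced_cycles \<Gamma> G \<sigma>"
      using dependent_triple[of s l t] dep lt[of s] lt[of t] tot[of s t True i] st l LE lst
      by (auto simp: insert_commute)
    then obtain u v w where t3: "u \<noteq> v" "v \<noteq> w" "u \<noteq> w"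
      "mends G s = {u, v}" "mends G l = {v, w}" "mends G t = {w, u}"
      "\<sigma> s u v \<otimes> \<sigma> l v w \<otimes> \<sigma> t w u = \<one>"
      using balanced_triangle[of s l t] lst by metis
    obtain b where b: "b \<in> mends G s" "b \<noteq> x False" "b \<noteq> x True" "mends G s \<subseteq> {x True, b}"
      using patch_end[of s s' True i] st by auto
    have vw: "{v, w} = {x True, x False}" using t3(5) link[OF l(1)] by simp
    have "v = x True" using b t3(1,4) vw by (auto simp: doubleton_eq_iff)
    moreover from this have "w = x False" using vw t3(2) by (auto simp: doubleton_eq_iff)
    moreover have u: "u \<notin> {x False, x True}" using t3(1,3) calculation by auto
    ultimately have m: "mends G s = {u, x True}" "mends G t = {u, x False}"
      and gg: "\<sigma> s u (x True) \<otimes> \<eta> l \<otimes> \<sigma> t (x False) u = \<one>"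
      using t3 by (auto simp: \<eta>_def)
    have gs: "\<sigma> s u (x True) \<in> carrier \<Gamma>" using gain_inv[of s u "x True"] m u st by auto
    have gt: "\<sigma> t u (x False) \<in> carrier \<Gamma>" "\<sigma> t (x False) u = inv (\<sigma> t u (x False))"
      using gain_inv[of t u "x False"] m u st by auto
    have "\<sigma> s u (x True) \<otimes> \<eta> l = \<sigma> t u (x False)"
      using gg gs gt \<eta>(1)[OF l(1)] by (metis inv_equality inv_inv m_closed inv_closed)
    then show ?thesis using m u by blast
  qed

  show ?thesis
  proof (rule that[of \<eta>])
    fix i s1 s2 t1 t2 lx ly lz lw
    assume st: "{s1, s2, t1, t2} \<subseteq> E" "s1 \<noteq> s2" "t1 \<noteq> t2"
      "\<kappa> s1 = To True i" "\<kappa> s2 = To True i" "\<kappa> t1 = To False i" "\<kappa> t2 = To False i"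
      and l: "{lx, ly, lz, lw} \<subseteq> L" "lab lx = pv s1 t1" "lab ly = pv s2 t1" "lab lz = pv s2 t2"
        "lab lw = pv s1 t2"
    obtain a where a: "a \<notin> {x False, x True}" "mends G s1 = {a, x True}" "mends G t1 = {a, x False}"
      "\<sigma> s1 a (x True) \<otimes> \<eta> lx = \<sigma> t1 a (x False)"
      using triangle[of s1 t1 s2 t2 i lx] st l by auto
    obtain b where b: "b \<notin> {x False, x True}" "mends G s2 = {b, x True}" "mends G t1 = {b, x False}"
      "\<sigma> s2 b (x True) \<otimes> \<eta> ly = \<sigma> t1 b (x False)"
      using triangle[of s2 t1 s1 t2 i ly] st l by auto
    obtain c where c: "c \<notin> {x False, x True}" "mends G s2 = {c, x True}" "mends G t2 = {c, x False}"
      "\<sigma> s2 c (x True) \<otimes> \<eta> lz = \<sigma> t2 c (x False)"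
      using triangle[of s2 t2 s1 t1 i lz] st l by auto
    obtain d where d: "d \<notin> {x False, x True}" "mends G s1 = {d, x True}" "mends G t2 = {d, x False}"
      "\<sigma> s1 d (x True) \<otimes> \<eta> lw = \<sigma> t2 d (x False)"
      using triangle[of s1 t2 s2 t1 i lw] st l by auto
    \<comment> \<open>Consecutive triangles share a patch edge, so all four have the same vertex
      away from the joints.\<close>
    have "b = a" using a(1,3) b(1,3) by (auto simp: doubleton_eq_iff)
    moreover have "d = a" using a(1,2) d(1,2) by (auto simp: doubleton_eq_iff)
    moreover have "c = a" using calculation b(1,2) c(1,2) by (auto simp: doubleton_eq_iff)
    ultimately have eqs: "\<sigma> s1 a (x True) \<otimes> \<eta> lx = \<sigma> t1 a (x False)"
      "\<sigma> s2 a (x True) \<otimes> \<eta> ly = \<sigma> t1 a (x False)"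
      "\<sigma> s2 a (x True) \<otimes> \<eta> lz = \<sigma> t2 a (x False)" "\<sigma> s1 a (x True) \<otimes> \<eta> lw = \<sigma> t2 a (x False)"
      using a b c d by auto
    have cl: "\<eta> lx \<in> carrier \<Gamma>" "\<eta> ly \<in> carrier \<Gamma>" "\<eta> lz \<in> carrier \<Gamma>" "\<eta> lw \<in> carrier \<Gamma>"
      using \<eta> l by auto
    have cs: "\<sigma> s1 a (x True) \<in> carrier \<Gamma>" "\<sigma> s2 a (x True) \<in> carrier \<Gamma>"
      using gain_inv[of s1 a "x True"] gain_inv[of s2 a "x True"] a b \<open>b = a\<close> st by auto
    have "\<sigma> s1 a (x True) \<otimes> \<eta> lx \<otimes> inv (\<eta> ly) = \<sigma> s2 a (x True)"
      using eqs(1,2) cl cs by (metis inv_solve_right m_closed)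
    then have "\<sigma> s1 a (x True) \<otimes> (\<eta> lx \<otimes> inv (\<eta> ly) \<otimes> \<eta> lz) = \<sigma> s1 a (x True) \<otimes> \<eta> lw"
      using eqs(3,4) cl cs by (simp add: m_assoc[symmetric])
    then show "\<eta> lw = \<eta> lx \<otimes> inv (\<eta> ly) \<otimes> \<eta> lz" using cl cs by simp
  qed (use \<eta> inj in auto)
qed

end

section \<open>Spread subsets of finite groups\<close>

text \<open>A random subset of \<open>D\<close> contains a given set of at most three elements with
  probability at least 1/8. For disjoint sets these events are independent, so all fail with
  probability at most \<open>(7/8) ^ card M\<close>. The powers are multiplied out to stay within
  the natural numbers.\<close>

lemma card_avoiding_sets:
  assumes "finite M" "finite D" "\<And>y. y \<in> M \<Longrightarrow> T y \<subseteq> D \<and> card (T y) \<le> 3"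
    and "\<And>y z. y \<in> M \<Longrightarrow> z \<in> M \<Longrightarrow> y \<noteq> z \<Longrightarrow> T y \<inter> T z = {}"
  shows "card {R. R \<subseteq> D \<and> (\<forall>y \<in> M. \<not> T y \<subseteq> R)} * 8 ^ card M \<le> 7 ^ card M * 2 ^ card D"
  using assms
proof (induction M arbitrary: D rule: finite_induct)
  case empty
  have "{R. R \<subseteq> D} = Pow D" by auto
  then show ?case using empty by (simp add: card_Pow)
next
  case (insert y M)
  let ?D = "D - T y"
  let ?bad = "\<lambda>M D. {R. R \<subseteq> D \<and> (\<forall>y \<in> M. \<not> T y \<subseteq> R)}"
  have Ty: "T y \<subseteq> D" "card (T y) \<le> 3" "finite (T y)"
    using insert.prems by (auto intro: finite_subset)
  have IH: "card (?bad M ?D) * 8 ^ card M \<le> 7 ^ card M * 2 ^ card ?D"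
  proof (rule insert.IH)
    fix z assume z: "z \<in> M"
    then have "T z \<inter> T y = {}" using insert.prems(3)[of z y] insert.hyps by auto
    then show "T z \<subseteq> ?D \<and> card (T z) \<le> 3" using insert.prems(2)[of z] z by auto
  qed (use insert.prems in auto)
  have "?bad (insert y M) D \<subseteq> (\<lambda>(A, B). A \<union> B) ` ((Pow (T y) - {T y}) \<times> ?bad M ?D)"
  proof
    fix R assume R: "R \<in> ?bad (insert y M) D"
    have "R = (\<lambda>(A, B). A \<union> B) (R \<inter> T y, R - T y)" by auto
    moreover have "R \<inter> T y \<in> Pow (T y) - {T y}" "R - T y \<in> ?bad M ?D" using R by auto
    ultimately show "R \<in> (\<lambda>(A, B). A \<union> B) ` ((Pow (T y) - {T y}) \<times> ?bad M ?D)"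
      by (intro image_eqI[where x = "(R \<inter> T y, R - T y)"] SigmaI)
  qed
  moreover have fin: "finite ((Pow (T y) - {T y}) \<times> ?bad M ?D)" using Ty insert.prems(1) by simp
  ultimately have "card (?bad (insert y M) D) \<le> card ((Pow (T y) - {T y}) \<times> ?bad M ?D)"
    by (intro surj_card_le)
  also have "\<dots> = (2 ^ card (T y) - 1) * card (?bad M ?D)"
    using Ty(3) by (subst card_cartesian_product, subst card_Diff_singleton) (auto simp: card_Pow)
  finally have 1: "card (?bad (insert y M) D) \<le> (2 ^ card (T y) - 1) * card (?bad M ?D)" .
  have "(2 :: nat) ^ card (T y) \<le> 2 ^ 3" using Ty(2) by (intro power_increasing) auto
  then have 2: "(2 ^ card (T y) - 1) * 8 \<le> (7 :: nat) * 2 ^ card (T y)" by (simp add: algebra_simps)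
  have "card (?bad (insert y M) D) * 8 ^ card (insert y M)
      \<le> (2 ^ card (T y) - 1) * card (?bad M ?D) * 8 ^ card (insert y M)"
    using 1 by (rule mult_le_mono1)
  also have "\<dots> = ((2 ^ card (T y) - 1) * 8) * (card (?bad M ?D) * 8 ^ card M)"
    using insert.hyps by simp
  also have "\<dots> \<le> (7 * 2 ^ card (T y)) * (7 ^ card M * 2 ^ card ?D)"
    by (intro mult_le_mono 2 IH)
  also have "\<dots> = 7 ^ card (insert y M) * (2 ^ (card (T y) + card ?D))"
    using insert.hyps by (simp add: power_add)
  also have "card (T y) + card ?D = card D"
    using Ty insert.prems(1) by (metis card_Diff_subset card_mono le_add_diff_inverse)
  finally show ?case .
qed

text \<open>
  A set is spread if it meets any three of its translates in a common point. This holds for a random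
  half of a large group, and it makes a map that respects the relations \<open>x y\<^sup>-\<^sup>1 z = w\<close> inside the set
  extend to the group.
\<close>

definition spread :: "('a, 'm) monoid_scheme \<Rightarrow> 'a set \<Rightarrow> 'a set \<Rightarrow> bool" where
  "spread G A X \<longleftrightarrow> X \<subseteq> A \<and> (\<forall>k \<in> A. \<forall>l \<in> A. \<exists>y \<in> X. k \<otimes>\<^bsub>G\<^esub> y \<in> X \<and> l \<otimes>\<^bsub>G\<^esub> y \<in> X)"

context group
begin

text \<open>A maximal \<open>M\<close> works: every triple meets one of the chosen triples, so
  \<open>g y' = h y\<close> with \<open>g\<close> and \<open>h\<close> among three elements. Each
  \<open>y\<close> in \<open>M\<close> accounts for at most nine such \<open>y'\<close>.\<close>

lemma disjoint_translates:
  assumes A: "subgroup A G" "finite A" and kl: "k \<in> A" "l \<in> A"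
  shows "\<exists>M \<subseteq> A. card A \<le> 9 * card M \<and>
    (\<forall>y \<in> M. \<forall>z \<in> M. y \<noteq> z \<longrightarrow> {y, k \<otimes> y, l \<otimes> y} \<inter> {z, k \<otimes> z, l \<otimes> z} = {})"
proof -
  let ?T = "\<lambda>y. {y, k \<otimes> y, l \<otimes> y}"
  let ?P = "\<lambda>M. M \<subseteq> A \<and> (\<forall>y \<in> M. \<forall>z \<in> M. y \<noteq> z \<longrightarrow> ?T y \<inter> ?T z = {})"
  have "?P {}" by simp
  moreover have "\<forall>M. ?P M \<longrightarrow> card M < Suc (card A)" using A(2) by (auto simp: card_mono less_Suc_eq_le)
  ultimately have "\<exists>M. ?P M \<and> (\<forall>M'. ?P M' \<longrightarrow> card M' \<le> card M)"
    by (rule ex_has_greatest_nat)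
  then obtain M where M: "?P M" and max: "\<And>M'. ?P M' \<Longrightarrow> card M' \<le> card M" by (elim exE conjE) simp
  let ?S = "{\<one>, k, l}"
  have c: "x \<in> carrier G" if "x \<in> A" for x using that A(1) subgroup.mem_carrier by metis
  have "A \<subseteq> (\<lambda>(y, g, h). inv g \<otimes> (h \<otimes> y)) ` (M \<times> ?S \<times> ?S)"
  proof
    fix y' assume y': "y' \<in> A"
    have "\<exists>y \<in> M. ?T y' \<inter> ?T y \<noteq> {}"
    proof (cases "y' \<in> M")
      case False
      have "finite M" using M A(2) finite_subset by blast
      then have "card (insert y' M) > card M" using False by simp
      then have "\<not> ?P (insert y' M)" using max not_le by blast
      show ?thesis
      proof (rule ccontr)
        assume "\<not> ?thesis"
        then have no: "?T y' \<inter> ?T y = {}" if "y \<in> M" for y using that by blast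
        have "?T y \<inter> ?T z = {}" if "y \<in> insert y' M" "z \<in> insert y' M" "y \<noteq> z" for y z
          using that no[of y] no[of z] M by (metis Int_commute insertE)
        then have "?P (insert y' M)" using M y' by (intro conjI ballI impI) auto
        then show False using \<open>\<not> ?P (insert y' M)\<close> by contradiction
      qed
    qed auto
    then obtain y where y: "y \<in> M" "?T y' \<inter> ?T y \<noteq> {}" by blast
    have cc: "y \<in> carrier G" "y' \<in> carrier G" "k \<in> carrier G" "l \<in> carrier G"
      using M y y' kl c by auto
    have "\<exists>g \<in> ?S. \<exists>h \<in> ?S. g \<otimes> y' = h \<otimes> y"
    proof -
      have "?T z = (\<lambda>g. g \<otimes> z) ` ?S" if "z \<in> carrier G" for z using that by auto
      then have "(\<lambda>g. g \<otimes> y') ` ?S \<inter> (\<lambda>g. g \<otimes> y) ` ?S \<noteq> {}" using y(2) cc by simp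
      then obtain u where "u \<in> (\<lambda>g. g \<otimes> y') ` ?S" "u \<in> (\<lambda>g. g \<otimes> y) ` ?S" by blast
      then obtain g h where "g \<in> ?S" "h \<in> ?S" "u = g \<otimes> y'" "u = h \<otimes> y" by (elim imageE)
      then show ?thesis by metis
    qed
    then obtain g h where gh: "g \<in> ?S" "h \<in> ?S" "g \<otimes> y' = h \<otimes> y" by blast
    have "g \<in> carrier G" "h \<in> carrier G" using gh cc by auto
    then have "y' = inv g \<otimes> (h \<otimes> y)" using gh(3) cc by (metis inv_solve_left m_closed)
    then show "y' \<in> (\<lambda>(y, g, h). inv g \<otimes> (h \<otimes> y)) ` (M \<times> ?S \<times> ?S)"
      using y(1) gh(1,2) by force
  qed
  moreover have finM: "finite M" using M A(2) finite_subset by blast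
  moreover have "finite (M \<times> ?S \<times> ?S)" using finM by blast
  ultimately have "card A \<le> card (M \<times> ?S \<times> ?S)" by (intro surj_card_le)
  also have "\<dots> = card M * (card ?S * card ?S)" by (simp only: card_cartesian_product)
  also have "\<dots> \<le> card M * (3 * 3)"
    by (intro mult_le_mono order_refl) (auto simp: card_insert_if)
  finally show ?thesis using M by (intro exI[of _ M]) auto
qed

text \<open>A union bound over the pairs \<open>k\<close>, \<open>l\<close>. Points of
  \<open>A - D\<close> are always in the set, so a triple is available as soon as \<open>R\<close>
  contains its part in \<open>D\<close>.\<close>

lemma card_nonspread:
  assumes A: "subgroup A G" "finite A" and D: "D \<subseteq> A"
  shows "real (card {R. R \<subseteq> D \<and> \<not> spread G A (A - D \<union> R)})
    \<le> real (card A) ^ 2 * (7 / 8) ^ (card A div 9) * 2 ^ card D"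
proof -
  let ?B = "\<lambda>(k, l). {R. R \<subseteq> D \<and> \<not> (\<exists>y \<in> A - D \<union> R. k \<otimes> y \<in> A - D \<union> R \<and> l \<otimes> y \<in> A - D \<union> R)}"
  have fD: "finite D" using A D finite_subset by blast
  have b: "real (card (?B (k, l))) \<le> (7 / 8) ^ (card A div 9) * 2 ^ card D" if kl: "k \<in> A" "l \<in> A"
    for k l
  proof -
    obtain M where M: "M \<subseteq> A" "card A \<le> 9 * card M"
      "\<And>y z. y \<in> M \<Longrightarrow> z \<in> M \<Longrightarrow> y \<noteq> z \<Longrightarrow> {y, k \<otimes> y, l \<otimes> y} \<inter> {z, k \<otimes> z, l \<otimes> z} = {}"
      using disjoint_translates[OF A kl] by auto
    let ?T = "\<lambda>y. {y, k \<otimes> y, l \<otimes> y} \<inter> D"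
    let ?C = "{R. R \<subseteq> D \<and> (\<forall>y \<in> M. \<not> ?T y \<subseteq> R)}"
    have finM: "finite M" using M A finite_subset by blast
    have "card (?T y) \<le> 3" for y
      by (rule order_trans[OF card_mono[of "{y, k \<otimes> y, l \<otimes> y}"]]) (auto simp: card_insert_if)
    moreover have "?T y \<inter> ?T z = {}" if "y \<in> M" "z \<in> M" "y \<noteq> z" for y z
      using M(3)[OF that] by blast
    ultimately have "card ?C * 8 ^ card M \<le> 7 ^ card M * 2 ^ card D"
      by (intro card_avoiding_sets[OF finM fD]) auto
    then have "real (card ?C * 8 ^ card M) \<le> real (7 ^ card M * 2 ^ card D)" by (rule of_nat_mono)
    then have "real (card ?C) \<le> (7 / 8) ^ card M * 2 ^ card D"
      by (simp add: field_simps power_divide)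
    also have "\<dots> \<le> (7 / 8) ^ (card A div 9) * 2 ^ card D"
      using M(2) by (intro mult_right_mono power_decreasing) auto
    finally have "real (card ?C) \<le> (7 / 8) ^ (card A div 9) * 2 ^ card D" .
    moreover have "?B (k, l) \<subseteq> ?C"
    proof
      fix R assume R: "R \<in> ?B (k, l)"
      have "\<not> ?T y \<subseteq> R" if y: "y \<in> M" for y
      proof
        assume "?T y \<subseteq> R"
        moreover have "{y, k \<otimes> y, l \<otimes> y} \<subseteq> A" using y M kl A by (auto intro: subgroup.m_closed)
        ultimately show False using R by auto
      qed
      then show "R \<in> ?C" using R by auto
    qed
    then have "card (?B (k, l)) \<le> card ?C" using fD by (intro card_mono) auto
    ultimately show ?thesis by linarith
  qed
  have "{R. R \<subseteq> D \<and> \<not> spread G A (A - D \<union> R)} \<subseteq> \<Union> (?B ` (A \<times> A))"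
  proof
    fix R assume R: "R \<in> {R. R \<subseteq> D \<and> \<not> spread G A (A - D \<union> R)}"
    then have "A - D \<union> R \<subseteq> A" using D by auto
    then obtain k l where "k \<in> A" "l \<in> A" "R \<in> ?B (k, l)"
      using R unfolding spread_def by auto
    then show "R \<in> \<Union> (?B ` (A \<times> A))" by blast
  qed
  moreover have "finite (\<Union> (?B ` (A \<times> A)))" using A fD by auto
  ultimately have "card {R. R \<subseteq> D \<and> \<not> spread G A (A - D \<union> R)} \<le> card (\<Union> (?B ` (A \<times> A)))"
    by (intro card_mono)
  also have "\<dots> \<le> (\<Sum>p \<in> A \<times> A. card (?B p))"
    using A by (intro card_UN_le) auto
  finally have "real (card {R. R \<subseteq> D \<and> \<not> spread G A (A - D \<union> R)}) \<le> real (\<Sum>p \<in> A \<times> A. card (?B p))"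
    by (rule of_nat_mono)
  also have "\<dots> = (\<Sum>p \<in> A \<times> A. real (card (?B p)))" by (rule of_nat_sum)
  also have "\<dots> \<le> (\<Sum>p \<in> A \<times> A. (7 / 8) ^ (card A div 9) * 2 ^ card D)"
    using b by (intro sum_mono) auto
  also have "\<dots> = real (card A) ^ 2 * (7 / 8) ^ (card A div 9) * 2 ^ card D"
    by (simp add: card_cartesian_product power2_eq_square)
  finally show ?thesis .
qed

end

text \<open>The bound is one half because two random choices must succeed at the same time.\<close>

lemma spread_threshold: "\<exists>N. \<forall>n \<ge> N. real n ^ 2 * (7 / 8) ^ (n div 9) < 1 / 2"
proof -
  \<comment> \<open>For \<open>q = n div 9\<close> one has \<open>n \<le> 9 * q + 8\<close>.\<close>
  have "(\<lambda>q :: nat. (9 * real q + 8) ^ 2 * (7 / 8) ^ q) \<longlonglongrightarrow> 0" by real_asymp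
  then have "eventually (\<lambda>q :: nat. (9 * real q + 8) ^ 2 * (7 / 8) ^ q < 1 / 2) sequentially"
    by (rule order_tendstoD) simp
  then obtain Q where Q: "\<And>q. q \<ge> Q \<Longrightarrow> (9 * real q + 8) ^ 2 * (7 / 8) ^ q < 1 / 2"
    by (auto simp: eventually_sequentially)
  have "real n ^ 2 * (7 / 8) ^ (n div 9) < 1 / 2" if n: "n \<ge> 9 * Q" for n
  proof -
    have "n \<le> 9 * (n div 9) + 8" by linarith
    then have "real n \<le> 9 * real (n div 9) + 8" by linarith
    then have "real n ^ 2 * (7 / 8) ^ (n div 9) \<le> (9 * real (n div 9) + 8) ^ 2 * (7 / 8) ^ (n div 9)"
      by (intro mult_right_mono power_mono) auto
    also have "\<dots> < 1 / 2" using n by (intro Q) linarith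
    finally show ?thesis .
  qed
  then show ?thesis by blast
qed

text \<open>The elements of \<open>D = A \<inter> B - F\<close> are distributed at random:
  \<open>R\<close> goes to \<open>A\<close>, \<open>D - R\<close> to \<open>B\<close>. Both parts
  are uniformly distributed, so the two failure counts can be added. If \<open>B\<close> is small,
  then so is \<open>D\<close>, and \<open>A\<close> can do without \<open>D\<close>
  altogether.\<close>

theorem spread_partition:
  obtains N where
    "\<And>(G :: ('a, 'm) monoid_scheme) A B F. group G \<Longrightarrow> subgroup A G \<Longrightarrow> subgroup B G \<Longrightarrow> finite A \<Longrightarrow> finite B \<Longrightarrow>
       F \<subseteq> A \<inter> B \<Longrightarrow> N \<le> card A \<Longrightarrow> \<exists>X Y. spread G A X \<and> spread G B Y \<and> X \<inter> Y = F"
proof -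
  obtain N where N: "\<And>n. n \<ge> N \<Longrightarrow> real n ^ 2 * (7 / 8) ^ (n div 9) < 1 / 2"
    using spread_threshold by auto
  \<comment> \<open>The factor 3 is for a small \<open>B\<close>: three translates of
    \<open>D\<close> must not cover \<open>A\<close>.\<close>
  show ?thesis
  proof (rule that[of "3 * N"])
    fix G :: "('a, 'm) monoid_scheme" and A B F
    assume G: "group G" and A: "subgroup A G" "finite A" and B: "subgroup B G" "finite B"
      and F: "F \<subseteq> A \<inter> B" and N3: "3 * N \<le> card A"
    interpret group G by (rule G)
    define D where "D = A \<inter> B - F"
    have fD: "finite D" and DA: "D \<subseteq> A" and DB: "D \<subseteq> B" using A by (auto simp: D_def)
    show "\<exists>X Y. spread G A X \<and> spread G B Y \<and> X \<inter> Y = F"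
    proof (cases "N \<le> card B")
      case True
      let ?P = "{R. R \<subseteq> D \<and> \<not> spread G A (A - D \<union> R)}"
      let ?Q = "{R. R \<subseteq> D \<and> \<not> spread G B (B - D \<union> R)}"
      have NA: "real (card A) ^ 2 * (7 / 8) ^ (card A div 9) < 1 / 2" using N3 by (intro N) simp
      have "real (card ?P) < 1 / 2 * 2 ^ card D"
        using card_nonspread[OF A DA] NA
        by (smt (verit) zero_less_power mult_strict_right_mono)
      moreover have "real (card ?Q) < 1 / 2 * 2 ^ card D"
        using card_nonspread[OF B DB] N[OF True]
        by (smt (verit) zero_less_power mult_strict_right_mono)
      \<comment> \<open>The choices of \<open>R\<close> that are bad for \<open>B\<close> are the
        complements in \<open>D\<close> of the sets in \<open>?Q\<close>.\<close>
      moreover have "card ((\<lambda>R. D - R) ` ?Q) \<le> card ?Q"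
        using fD by (intro card_image_le) auto
      ultimately have "real (card ?P + card ((\<lambda>R. D - R) ` ?Q)) < 2 ^ card D"
        by simp
      then have "card ?P + card ((\<lambda>R. D - R) ` ?Q) < card (Pow D)"
        using fD by (simp add: card_Pow flip: of_nat_less_iff[where 'a = real])
      then have "card (?P \<union> (\<lambda>R. D - R) ` ?Q) < card (Pow D)"
        using card_Un_le order_le_less_trans by blast
      moreover have finP: "finite (?P \<union> (\<lambda>R. D - R) ` ?Q)" using fD by simp
      ultimately have "\<not> Pow D \<subseteq> ?P \<union> (\<lambda>R. D - R) ` ?Q"
        using fD by (meson card_mono finP leD)
      then obtain R where R: "R \<subseteq> D" "R \<notin> ?P" "R \<notin> (\<lambda>R. D - R) ` ?Q" by blast
      have "spread G A (A - D \<union> R)" using R by auto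
      moreover have "D - (D - R) = R" using R by auto
      then have "D - R \<notin> ?Q" using R(3) by (metis (no_types, lifting) image_eqI)
      then have "spread G B (B - D \<union> (D - R))" by auto
      moreover have "(A - D \<union> R) \<inter> (B - D \<union> (D - R)) = F"
        using R(1) F by (auto simp: D_def)
      ultimately show ?thesis by blast
    next
      case False
      \<comment> \<open>\<open>y\<close> has to avoid \<open>D\<close> and its translates by the
        inverses of \<open>k\<close> and \<open>l\<close>, which are fewer than \<open>3 * N\<close>
        elements.\<close>
      have "\<exists>y \<in> A - D. k \<otimes>\<^bsub>G\<^esub> y \<in> A - D \<and> l \<otimes>\<^bsub>G\<^esub> y \<in> A - D" if kl: "k \<in> A" "l \<in> A" for k l
      proof -
        have c: "x \<in> carrier G" if "x \<in> A" for x using that A(1) subgroup.mem_carrier by metis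
        let ?U = "D \<union> (\<lambda>d. inv\<^bsub>G\<^esub> k \<otimes>\<^bsub>G\<^esub> d) ` D \<union> (\<lambda>d. inv\<^bsub>G\<^esub> l \<otimes>\<^bsub>G\<^esub> d) ` D"
        have "card D < N" using card_mono[OF B(2) DB] False by linarith
        have "card ?U \<le> card D + card D + card D"
          by (intro order_trans[OF card_Un_le] add_mono card_image_le fD order_refl)
        then have "card ?U < card A" using \<open>card D < N\<close> N3 by linarith
        moreover have "finite ?U" using fD by simp
        ultimately obtain y where y: "y \<in> A" "y \<notin> ?U" by (meson card_mono leD subsetI)
        have "k \<otimes>\<^bsub>G\<^esub> y \<notin> D" "l \<otimes>\<^bsub>G\<^esub> y \<notin> D"
          using y kl c by (auto simp: image_iff) (metis inv_solve_left c DA m_closed subsetD)+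
        then show ?thesis using y kl A(1) by (auto intro!: bexI[of _ y] intro: subgroup.m_closed)
      qed
      then have "spread G A (A - D)" by (auto simp: spread_def)
      moreover have "\<one>\<^bsub>G\<^esub> \<in> B" using B(1) subgroup.one_closed by metis
      then have "spread G B B"
        using B(1) unfolding spread_def by (meson order_refl subgroup.m_closed)
      moreover have "(A - D) \<inter> B = F" using F by (auto simp: D_def)
      ultimately show ?thesis by blast
    qed
  qed
qed

section \<open>Monomorphisms determined on a spread set\<close>

lemma monI: "h \<in> hom G H \<Longrightarrow> inj_on h (carrier G) \<Longrightarrow> h \<in> mon G H"
  by (simp add: mon_def)

lemma monD:
  assumes "h \<in> mon G H"
  shows "h \<in> hom G H" "inj_on h (carrier G)" "x \<in> carrier G \<Longrightarrow> h x \<in> carrier H"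
  using assms by (auto simp: mon_def hom_def)

text \<open>\<open>\<theta> k\<close> is the quotient of the values at \<open>k y\<close> and
  \<open>y\<close>, for any \<open>y\<close> with both in \<open>X\<close>; \<open>heap\<close>
  makes it independent of \<open>y\<close>. Products and injectivity involve two group elements at
  once, and the common \<open>y\<close> for two translations in \<open>spread\<close> is what they
  need. \<open>\<eta>\<close> itself need not preserve products, so only its quotients appear in the
  conclusion.\<close>

lemma spread_extends:
  assumes "group K" "group \<Gamma>" and X: "spread K (carrier K) X"
    and \<eta>: "\<And>x. x \<in> X \<Longrightarrow> \<eta> x \<in> carrier \<Gamma>" "inj_on \<eta> X"
    and heap: "\<And>x y z w. {x, y, z, w} \<subseteq> X \<Longrightarrow> x \<otimes>\<^bsub>K\<^esub> inv\<^bsub>K\<^esub> y \<otimes>\<^bsub>K\<^esub> z = w \<Longrightarrow>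
      \<eta> w = \<eta> x \<otimes>\<^bsub>\<Gamma>\<^esub> inv\<^bsub>\<Gamma>\<^esub> (\<eta> y) \<otimes>\<^bsub>\<Gamma>\<^esub> \<eta> z"
  obtains \<theta> where "\<theta> \<in> mon K \<Gamma>"
    "\<And>x y. x \<in> X \<Longrightarrow> y \<in> X \<Longrightarrow> \<theta> (x \<otimes>\<^bsub>K\<^esub> inv\<^bsub>K\<^esub> y) = \<eta> x \<otimes>\<^bsub>\<Gamma>\<^esub> inv\<^bsub>\<Gamma>\<^esub> (\<eta> y)"
proof -
  interpret K: group K by (rule assms)
  interpret \<Gamma>: group \<Gamma> by (rule assms)
  have XK: "x \<in> carrier K" if "x \<in> X" for x using X that by (auto simp: spread_def)
  have ex: "\<exists>y \<in> X. k \<otimes>\<^bsub>K\<^esub> y \<in> X \<and> l \<otimes>\<^bsub>K\<^esub> y \<in> X" if "k \<in> carrier K" "l \<in> carrier K" for k l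
    using X that by (simp add: spread_def)
  define c where "c k = (SOME y. y \<in> X \<and> k \<otimes>\<^bsub>K\<^esub> y \<in> X)" for k
  have c: "c k \<in> X \<and> k \<otimes>\<^bsub>K\<^esub> c k \<in> X" if "k \<in> carrier K" for k
    unfolding c_def by (rule someI_ex) (use ex[OF that that] in blast)
  define \<theta> where "\<theta> k = \<eta> (k \<otimes>\<^bsub>K\<^esub> c k) \<otimes>\<^bsub>\<Gamma>\<^esub> inv\<^bsub>\<Gamma>\<^esub> (\<eta> (c k))" for k
  have \<theta>: "\<theta> k = \<eta> (k \<otimes>\<^bsub>K\<^esub> y) \<otimes>\<^bsub>\<Gamma>\<^esub> inv\<^bsub>\<Gamma>\<^esub> (\<eta> y)"
    if k: "k \<in> carrier K" "y \<in> X" "k \<otimes>\<^bsub>K\<^esub> y \<in> X" for k y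
  proof -
    have "(k \<otimes>\<^bsub>K\<^esub> c k) \<otimes>\<^bsub>K\<^esub> inv\<^bsub>K\<^esub> (c k) \<otimes>\<^bsub>K\<^esub> y = k \<otimes>\<^bsub>K\<^esub> y"
      using c[OF k(1)] k XK by (simp add: K.m_assoc)
    then have "\<eta> (k \<otimes>\<^bsub>K\<^esub> y) = \<eta> (k \<otimes>\<^bsub>K\<^esub> c k) \<otimes>\<^bsub>\<Gamma>\<^esub> inv\<^bsub>\<Gamma>\<^esub> (\<eta> (c k)) \<otimes>\<^bsub>\<Gamma>\<^esub> \<eta> y"
      using c[OF k(1)] k by (intro heap) auto
    then show ?thesis using \<eta>(1) c[OF k(1)] k by (simp add: \<theta>_def \<Gamma>.m_assoc)
  qed
  have "\<theta> \<in> hom K \<Gamma>"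
  proof (rule homI)
    fix k assume "k \<in> carrier K"
    then show "\<theta> k \<in> carrier \<Gamma>" using c \<eta>(1) by (simp add: \<theta>_def)
  next
    fix k l assume kl: "k \<in> carrier K" "l \<in> carrier K"
    \<comment> \<open>With base \<open>y\<close> for \<open>k\<close>, and base
      \<open>inv l y\<close> for both \<open>l\<close> and \<open>k l\<close>, the two middle
      factors of the product cancel.\<close>
    then obtain y where y: "y \<in> X" "k \<otimes>\<^bsub>K\<^esub> y \<in> X" "inv\<^bsub>K\<^esub> l \<otimes>\<^bsub>K\<^esub> y \<in> X"
      using ex[of k "inv\<^bsub>K\<^esub> l"] by auto
    have l: "l \<otimes>\<^bsub>K\<^esub> (inv\<^bsub>K\<^esub> l \<otimes>\<^bsub>K\<^esub> y) = y" using kl XK[OF y(1)] by (simp add: K.m_assoc[symmetric])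
    have "k \<otimes>\<^bsub>K\<^esub> l \<otimes>\<^bsub>K\<^esub> (inv\<^bsub>K\<^esub> l \<otimes>\<^bsub>K\<^esub> y) = k \<otimes>\<^bsub>K\<^esub> y"
      using kl XK[OF y(1)] l by (simp add: K.m_assoc)
    then have "\<theta> (k \<otimes>\<^bsub>K\<^esub> l) = \<eta> (k \<otimes>\<^bsub>K\<^esub> y) \<otimes>\<^bsub>\<Gamma>\<^esub> inv\<^bsub>\<Gamma>\<^esub> (\<eta> (inv\<^bsub>K\<^esub> l \<otimes>\<^bsub>K\<^esub> y))"
      using \<theta>[of "k \<otimes>\<^bsub>K\<^esub> l" "inv\<^bsub>K\<^esub> l \<otimes>\<^bsub>K\<^esub> y"] kl y by simp
    moreover have "\<theta> k = \<eta> (k \<otimes>\<^bsub>K\<^esub> y) \<otimes>\<^bsub>\<Gamma>\<^esub> inv\<^bsub>\<Gamma>\<^esub> (\<eta> y)" using \<theta> kl y by blast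
    moreover have "\<theta> l = \<eta> y \<otimes>\<^bsub>\<Gamma>\<^esub> inv\<^bsub>\<Gamma>\<^esub> (\<eta> (inv\<^bsub>K\<^esub> l \<otimes>\<^bsub>K\<^esub> y))"
      using \<theta>[of l "inv\<^bsub>K\<^esub> l \<otimes>\<^bsub>K\<^esub> y"] kl y l by simp
    ultimately show "\<theta> (k \<otimes>\<^bsub>K\<^esub> l) = \<theta> k \<otimes>\<^bsub>\<Gamma>\<^esub> \<theta> l"
      using \<eta>(1) y by (simp add: \<Gamma>.m_assoc \<Gamma>.inv_solve_left)
  qed
  moreover have "inj_on \<theta> (carrier K)"
  proof (rule inj_onI)
    fix k l assume kl: "k \<in> carrier K" "l \<in> carrier K" "\<theta> k = \<theta> l"
    then obtain y where y: "y \<in> X" "k \<otimes>\<^bsub>K\<^esub> y \<in> X" "l \<otimes>\<^bsub>K\<^esub> y \<in> X" using ex by blast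
    have "\<eta> (k \<otimes>\<^bsub>K\<^esub> y) \<otimes>\<^bsub>\<Gamma>\<^esub> inv\<^bsub>\<Gamma>\<^esub> (\<eta> y) = \<eta> (l \<otimes>\<^bsub>K\<^esub> y) \<otimes>\<^bsub>\<Gamma>\<^esub> inv\<^bsub>\<Gamma>\<^esub> (\<eta> y)"
      using \<theta>[OF kl(1) y(1,2)] \<theta>[OF kl(2) y(1,3)] kl(3) by simp
    then have "\<eta> (k \<otimes>\<^bsub>K\<^esub> y) = \<eta> (l \<otimes>\<^bsub>K\<^esub> y)" using \<eta>(1) y by simp
    then have "k \<otimes>\<^bsub>K\<^esub> y = l \<otimes>\<^bsub>K\<^esub> y" using \<eta>(2) y by (meson inj_onD)
    then show "k = l" using kl XK[OF y(1)] by simp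
  qed
  ultimately have "\<theta> \<in> mon K \<Gamma>" by (rule monI)
  moreover have "\<theta> (x \<otimes>\<^bsub>K\<^esub> inv\<^bsub>K\<^esub> y) = \<eta> x \<otimes>\<^bsub>\<Gamma>\<^esub> inv\<^bsub>\<Gamma>\<^esub> (\<eta> y)" if "x \<in> X" "y \<in> X" for x y
  proof -
    have "x \<otimes>\<^bsub>K\<^esub> inv\<^bsub>K\<^esub> y \<otimes>\<^bsub>K\<^esub> y = x" using XK that by (simp add: K.m_assoc)
    then show ?thesis using \<theta>[of "x \<otimes>\<^bsub>K\<^esub> inv\<^bsub>K\<^esub> y" y] XK that by simp
  qed
  ultimately show ?thesis using that by blast
qed

lemma mon_image_subgroup:
  assumes "group K" "group \<Gamma>" "\<theta> \<in> mon K \<Gamma>"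
  shows "subgroup (\<theta> ` carrier K) \<Gamma>"
proof -
  interpret group_hom K \<Gamma> \<theta>
    using assms monD(1)[OF assms(3)] by (simp add: group_hom_def group_hom_axioms_def)
  show ?thesis by (rule img_is_subgroup)
qed

lemma spread_pullback:
  assumes \<theta>: "\<theta> \<in> mon K \<Gamma>" and K: "group K" and X: "spread \<Gamma> (\<theta> ` carrier K) X"
  shows "spread K (carrier K) {k \<in> carrier K. \<theta> k \<in> X}" "\<theta> ` {k \<in> carrier K. \<theta> k \<in> X} = X"
proof -
  interpret K: group K by (rule K)
  show "\<theta> ` {k \<in> carrier K. \<theta> k \<in> X} = X" using X by (auto simp: spread_def)
  have "\<exists>y \<in> {k \<in> carrier K. \<theta> k \<in> X}. k \<otimes>\<^bsub>K\<^esub> y \<in> {k \<in> carrier K. \<theta> k \<in> X} \<and>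
      l \<otimes>\<^bsub>K\<^esub> y \<in> {k \<in> carrier K. \<theta> k \<in> X}" if kl: "k \<in> carrier K" "l \<in> carrier K" for k l
  proof -
    have "\<theta> k \<in> \<theta> ` carrier K" "\<theta> l \<in> \<theta> ` carrier K" using kl by auto
    then obtain x where x: "x \<in> X" "\<theta> k \<otimes>\<^bsub>\<Gamma>\<^esub> x \<in> X" "\<theta> l \<otimes>\<^bsub>\<Gamma>\<^esub> x \<in> X"
      using X unfolding spread_def by meson
    then obtain y where y: "y \<in> carrier K" "x = \<theta> y" using X by (auto simp: spread_def)
    have "\<theta> (k \<otimes>\<^bsub>K\<^esub> y) = \<theta> k \<otimes>\<^bsub>\<Gamma>\<^esub> x" "\<theta> (l \<otimes>\<^bsub>K\<^esub> y) = \<theta> l \<otimes>\<^bsub>\<Gamma>\<^esub> x"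
      using monD(1)[OF \<theta>] kl y by (auto simp: hom_def)
    then show ?thesis using x y kl by (intro bexI[of _ y]) auto
  qed
  then show "spread K (carrier K) {k \<in> carrier K. \<theta> k \<in> X}" by (auto simp: spread_def)
qed

section \<open>Extensions up to equivalence\<close>

lemma mem_extensions:
  "(K, \<psi>) \<in> extensions F H \<longleftrightarrow>
     group K \<and> finite (carrier K) \<and> mon K H \<noteq> {} \<and> \<psi> \<in> mon F K"
  by (simp add: extensions_def)

lemma mem_ext_equiv:
  "((K1, \<psi>1), (K2, \<psi>2)) \<in> ext_equiv F H \<longleftrightarrow>
     (K1, \<psi>1) \<in> extensions F H \<and> (K2, \<psi>2) \<in> extensions F H \<and>
     (\<exists>\<theta> \<in> iso K1 K2. \<forall>x \<in> carrier F. \<psi>2 x = \<theta> (\<psi>1 x))"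
  by (simp add: ext_equiv_def)

lemma equiv_ext_equiv: "equiv (extensions F H) (ext_equiv F H)"
proof (rule equivI)
  show "ext_equiv F H \<subseteq> extensions F H \<times> extensions F H" by (auto simp: ext_equiv_def)
  show "refl_on (extensions F H) (ext_equiv F H)"
  proof (rule refl_onI)
    fix a assume a: "a \<in> extensions F H"
    obtain K \<psi> where K: "a = (K, \<psi>)" by (cases a)
    have "(\<lambda>x. x) \<in> iso K K" by (simp add: iso_def hom_def bij_betw_def)
    then show "(a, a) \<in> ext_equiv F H" using a unfolding K mem_ext_equiv
      by (intro conjI bexI[of _ "\<lambda>x. x"]) auto
  qed
  show "sym (ext_equiv F H)"
  proof (rule symI)
    fix a b assume ab: "(a, b) \<in> ext_equiv F H"
    obtain K \<psi> L \<chi> where K: "a = (K, \<psi>)" "b = (L, \<chi>)" by (cases a, cases b)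
    obtain \<theta> where \<theta>: "\<theta> \<in> iso K L" "\<forall>x \<in> carrier F. \<chi> x = \<theta> (\<psi> x)" and ext: "a \<in> extensions F H"
      "b \<in> extensions F H"
      using ab unfolding K mem_ext_equiv by blast
    have gK: "group K" and \<psi>: "\<psi> \<in> mon F K" using ext(1) unfolding K mem_extensions by auto
    have "inv_into (carrier K) \<theta> \<in> iso L K" using group.iso_set_sym[OF gK \<theta>(1)] .
    moreover have "\<psi> x = inv_into (carrier K) \<theta> (\<chi> x)" if "x \<in> carrier F" for x
      using \<theta> that monD(3)[OF \<psi> that] by (simp add: iso_def bij_betw_def)
    ultimately show "(b, a) \<in> ext_equiv F H" using ext unfolding K mem_ext_equiv by blast
  qed
  show "trans (ext_equiv F H)"
  proof (rule transI)
    fix a b c assume ab: "(a, b) \<in> ext_equiv F H" and bc: "(b, c) \<in> ext_equiv F H"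
    obtain K \<psi> L \<chi> M \<xi> where K: "a = (K, \<psi>)" "b = (L, \<chi>)" "c = (M, \<xi>)" by (cases a, cases b, cases c)
    obtain \<theta> where \<theta>: "\<theta> \<in> iso K L" "\<forall>x \<in> carrier F. \<chi> x = \<theta> (\<psi> x)"
      using ab unfolding K mem_ext_equiv by blast
    obtain \<theta>' where \<theta>': "\<theta>' \<in> iso L M" "\<forall>x \<in> carrier F. \<xi> x = \<theta>' (\<chi> x)"
      using bc unfolding K mem_ext_equiv by blast
    have "\<theta>' \<circ> \<theta> \<in> iso K M" using iso_set_trans[OF \<theta>(1) \<theta>'(1)] .
    moreover have "\<xi> x = (\<theta>' \<circ> \<theta>) (\<psi> x)" if "x \<in> carrier F" for x using \<theta>(2) \<theta>'(2) that by simp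
    ultimately show "(a, c) \<in> ext_equiv F H" using ab bc unfolding K mem_ext_equiv by blast
  qed
qed

text \<open>After renaming its elements to an initial segment of the natural numbers, an extension
  is determined up to equivalence by its multiplication table and the embedding of \<open>F\<close>.
  For bounded order there are finitely many such data.\<close>

lemma finite_small_extensions:
  assumes F: "finite (carrier F)"
  shows "finite {A \<in> elem_verts F H. \<exists>(K, \<psi>) \<in> A. card (carrier K) < n}"
proof -
  let ?small = "{A \<in> elem_verts F H. \<exists>(K, \<psi>) \<in> A. card (carrier K) < n}"
  define \<beta> where "\<beta> K = (SOME h. bij_betw h (carrier K) {0..<card (carrier K)})" for K :: "nat monoid"
  have \<beta>: "bij_betw (\<beta> K) (carrier K) {0..<card (carrier K)}" if "finite (carrier K)" for K
    unfolding \<beta>_def by (rule someI_ex[OF ex_bij_betw_finite_nat[OF that]])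
  define code where "code = (\<lambda>(K, \<psi>).
    ({(\<beta> K x, \<beta> K y, \<beta> K (x \<otimes>\<^bsub>K\<^esub> y)) | x y. x \<in> carrier K \<and> y \<in> carrier K},
     {(f, \<beta> K (\<psi> f)) | f. f \<in> carrier F}, card (carrier K)))"
  have code: "(a, b) \<in> ext_equiv F H" if ab: "a \<in> extensions F H" "b \<in> extensions F H"
    "code a = code b" for a b
  proof -
    obtain K \<psi> L \<chi> where K: "a = (K, \<psi>)" "b = (L, \<chi>)" by (cases a, cases b)
    have e: "group K" "finite (carrier K)" "\<psi> \<in> mon F K" "group L" "finite (carrier L)" "\<chi> \<in> mon F L"
      using ab(1,2) unfolding K mem_extensions by auto
    interpret K: group K by (rule e)
    interpret L: group L by (rule e)
    have bK: "bij_betw (\<beta> K) (carrier K) {0..<card (carrier K)}"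
      and bL: "bij_betw (\<beta> L) (carrier L) {0..<card (carrier L)}" using e \<beta> by auto
    have cd: "card (carrier K) = card (carrier L)"
      and mult: "{(\<beta> K x, \<beta> K y, \<beta> K (x \<otimes>\<^bsub>K\<^esub> y)) | x y. x \<in> carrier K \<and> y \<in> carrier K}
        = {(\<beta> L x, \<beta> L y, \<beta> L (x \<otimes>\<^bsub>L\<^esub> y)) | x y. x \<in> carrier L \<and> y \<in> carrier L}"
      and emb: "{(f, \<beta> K (\<psi> f)) | f. f \<in> carrier F} = {(f, \<beta> L (\<chi> f)) | f. f \<in> carrier F}"
      using ab(3) unfolding K code_def by auto
    define \<theta> where "\<theta> = inv_into (carrier L) (\<beta> L) \<circ> \<beta> K"
    have \<theta>I: "\<theta> x = x'" if "x' \<in> carrier L" "\<beta> L x' = \<beta> K x" for x x'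
      using that bL unfolding \<theta>_def bij_betw_def by (metis comp_apply inv_into_f_f)
    have bij: "bij_betw \<theta> (carrier K) (carrier L)"
      unfolding \<theta>_def using bK bL cd by (metis bij_betw_inv_into bij_betw_trans)
    have "\<theta> \<in> hom K L"
    proof (rule homI)
      show "\<theta> x \<in> carrier L" if "x \<in> carrier K" for x using bij that by (auto simp: bij_betw_def)
    next
      fix x y assume "x \<in> carrier K" "y \<in> carrier K"
      then have "(\<beta> K x, \<beta> K y, \<beta> K (x \<otimes>\<^bsub>K\<^esub> y)) \<in>
          {(\<beta> L x, \<beta> L y, \<beta> L (x \<otimes>\<^bsub>L\<^esub> y)) | x y. x \<in> carrier L \<and> y \<in> carrier L}"
        unfolding mult[symmetric] by blast
      then obtain x' y' where xy: "x' \<in> carrier L" "y' \<in> carrier L" "\<beta> L x' = \<beta> K x" "\<beta> L y' = \<beta> K y"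
        "\<beta> L (x' \<otimes>\<^bsub>L\<^esub> y') = \<beta> K (x \<otimes>\<^bsub>K\<^esub> y)" by auto
      show "\<theta> (x \<otimes>\<^bsub>K\<^esub> y) = \<theta> x \<otimes>\<^bsub>L\<^esub> \<theta> y"
        using \<theta>I[OF xy(1,3)] \<theta>I[OF xy(2,4)] \<theta>I[OF _ xy(5)] xy(1,2) by simp
    qed
    then have "\<theta> \<in> iso K L" using bij by (simp add: iso_def)
    moreover have "\<chi> f = \<theta> (\<psi> f)" if f: "f \<in> carrier F" for f
    proof -
      have "(f, \<beta> K (\<psi> f)) \<in> {(f, \<beta> L (\<chi> f)) | f. f \<in> carrier F}" unfolding emb[symmetric]
        using f by blast
      then have "\<beta> L (\<chi> f) = \<beta> K (\<psi> f)" by auto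
      then show ?thesis using \<theta>I[of "\<chi> f" "\<psi> f"] monD(3)[OF e(6) f] by simp
    qed
    ultimately show ?thesis using ab(1,2) unfolding K mem_ext_equiv by blast
  qed
  define r where "r A = (SOME a. a \<in> A \<and> card (carrier (fst a)) < n)" for A :: "'a extension set"
  have r: "r A \<in> A \<and> card (carrier (fst (r A))) < n" if "A \<in> ?small" for A
  proof -
    have "\<exists>a. a \<in> A \<and> card (carrier (fst a)) < n" using that by force
    then show ?thesis unfolding r_def by (rule someI_ex)
  qed
  have rext: "r A \<in> extensions F H" if "A \<in> ?small" for A
  proof -
    have "A \<subseteq> extensions F H" using that in_quotient_imp_subset[OF equiv_ext_equiv]
      by (auto simp: elem_verts_def)
    then show ?thesis using r[OF that] by blast
  qed
  have "inj_on (code \<circ> r) ?small"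
  proof (rule inj_onI)
    fix A B assume AB: "A \<in> ?small" "B \<in> ?small" "(code \<circ> r) A = (code \<circ> r) B"
    have "(r A, r B) \<in> ext_equiv F H" using code rext AB by simp
    moreover have "A \<in> extensions F H // ext_equiv F H" "B \<in> extensions F H // ext_equiv F H"
      using AB by (auto simp: elem_verts_def)
    moreover have "r A \<in> A" "r B \<in> B" using r AB by auto
    ultimately show "A = B" using quotient_eq_iff[OF equiv_ext_equiv] by metis
  qed
  moreover have
    "(code \<circ> r) ` ?small \<subseteq> Pow ({..<n} \<times> {..<n} \<times> {..<n}) \<times> Pow (carrier F \<times> {..<n}) \<times> {..<n}"
  proof
    fix u assume "u \<in> (code \<circ> r) ` ?small"
    then obtain A where A: "A \<in> ?small" "u = code (r A)" by auto
    obtain K \<psi> where K: "r A = (K, \<psi>)" by (cases "r A")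
    have e: "group K" "finite (carrier K)" "\<psi> \<in> mon F K" using rext[OF A(1)]
      unfolding K mem_extensions by auto
    interpret K: group K by (rule e)
    have "card (carrier K) < n" using r[OF A(1)] K by simp
    then have "\<beta> K x < n" if "x \<in> carrier K" for x
      using bij_betwE[OF \<beta>[OF e(2)]] that by fastforce
    then show "u \<in> Pow ({..<n} \<times> {..<n} \<times> {..<n}) \<times> Pow (carrier F \<times> {..<n}) \<times> {..<n}"
      using \<open>card (carrier K) < n\<close> monD(3)[OF e(3)] unfolding A(2) K code_def by auto
  qed
  moreover have "finite (Pow ({..<n} \<times> {..<n} \<times> {..<n}) \<times> Pow (carrier F \<times> {..<n}) \<times> {..<n})"
    using F by blast
  ultimately show ?thesis by (meson finite_subset finite_imageD)
qed

section \<open>Gluing gadgets\<close>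

definition points_of ::
    "('e \<Rightarrow> kind) \<Rightarrow> ('e \<Rightarrow> 'p) \<Rightarrow> ('e \<Rightarrow> 'e \<Rightarrow> 'p) \<Rightarrow> 'e set \<Rightarrow> 'p point set" where
  "points_of \<kappa> lab pv Z = {v. \<exists>U \<subseteq> Z. unit_point \<kappa> lab pv U v}"

definition clash_free ::
    "('e \<Rightarrow> kind) \<Rightarrow> ('e \<Rightarrow> 'p) \<Rightarrow> ('e \<Rightarrow> 'e \<Rightarrow> 'p) \<Rightarrow> 'e set \<Rightarrow> bool" where
  "clash_free \<kappa> lab pv Z \<longleftrightarrow> (\<forall>U U' v. U \<subseteq> Z \<longrightarrow> U' \<subseteq> Z \<longrightarrow>
     unit_point \<kappa> lab pv U v \<longrightarrow> unit_point \<kappa> lab pv U' v \<longrightarrow> U = U')"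

lemma unit_point_split:
  assumes "unit_point \<kappa> lab pv U v" "U \<subseteq> Z \<union> Y" "patches \<kappa> Z \<inter> patches \<kappa> Y = {}"
  shows "U \<subseteq> Z \<or> U \<subseteq> Y"
  using assms(1)
proof cases
  case (Same e f c i)
  then show ?thesis using assms(2,3) by (auto simp: patches_def)
next
  case (Mixed s i t)
  then show ?thesis using assms(2,3) by (auto simp: patches_def)
qed (use assms(2) in auto)

text \<open>A unit of two edges lies in one patch, so no unit uses both parts, and the numbers of
  edges beyond the patches add up. The subtractions are never truncated, because a set has at most
  as many patches as edges.\<close>

lemma load_indep_Un:
  assumes fin: "finite Z" "finite Y" and disj: "Z \<inter> Y = {}" "patches \<kappa> Z \<inter> patches \<kappa> Y = {}"
  shows "load_indep \<kappa> lab pv (Z \<union> Y) \<longleftrightarrow>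
    (card Z - card (patches \<kappa> Z)) + (card Y - card (patches \<kappa> Y)) \<le> 2 \<and>
    clash_free \<kappa> lab pv Z \<and> clash_free \<kappa> lab pv Y \<and> points_of \<kappa> lab pv Z \<inter> points_of \<kappa> lab pv Y = {}"
proof -
  have "card (patches \<kappa> (Z \<union> Y)) = card (patches \<kappa> Z) + card (patches \<kappa> Y)"
    using patches_finite[OF fin(1), of \<kappa>] patches_finite[OF fin(2), of \<kappa>] disj(2)
    by (simp add: patches_Un card_Un_disjoint)
  then have "card (Z \<union> Y) \<le> card (patches \<kappa> (Z \<union> Y)) + 2 \<longleftrightarrow>
      (card Z - card (patches \<kappa> Z)) + (card Y - card (patches \<kappa> Y)) \<le> 2"
    using patches_finite[OF fin(1), of \<kappa>] patches_finite[OF fin(2), of \<kappa>] fin disj(1)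
    by (auto simp: card_Un_disjoint)
  moreover have "clash_free \<kappa> lab pv (Z \<union> Y) \<longleftrightarrow>
    clash_free \<kappa> lab pv Z \<and> clash_free \<kappa> lab pv Y \<and> points_of \<kappa> lab pv Z \<inter> points_of \<kappa> lab pv Y = {}"
    (is "?L \<longleftrightarrow> ?R")
  proof
    assume L: ?L
    have "False" if v: "v \<in> points_of \<kappa> lab pv Z" "v \<in> points_of \<kappa> lab pv Y" for v
    proof -
      obtain U U' where U: "U \<subseteq> Z" "unit_point \<kappa> lab pv U v" "U' \<subseteq> Y" "unit_point \<kappa> lab pv U' v"
        using v by (auto simp: points_of_def)
      then have "U = U'" using L unfolding clash_free_def by (meson le_supI1 le_supI2)
      then show False using U disj(1) unit_point_finite[OF U(2)] by blast
    qed
    then show ?R using L unfolding clash_free_def by (meson disjoint_iff le_supI1 le_supI2)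
  next
    assume R: ?R
    show ?L unfolding clash_free_def
    proof (intro allI impI)
      fix U U' v
      assume U: "U \<subseteq> Z \<union> Y" "U' \<subseteq> Z \<union> Y" "unit_point \<kappa> lab pv U v" "unit_point \<kappa> lab pv U' v"
      have p: "v \<in> points_of \<kappa> lab pv W" if "V \<subseteq> W" "unit_point \<kappa> lab pv V v" for V W
        using that by (auto simp: points_of_def)
      have mixed: "\<not> (V \<subseteq> Z \<and> W \<subseteq> Y)" if "unit_point \<kappa> lab pv V v" "unit_point \<kappa> lab pv W v" for V W
      proof
        assume "V \<subseteq> Z \<and> W \<subseteq> Y"
        then have "v \<in> points_of \<kappa> lab pv Z" "v \<in> points_of \<kappa> lab pv Y" using p that by blast+
        then show False using R by blast
      qed
      have "U \<subseteq> Z \<and> U' \<subseteq> Z \<or> U \<subseteq> Y \<and> U' \<subseteq> Y"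
        using unit_point_split[OF U(3,1) disj(2)] unit_point_split[OF U(4,2) disj(2)]
          mixed[OF U(3,4)] mixed[OF U(4,3)] by argo
      then show "U = U'" using R U(3,4) unfolding clash_free_def by meson
    qed
  qed
  moreover have "load_indep \<kappa> lab pv (Z \<union> Y) \<longleftrightarrow>
      card (Z \<union> Y) \<le> card (patches \<kappa> (Z \<union> Y)) + 2 \<and> clash_free \<kappa> lab pv (Z \<union> Y)"
    by (simp only: load_indep_def clash_free_def)
  ultimately show ?thesis by (simp only:)
qed

text \<open>The excess is capped at 3 because it only matters whether the total stays within 2.
  Points outside \<open>V\<close> are omitted as they cannot occur on the other side.\<close>

definition load_state ::
    "('e \<Rightarrow> kind) \<Rightarrow> ('e \<Rightarrow> 'p) \<Rightarrow> ('e \<Rightarrow> 'e \<Rightarrow> 'p) \<Rightarrow> 'p point set \<Rightarrow> 'e set \<Rightarrow> nat \<times> bool \<times> 'p point set" where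
  "load_state \<kappa> lab pv V Z =
     (min 3 (card Z - card (patches \<kappa> Z)), clash_free \<kappa> lab pv Z, points_of \<kappa> lab pv Z \<inter> V)"

lemma load_state_finite:
  "finite V \<Longrightarrow> finite ({..3 :: nat} \<times> (UNIV :: bool set) \<times> Pow V)"
  "load_state \<kappa> lab pv V Z \<in> {..3} \<times> UNIV \<times> Pow V"
  by (auto simp: load_state_def)

lemma load_state_congruence:
  assumes "finite Z" "finite Z'" "finite Y" "Z \<inter> Y = {}" "Z' \<inter> Y = {}"
    "patches \<kappa> Z \<inter> patches \<kappa> Y = {}" "patches \<kappa> Z' \<inter> patches \<kappa> Y = {}"
    "points_of \<kappa> lab pv Z \<inter> points_of \<kappa> lab pv Y \<subseteq> V" "points_of \<kappa> lab pv Z' \<inter> points_of \<kappa> lab pv Y \<subseteq> V"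
    and eq: "load_state \<kappa> lab pv V Z = load_state \<kappa> lab pv V Z'"
  shows "load_indep \<kappa> lab pv (Z \<union> Y) = load_indep \<kappa> lab pv (Z' \<union> Y)"
proof -
  have "min 3 (card Z - card (patches \<kappa> Z)) = min 3 (card Z' - card (patches \<kappa> Z'))"
    "clash_free \<kappa> lab pv Z = clash_free \<kappa> lab pv Z'"
    and p: "points_of \<kappa> lab pv Z \<inter> V = points_of \<kappa> lab pv Z' \<inter> V"
    using eq by (simp_all add: load_state_def)
  moreover have "(card Z - card (patches \<kappa> Z)) + n \<le> 2 \<longleftrightarrow> (card Z' - card (patches \<kappa> Z')) + n \<le> 2" for n
    using calculation(1) by linarith
  moreover have "points_of \<kappa> lab pv Z \<inter> points_of \<kappa> lab pv Y = {} \<longleftrightarrow>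
      points_of \<kappa> lab pv Z' \<inter> points_of \<kappa> lab pv Y = {}"
    using p assms(8,9) by blast
  ultimately show ?thesis
    using load_indep_Un[of Z Y \<kappa> lab pv] load_indep_Un[of Z' Y \<kappa> lab pv] assms(1-7) by simp
qed

text \<open>Independence depends only on which points coincide, so reading formal labels as group
  elements by an injective map changes nothing.\<close>

lemma load_indep_relabel:
  assumes lab: "\<And>e. e \<in> E \<Longrightarrow> \<kappa> e = Link \<Longrightarrow> lab' e = \<mu> (lab e) \<and> lab e \<in> \<Lambda>"
    and pv: "\<And>s t i. s \<in> E \<Longrightarrow> t \<in> E \<Longrightarrow> \<kappa> s = To True i \<Longrightarrow> \<kappa> t = To False i \<Longrightarrow>
      pv' s t = \<mu> (pv s t) \<and> pv s t \<in> \<Lambda>"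
    and inj: "inj_on \<mu> \<Lambda>" and Z: "Z \<subseteq> E"
  shows "load_indep \<kappa> lab' pv' Z = load_indep \<kappa> lab pv Z"
proof -
  let ?P = "range Joint \<union> Point ` \<Lambda>"
  have injP: "inj_on (map_point \<mu>) ?P"
  proof (rule inj_onI)
    fix v w assume "v \<in> ?P" "w \<in> ?P" "map_point \<mu> v = map_point \<mu> w"
    then show "v = w" using inj by (cases v; cases w) (auto dest: inj_onD)
  qed
  have fwd: "unit_point \<kappa> lab' pv' U (map_point \<mu> v) \<and> v \<in> ?P" if "unit_point \<kappa> lab pv U v" "U \<subseteq> Z"
    for U v
    using that(1)
  proof cases
    case (At e c)
    then show ?thesis using unit_point.At[of \<kappa> e c lab' pv'] by simp
  next
    case (Link e)
    then show ?thesis using unit_point.Link[of \<kappa> e lab' pv'] lab[of e] that(2) Z by auto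
  next
    case (Same e f c i)
    then show ?thesis using unit_point.Same[of e f \<kappa> c i lab' pv'] by simp
  next
    case (Mixed s i t)
    have "s \<in> E" "t \<in> E" using Mixed(1) that(2) Z by auto
    then have "pv' s t = \<mu> (pv s t)" "pv s t \<in> \<Lambda>" using pv Mixed by blast+
    then show ?thesis using unit_point.Mixed[of \<kappa> s i t lab' pv'] Mixed by simp
  qed
  have bwd: "\<exists>v. unit_point \<kappa> lab pv U v \<and> v' = map_point \<mu> v"
    if "unit_point \<kappa> lab' pv' U v'" "U \<subseteq> Z" for U v'
    using that(1)
  proof cases
    case (At e c)
    then show ?thesis using unit_point.At[of \<kappa> e c lab pv] by (intro exI[of _ "Joint c"]) simp
  next
    case (Link e)
    then show ?thesis using unit_point.Link[of \<kappa> e lab pv] lab[of e] that(2) Z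
      by (intro exI[of _ "Point (lab e)"]) auto
  next
    case (Same e f c i)
    then show ?thesis using unit_point.Same[of e f \<kappa> c i lab pv] by (intro exI[of _ "Joint c"]) simp
  next
    case (Mixed s i t)
    have "s \<in> E" "t \<in> E" using Mixed(1) that(2) Z by auto
    then have "pv' s t = \<mu> (pv s t)" using pv Mixed by blast
    then show ?thesis using unit_point.Mixed[of \<kappa> s i t lab pv] Mixed
      by (intro exI[of _ "Point (pv s t)"]) simp
  qed
  have "clash_free \<kappa> lab' pv' Z = clash_free \<kappa> lab pv Z"
  proof
    assume L: "clash_free \<kappa> lab' pv' Z"
    show "clash_free \<kappa> lab pv Z" unfolding clash_free_def
    proof (intro allI impI)
      fix U U' v assume "U \<subseteq> Z" "U' \<subseteq> Z" "unit_point \<kappa> lab pv U v" "unit_point \<kappa> lab pv U' v"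
      then show "U = U'" using L fwd unfolding clash_free_def by meson
    qed
  next
    assume R: "clash_free \<kappa> lab pv Z"
    show "clash_free \<kappa> lab' pv' Z" unfolding clash_free_def
    proof (intro allI impI)
      fix U U' v' assume U: "U \<subseteq> Z" "U' \<subseteq> Z" "unit_point \<kappa> lab' pv' U v'" "unit_point \<kappa> lab' pv' U' v'"
      obtain v w where v: "unit_point \<kappa> lab pv U v" "v' = map_point \<mu> v"
        and w: "unit_point \<kappa> lab pv U' w" "v' = map_point \<mu> w"
        using bwd[OF U(3,1)] bwd[OF U(4,2)] by metis
      have "v = w" using injP fwd[OF v(1) U(1)] fwd[OF w(1) U(2)] v(2) w(2) by (metis inj_onD)
      then show "U = U'" using R U(1,2) v(1) w(1) unfolding clash_free_def by meson
    qed
  qed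
  then show ?thesis unfolding load_indep_def clash_free_def by metis
qed

text \<open>\<open>Shared\<close> labels stand for elements of the common subgroup,
  \<open>Private s k\<close> for the other elements on side \<open>s\<close>. Thus labels of the two
  sides coincide only over the common subgroup, whatever the two extensions are.\<close>

datatype label = Shared nat | Private bool nat

text \<open>
  \<open>(s, x, y, z, w)\<close> records the relation \<open>x y\<^sup>-\<^sup>1 z = w\<close> on side \<open>s\<close>. Its patch has edges with gains
  \<open>1\<close> and \<open>x y\<^sup>-\<^sup>1\<close> to the terminal 1 and \<open>x\<close> and \<open>w\<close> to the terminal 0, so that the four paths
  between the terminals through the patch have gains \<open>x, y, w, z\<close> and no others.
\<close>

type_synonym relation = "bool \<times> label \<times> label \<times> label \<times> label"

text \<open>In \<open>Patch_edge c b q\<close>, \<open>c\<close> is the terminal and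
  \<open>b\<close> tells the two edges there apart. The anchors of \<open>c\<close> are parallel
  patch edges which force the joint at \<open>c\<close> to be a loop in every
  representation.\<close>

datatype edge = Joint_edge bool | Anchor bool nat | Link_edge label | Patch_edge bool bool relation

instance label :: countable by countable_datatype
instance edge :: countable by countable_datatype

text \<open>The anchors occupy the patches 0 and 1, hence the shift for the patches of
  relations.\<close>

fun edge_kind :: "edge \<Rightarrow> kind" where
  "edge_kind (Joint_edge c) = At c"
| "edge_kind (Anchor c n) = To c (of_bool c)"
| "edge_kind (Link_edge l) = Link"
| "edge_kind (Patch_edge c b q) = To c (to_nat q + 2)"

fun edge_label :: "edge \<Rightarrow> label" where
  "edge_label (Link_edge l) = l"
| "edge_label _ = Shared 0"

text \<open>The anchors of the two terminals lie in different patches, so a mixed pair always comes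
  from a single relation and the default value is never the position of a unit.\<close>

fun pair_label :: "edge \<Rightarrow> edge \<Rightarrow> label" where
  "pair_label (Patch_edge _ b (_, x, y, z, w)) (Patch_edge _ b' _) =
     (if b then if b' then z else y else if b' then w else x)"
| "pair_label _ _ = Shared 0"

section \<open>Coded edges and the two sides of a glued hypergraph\<close>

definition kind_at :: "nat \<Rightarrow> kind" where "kind_at n = edge_kind (from_nat n)"
definition label_at :: "nat \<Rightarrow> label" where "label_at n = edge_label (from_nat n)"
definition pair_label_at :: "nat \<Rightarrow> nat \<Rightarrow> label" where
  "pair_label_at m n = pair_label (from_nat m) (from_nat n)"

abbreviation "edge_indep \<equiv> load_indep kind_at label_at pair_label_at"

lemma kind_to_nat [simp]: "kind_at (to_nat e) = edge_kind e" "label_at (to_nat e) = edge_label e"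
  "pair_label_at (to_nat e) (to_nat f) = pair_label e f"
  by (simp_all add: kind_at_def label_at_def pair_label_at_def)

fun edge_side :: "edge \<Rightarrow> bool option" where
  "edge_side (Patch_edge c b q) = Some (fst q)"
| "edge_side (Link_edge (Private s k)) = Some s"
| "edge_side _ = None"

definition side_labels :: "nat set \<Rightarrow> bool \<Rightarrow> label set" where
  "side_labels S s = Shared ` S \<union> range (Private s)"

fun edge_labels :: "edge \<Rightarrow> label set" where
  "edge_labels (Link_edge l) = {l}"
| "edge_labels (Patch_edge c b (s, x, y, z, w)) = {x, y, z, w}"
| "edge_labels _ = {}"

definition left_edges :: "nat set \<Rightarrow> nat set" where
  "left_edges S = to_nat ` {e. edge_side e = Some True \<and> edge_labels e \<subseteq> side_labels S True}"

text \<open>The edges common to both gadgets are counted on the right, the side that stays fixed in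
  the exchange.\<close>

definition right_edges :: "nat set \<Rightarrow> nat set" where
  "right_edges S = to_nat ` {e. edge_side e \<noteq> Some True \<and> edge_labels e \<subseteq> side_labels S False}"

lemma left_right_disjoint: "left_edges S \<inter> right_edges S = {}"
  by (auto simp: left_edges_def right_edges_def)

text \<open>A relation carries its side, so two relations on different sides have different patches
  even if all their labels are shared. Anchors occur on the right only.\<close>

lemma patches_left_right:
  assumes "Z \<subseteq> left_edges S" "Y \<subseteq> right_edges S"
  shows "patches kind_at Z \<inter> patches kind_at Y = {}"
proof (rule ccontr)
  assume "\<not> ?thesis"
  then obtain i m n c d where i: "m \<in> Z" "n \<in> Y" "kind_at m = To c i" "kind_at n = To d i"
    by (auto simp: patches_def)
  obtain e f where e: "m = to_nat e" "edge_side e = Some True" and f: "n = to_nat f"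
    "edge_side f \<noteq> Some True"
    using i assms unfolding left_edges_def right_edges_def by blast
  obtain b q where q: "e = Patch_edge c b q" "i = to_nat q + 2" using i(3) e by (cases e) auto
  then have "\<exists>b'. f = Patch_edge d b' q" using i(4) f(1)
    by (cases f) (auto simp: of_bool_def split: if_splits)
  then show False using e(2) f(2) q by auto
qed

lemma points_of_side:
  assumes "Z \<subseteq> to_nat ` {e. edge_labels e \<subseteq> side_labels S s}"
  shows "points_of kind_at label_at pair_label_at Z \<subseteq> range Joint \<union> Point ` side_labels S s"
proof
  fix v assume "v \<in> points_of kind_at label_at pair_label_at Z"
  then obtain U where U: "U \<subseteq> Z" "unit_point kind_at label_at pair_label_at U v"
    by (auto simp: points_of_def)
  from U(2) show "v \<in> range Joint \<union> Point ` side_labels S s"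
  proof cases
    case (Link e)
    then obtain f where f: "e = to_nat f" "edge_labels f \<subseteq> side_labels S s" using U(1) assms by auto
    then have "edge_label f \<in> side_labels S s" using Link by (cases f) auto
    then show ?thesis using Link f by auto
  next
    case (Mixed m i n)
    then have "m \<in> to_nat ` {e. edge_labels e \<subseteq> side_labels S s}"
      "n \<in> to_nat ` {e. edge_labels e \<subseteq> side_labels S s}"
      using U(1) assms by auto
    then obtain e f where ef: "m = to_nat (e :: edge)" "edge_labels e \<subseteq> side_labels S s"
      "n = to_nat (f :: edge)"
      by blast
    have "pair_label e f \<in> side_labels S s"
      using Mixed ef by (cases e; cases f) (auto simp: of_bool_def split: if_splits)
    then show ?thesis using Mixed ef by auto
  qed auto
qed

definition shared_points :: "nat set \<Rightarrow> label point set" where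
  "shared_points S = range Joint \<union> Point ` Shared ` S"

lemma points_left_right:
  assumes "Z \<subseteq> left_edges S" "Y \<subseteq> right_edges S"
  shows "points_of kind_at label_at pair_label_at Z \<inter> points_of kind_at label_at pair_label_at Y \<subseteq> shared_points S"
proof -
  have "points_of kind_at label_at pair_label_at Z \<subseteq> range Joint \<union> Point ` side_labels S True"
    using assms(1) by (intro points_of_side) (auto simp: left_edges_def)
  moreover have "points_of kind_at label_at pair_label_at Y \<subseteq> range Joint \<union> Point ` side_labels S False"
    using assms(2) by (intro points_of_side) (auto simp: right_edges_def)
  ultimately show ?thesis by (auto simp: shared_points_def side_labels_def)
qed

lemma models_left_index:
  assumes S: "finite S" and \<phi>: "wf_cmso \<phi>"
  obtains \<tau> :: "nat set \<Rightarrow> nat" and T where "finite T"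
    "\<And>E. finite E \<Longrightarrow> E \<subseteq> left_edges S \<Longrightarrow> \<tau> E \<in> T"
    "\<And>E E' D. finite E \<Longrightarrow> E \<subseteq> left_edges S \<Longrightarrow> finite E' \<Longrightarrow> E' \<subseteq> left_edges S \<Longrightarrow> finite D \<Longrightarrow>
       D \<subseteq> right_edges S \<Longrightarrow> \<tau> E = \<tau> E' \<Longrightarrow>
       models (restricted_hypergraph edge_indep (E \<union> D)) \<phi> \<longleftrightarrow> models (restricted_hypergraph edge_indep (E' \<union> D)) \<phi>"
proof -
  have fin: "finite (shared_points S)" using S by (simp add: shared_points_def)
  have cong: "edge_indep (Z \<union> Y) = edge_indep (Z' \<union> Y)"
    if "Z \<subseteq> left_edges S" "finite Z" "Z' \<subseteq> left_edges S" "finite Z'" "Y \<subseteq> right_edges S" "finite Y"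
      "load_state kind_at label_at pair_label_at (shared_points S) Z = load_state kind_at label_at pair_label_at (shared_points S) Z'" for Z Z' Y
    using that left_right_disjoint[of S]
    by (intro load_state_congruence[where V =
      "shared_points S"] patches_left_right points_left_right) auto
  show ?thesis
  proof (rule models_finite_index[of "left_edges S" "right_edges S"
    "{..3} \<times> UNIV \<times> Pow (shared_points S)"
        "load_state kind_at label_at pair_label_at (shared_points S)" edge_indep \<phi>])
    fix \<tau> :: "nat set \<Rightarrow> nat" and T
    assume "finite T" "\<And>E. finite E \<Longrightarrow> E \<subseteq> left_edges S \<Longrightarrow> \<tau> E \<in> T"
      "\<And>E E' D. finite E \<Longrightarrow> E \<subseteq> left_edges S \<Longrightarrow> finite E' \<Longrightarrow> E' \<subseteq> left_edges S \<Longrightarrow> finite D \<Longrightarrow>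
         D \<subseteq> right_edges S \<Longrightarrow> \<tau> E = \<tau> E' \<Longrightarrow>
         models (restricted_hypergraph edge_indep (E \<union> D)) \<phi> \<longleftrightarrow> models (restricted_hypergraph edge_indep (E' \<union> D)) \<phi>"
    then show thesis by (rule that)
  next
    show "edge_indep (Z \<union> Y) = edge_indep (Z' \<union> Y)"
      if "Z \<subseteq> left_edges S" "finite Z" "Z' \<subseteq> left_edges S" "finite Z'" "Y \<subseteq> right_edges S" "finite Y"
        "load_state kind_at label_at pair_label_at (shared_points S) Z = load_state kind_at label_at pair_label_at (shared_points S) Z'" for Z Z' Y
      using cong[OF that] .
  qed (rule left_right_disjoint load_state_finite(1)[OF fin] load_state_finite(2) \<phi>)+
qed

section \<open>The edges contributed by an extension\<close>

definition ext_label :: "('a \<Rightarrow> nat) \<Rightarrow> 'a set \<Rightarrow> ('a \<Rightarrow> nat) \<Rightarrow> bool \<Rightarrow> nat \<Rightarrow> label" where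
  "ext_label h F \<psi> s k = (if k \<in> \<psi> ` F then Shared (h (inv_into F \<psi> k)) else Private s k)"

text \<open>Links for the image of \<open>F\<close> are common edges and so omitted here. For
  \<open>x = y\<close> or \<open>y = z\<close> the relation holds trivially, and its patch would
  have two parallel edges of equal gain, \<open>1\<close> and \<open>x y^-1\<close> or
  \<open>x\<close> and \<open>w\<close>.\<close>

definition ext_edges ::
    "('a \<Rightarrow> nat) \<Rightarrow> 'a set \<Rightarrow> bool \<Rightarrow> nat monoid \<Rightarrow> ('a \<Rightarrow> nat) \<Rightarrow> nat set \<Rightarrow> edge set" where
  "ext_edges h F s K \<psi> X =
     (\<lambda>x. Link_edge (ext_label h F \<psi> s x)) ` (X - \<psi> ` F) \<union>
     {Patch_edge c b (s, ext_label h F \<psi> s x, ext_label h F \<psi> s y, ext_label h F \<psi> s z, ext_label h F \<psi> s w)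
       | c b x y z w. {x, y, z, w} \<subseteq> X \<and> x \<otimes>\<^bsub>K\<^esub> inv\<^bsub>K\<^esub> y \<otimes>\<^bsub>K\<^esub> z = w \<and> x \<noteq> y \<and> y \<noteq> z}"

definition common_edges :: "('a \<Rightarrow> nat) \<Rightarrow> 'a set \<Rightarrow> edge set" where
  "common_edges h F = range Joint_edge \<union> {Anchor c n | c n. n < 3} \<union> (\<lambda>f. Link_edge (Shared (h f))) ` F"

lemma finite_ext_edges: "finite X \<Longrightarrow> finite (ext_edges h F s K \<psi> X)"
proof -
  assume X: "finite X"
  let ?l = "ext_label h F \<psi> s"
  have "{Patch_edge c b (s, ?l x, ?l y, ?l z, ?l w)
       | c b x y z w. {x, y, z, w} \<subseteq> X \<and> x \<otimes>\<^bsub>K\<^esub> inv\<^bsub>K\<^esub> y \<otimes>\<^bsub>K\<^esub> z = w \<and> x \<noteq> y \<and> y \<noteq> z}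
    \<subseteq> (\<lambda>(c, b, x, y, z, w). Patch_edge c b (s, ?l x, ?l y, ?l z, ?l w)) ` (UNIV \<times> UNIV \<times> X \<times> X \<times> X \<times> X)"
    by (fastforce simp: image_iff)
  moreover have "finite ((UNIV :: bool set) \<times> (UNIV :: bool set) \<times> X \<times> X \<times> X \<times> X)" using X by simp
  ultimately show ?thesis unfolding ext_edges_def using X
    by (meson finite_Diff finite_Un finite_imageI finite_subset)
qed

lemma finite_common_edges: "finite F \<Longrightarrow> finite (common_edges h F)"
proof -
  have "{Anchor c n | c n. n < 3} = (\<lambda>(c, n). Anchor c n) ` (UNIV \<times> {..<3})" by auto
  then show "finite F \<Longrightarrow> finite (common_edges h F)" unfolding common_edges_def by simp
qed

lemma ext_label_side: "ext_label h F \<psi> s k \<in> side_labels (h ` F) s"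
  unfolding ext_label_def side_labels_def by (auto intro: inv_into_into)

lemma ext_label_image: "inj_on \<psi> F \<Longrightarrow> f \<in> F \<Longrightarrow> ext_label h F \<psi> s (\<psi> f) = Shared (h f)"
  by (simp add: ext_label_def)

lemma inj_ext_label:
  assumes "inj_on h F"
  shows "inj (ext_label h F \<psi> s)"
proof (rule injI)
  fix k l assume kl: "ext_label h F \<psi> s k = ext_label h F \<psi> s l"
  then have "k \<in> \<psi> ` F \<longleftrightarrow> l \<in> \<psi> ` F" by (simp add: ext_label_def split: if_splits)
  moreover have "k = l" if "k \<in> \<psi> ` F" "l \<in> \<psi> ` F"
  proof -
    have "inv_into F \<psi> k = inv_into F \<psi> l"
      using kl that assms inv_into_into[of k \<psi> F] inv_into_into[of l \<psi> F]
      by (simp add: ext_label_def inj_on_eq_iff)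
    then show ?thesis using that f_inv_into_f by metis
  qed
  moreover have "k = l" if "k \<notin> \<psi> ` F" "l \<notin> \<psi> ` F" using kl that by (simp add: ext_label_def)
  ultimately show "k = l" by blast
qed

lemma ext_edges_side:
  assumes "e \<in> ext_edges h F s K \<psi> X"
  shows "edge_side e = Some s" "edge_labels e \<subseteq> side_labels (h ` F) s"
proof -
  have 1: "ext_label h F \<psi> s x = Private s x" if "x \<notin> \<psi> ` F" for x using that
    by (simp add: ext_label_def)
  show "edge_side e = Some s" using assms 1 unfolding ext_edges_def by auto
  show "edge_labels e \<subseteq> side_labels (h ` F) s"
    using assms ext_label_side[of h F \<psi> s] unfolding ext_edges_def by auto
qed

lemma ext_edges_left: "to_nat ` ext_edges h F True K \<psi> X \<subseteq> left_edges (h ` F)"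
  unfolding left_edges_def using ext_edges_side[of _ h F True K \<psi> X] by blast

lemma right_part: "to_nat ` (common_edges h F \<union> ext_edges h F False K \<psi> X) \<subseteq> right_edges (h ` F)"
proof -
  have "edge_side e \<noteq> Some True \<and> edge_labels e \<subseteq> side_labels (h ` F) False"
    if "e \<in> common_edges h F" for e
    using that by (auto simp: common_edges_def side_labels_def)
  then show ?thesis unfolding right_edges_def using ext_edges_side[of _ h F False K \<psi> X] by fastforce
qed

text \<open>The formal labels are read in \<open>\<Gamma>\<close> through the two embeddings. By
  \<open>agree\<close> the reading of shared labels is consistent, and by \<open>exact\<close>
  labels of different sides never collide, so \<open>load_indep_relabel\<close> identifies the
  formal gadget with one that has these gains. The assumption \<open>big\<close> provides gains for
  joints and anchors.\<close>

lemma realization: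
  fixes \<Gamma> :: "('a, 'm) monoid_scheme" (structure)
    and K :: "bool \<Rightarrow> nat monoid"
  assumes \<Gamma>: "group \<Gamma>" and K: "\<And>s. group (K s)" and \<theta>: "\<And>s. \<theta> s \<in> mon (K s) \<Gamma>"
    and h: "inj_on h F" "finite F" and \<psi>: "\<And>s. inj_on (\<psi> s) F" "\<And>s. \<psi> s ` F \<subseteq> X s"
    and X: "\<And>s. X s \<subseteq> carrier (K s)" "\<And>s. finite (X s)"
    and agree: "\<And>f. f \<in> F \<Longrightarrow> \<theta> True (\<psi> True f) = \<theta> False (\<psi> False f)"
    and exact: "\<theta> True ` X True \<inter> \<theta> False ` X False \<subseteq> \<theta> True ` \<psi> True ` F"
    and big: "3 \<le> card (carrier (K True))"
  defines "D \<equiv> common_edges h F \<union> (\<Union>s. ext_edges h F s (K s) (\<psi> s) (X s))"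
  shows "restricted_hypergraph edge_indep (to_nat ` D) \<in> gain_graphic_matroids \<Gamma>"
proof -
  interpret \<Gamma>: group \<Gamma> by (rule \<Gamma>)
  let ?l = "\<lambda>s. ext_label h F (\<psi> s) s"
  have c\<theta>: "\<theta> s k \<in> carrier \<Gamma>" if "k \<in> X s" for s k using monD(3)[OF \<theta>] X(1) that by blast
  have fD: "finite D"
    unfolding D_def using finite_common_edges[OF h(2)] finite_ext_edges[OF X(2)] by auto
  have \<theta>inj: "k = l" if "\<theta> s k = \<theta> s l" "k \<in> carrier (K s)" "l \<in> carrier (K s)" for s k l
    using inj_onD[OF monD(2)[OF \<theta>] that] .

  \<comment> \<open>The three parallel anchors at a terminal need distinct gains. Since at least one
    of two distinct elements is not the identity, this also provides a gain for the joints.\<close>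
  obtain T where T: "T \<subseteq> carrier (K True)" "card T = 3" using big by (meson obtain_subset_with_card_n)
  then have "finite T" by (metis card.infinite zero_neq_numeral)
  then obtain d0 where d0: "bij_betw d0 {0..<card T} T" using ex_bij_betw_nat_finite by blast
  define d where "d n = \<theta> True (d0 n)" for n
  have dT: "d0 n \<in> carrier (K True)" if "n < 3" for n using d0 T that by (auto simp: bij_betw_def)
  have dc: "d n \<in> carrier \<Gamma>" if "n < 3" for n using monD(3)[OF \<theta> dT[OF that]] by (simp add: d_def)
  have dinj: "m = n" if "m < 3" "n < 3" "d m = d n" for m n
  proof -
    have "d0 m = d0 n" using that(3) dT[OF that(1)] dT[OF that(2)] unfolding d_def by (rule \<theta>inj)
    moreover have "m \<in> {0..<card T}" "n \<in> {0..<card T}" using that T(2) by auto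
    ultimately show ?thesis using bij_betw_imp_inj_on[OF d0] by (meson inj_onD)
  qed
  obtain \<gamma> where \<gamma>: "\<gamma> \<in> carrier \<Gamma>" "\<gamma> \<noteq> \<one>"
    using dc[of 0] dc[of 1] dinj[of 0 1]
      by (metis one_less_numeral_iff semiring_norm(77) zero_less_numeral zero_neq_one)

  \<comment> \<open>Shared labels are read through the left embedding, which is the same as through
    the right one.\<close>
  define \<mu> where
    "\<mu> l = (case l of Shared n \<Rightarrow> \<theta> True (\<psi> True (inv_into F h n)) | Private s k \<Rightarrow> \<theta> s k)" for l
  have \<mu>: "\<mu> (?l s k) = \<theta> s k" for s k
  proof (cases "k \<in> \<psi> s ` F")
    case True
    then obtain f where f: "f \<in> F" "k = \<psi> s f" by auto
    then have "\<mu> (?l s k) = \<theta> True (\<psi> True f)"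
      using ext_label_image[OF \<psi>(1)] h(1) by (simp add: \<mu>_def)
    then show ?thesis using agree f by (cases s) auto
  qed (simp add: ext_label_def \<mu>_def)
  define \<Lambda> where "\<Lambda> = (\<Union>s. ?l s ` X s)"
  have \<mu>inj: "inj_on \<mu> \<Lambda>"
  proof (rule inj_onI)
    fix l l' assume ll: "l \<in> \<Lambda>" "l' \<in> \<Lambda>" "\<mu> l = \<mu> l'"
    obtain s k s' k' where k: "k \<in> X s" "l = ?l s k" and k': "k' \<in> X s'" "l' = ?l s' k'"
      using ll(1,2) by (auto simp: \<Lambda>_def)
    have eq: "\<theta> s k = \<theta> s' k'" using ll(3) \<mu> k(2) k'(2) by simp
    \<comment> \<open>Equal values from the two sides come from \<open>F\<close> by
      \<open>exact\<close>, and then both elements carry the same shared label.\<close>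
    have mixed: "?l True x = ?l False y" if xy: "x \<in> X True" "y \<in> X False" "\<theta> True x = \<theta> False y"
      for x y
    proof -
      have "\<theta> True x \<in> \<theta> True ` X True \<inter> \<theta> False ` X False"
        using imageI[OF xy(1), of "\<theta> True"] imageI[OF xy(2), of "\<theta> False"] xy(3)
          by (intro IntI) simp_all
      then obtain f where f: "f \<in> F" "\<theta> True x = \<theta> True (\<psi> True f)" using exact by auto
      then have "\<theta> False y = \<theta> False (\<psi> False f)" using agree xy(3) by simp
      moreover have "y \<in> carrier (K False)" "\<psi> False f \<in> carrier (K False)"
        using xy f \<psi>(2) X(1) by blast+
      ultimately have "y = \<psi> False f" by (rule \<theta>inj)
      moreover have "x \<in> carrier (K True)" "\<psi> True f \<in> carrier (K True)" using xy f \<psi>(2) X(1) by blast+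
      with f(2) have "x = \<psi> True f" by (rule \<theta>inj)
      ultimately show ?thesis using ext_label_image[OF \<psi>(1) f(1)] by simp
    qed
    show "l = l'"
    proof (cases "s = s'")
      case True
      then have "k' \<in> carrier (K s)" "\<theta> s k = \<theta> s k'" "k \<in> carrier (K s)"
        using eq k(1) k'(1) X(1) by auto
      then have "k = k'" using \<theta>inj by blast
      then show ?thesis using True k(2) k'(2) by simp
    next
      case False
      then consider "s" "\<not> s'" | "\<not> s" "s'" by blast
      then show ?thesis
      proof cases
        case 1
        then show ?thesis using mixed[of k k'] eq k k' by simp
      next
        case 2
        then show ?thesis using mixed[of k' k] eq k k' by simp
      qed
    qed
  qed

  define g where "g e = (case e of Joint_edge c \<Rightarrow> \<gamma> | Anchor c n \<Rightarrow> d n | Link_edge l \<Rightarrow> \<mu> l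
    | Patch_edge c b q \<Rightarrow> (case q of (s, x, y, z, w) \<Rightarrow>
        if c then (if b then \<mu> x \<otimes> inv (\<mu> y) else \<one>) else (if b then \<mu> w else \<mu> x)))" for e
  have D_link: "l \<in> \<Lambda> \<and> \<mu> l \<in> carrier \<Gamma>" if "Link_edge l \<in> D" for l
  proof -
    have "\<exists>s. \<exists>k \<in> X s. l = ?l s k"
    proof (cases "Link_edge l \<in> common_edges h F")
      case True
      then obtain f where "f \<in> F" "l = Shared (h f)" by (auto simp: common_edges_def)
      then show ?thesis using ext_label_image[OF \<psi>(1)] \<psi>(2)[of True]
        by (intro exI[of _ True] bexI[of _ "\<psi> True f"]) auto
    next
      case False
      then show ?thesis using that by (auto simp: D_def ext_edges_def)
    qed
    then show ?thesis using \<mu> c\<theta> by (auto simp: \<Lambda>_def)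
  qed
  have D_patch: "{x, y, z, w} \<subseteq> \<Lambda> \<and> {\<mu> x, \<mu> y, \<mu> z, \<mu> w} \<subseteq> carrier \<Gamma> \<and>
      \<mu> w = \<mu> x \<otimes> inv (\<mu> y) \<otimes> \<mu> z \<and> \<mu> x \<noteq> \<mu> y \<and> \<mu> y \<noteq> \<mu> z"
    if "Patch_edge c b (s, x, y, z, w) \<in> D" for c b s x y z w
  proof -
    have "Patch_edge c b (s, x, y, z, w) \<notin> common_edges h F" by (auto simp: common_edges_def)
    then have "Patch_edge c b (s, x, y, z, w) \<in> ext_edges h F s (K s) (\<psi> s) (X s)"
      using that by (auto simp: D_def ext_edges_def)
    then obtain x' y' z' w' where p: "x = ?l s x'" "y = ?l s y'" "z = ?l s z'" "w = ?l s w'"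
      "{x', y', z', w'} \<subseteq> X s" "x' \<otimes>\<^bsub>K s\<^esub> inv\<^bsub>K s\<^esub> y' \<otimes>\<^bsub>K s\<^esub> z' = w'" "x' \<noteq> y'" "y' \<noteq> z'"
      by (auto simp: ext_edges_def)
    interpret K: group "K s" by (rule K)
    interpret hm: group_hom "K s" \<Gamma> "\<theta> s"
      using monD(1)[OF \<theta>] by (unfold_locales) auto
    have c: "x' \<in> carrier (K s)" "y' \<in> carrier (K s)" "z' \<in> carrier (K s)" using p(5) X(1) by auto
    have "\<theta> s w' = \<theta> s x' \<otimes> inv (\<theta> s y') \<otimes> \<theta> s z'" using c unfolding p(6)[symmetric] by simp
    moreover have "\<theta> s x' \<noteq> \<theta> s y'" "\<theta> s y' \<noteq> \<theta> s z'"
      using p(7,8) c \<theta>inj by blast+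
    moreover have "{x, y, z, w} \<subseteq> \<Lambda>" using p(5) unfolding p(1-4) \<Lambda>_def by auto
    ultimately show ?thesis using p(5) c\<theta> unfolding p(1-4) \<mu> by auto
  qed

  let ?E = "to_nat ` D" and ?g = "\<lambda>n. g (from_nat n)"
  interpret gain_gadget \<Gamma> ?E kind_at ?g
  proof (unfold_locales)
    show "finite ?E" using fD by simp
  next
    fix n assume "n \<in> ?E"
    then obtain e where e: "n = to_nat e" "e \<in> D" by auto
    have "g e \<in> carrier \<Gamma>"
    proof (cases e)
      case (Joint_edge c)
      then show ?thesis using \<gamma> by (simp add: g_def)
    next
      case (Anchor c n)
      then have "n < 3" using e(2) by (auto simp: D_def common_edges_def ext_edges_def)
      then show ?thesis using Anchor dc by (simp add: g_def)
    next
      case (Link_edge l)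
      then show ?thesis using D_link e(2) by (simp add: g_def)
    next
      case (Patch_edge c b q)
      obtain s x y z w where q: "q = (s, x, y, z, w)" by (cases q) auto
      show ?thesis using D_patch[of c b s x y z w] e(2) Patch_edge q by (auto simp: g_def)
    qed
    then show "?g n \<in> carrier \<Gamma>" using e by simp
  next
    fix n c assume "n \<in> ?E" "kind_at n = At c"
    then obtain e where e: "n = to_nat e" "edge_kind e = At c" by auto
    then have "e = Joint_edge c" by (cases e) auto
    then show "?g n \<noteq> \<one>" using \<gamma> e by (simp add: g_def)
  next
    fix m n c i
    assume mn: "m \<in> ?E" "n \<in> ?E" "kind_at m = To c i" "kind_at n = To c i" "?g m = ?g n"
    then obtain e f where ef: "m = to_nat e" "n = to_nat f" "e \<in> D" "f \<in> D" "edge_kind e = To c i"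
      "edge_kind f = To c i" "g e = g f" by auto
    have "e = f"
    proof (cases e)
      case (Anchor c' k)
      then obtain l where l: "f = Anchor c l" "c' = c" using ef(5,6)
        by (cases f) (auto simp: of_bool_def split: if_splits)
      have "k < 3" "l < 3" using ef(3,4) Anchor l by (auto simp: D_def common_edges_def ext_edges_def)
      then show ?thesis using dinj ef(7) Anchor l by (simp add: g_def)
    next
      case (Patch_edge c' b q)
      then obtain b' where f: "f = Patch_edge c b' q" "c' = c" using ef(5,6)
        by (cases f) (auto simp: of_bool_def split: if_splits)
      obtain s x y z w where q: "q = (s, x, y, z, w)" by (cases q) auto
      have p: "{\<mu> x, \<mu> y, \<mu> z, \<mu> w} \<subseteq> carrier \<Gamma>" "\<mu> w = \<mu> x \<otimes> inv (\<mu> y) \<otimes> \<mu> z" "\<mu> x \<noteq> \<mu> y" "\<mu> y \<noteq> \<mu> z"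
        using D_patch[of c b s x y z w] ef(3) Patch_edge f q by auto
      \<comment> \<open>Parallel patch edges have different gains: \<open>1\<close> and
        \<open>x y^-1\<close> because \<open>x\<close> and \<open>y\<close> differ, \<open>x\<close>
        and \<open>w\<close> because \<open>y\<close> and \<open>z\<close> differ.\<close>
      have 1: "\<mu> x \<otimes> inv (\<mu> y) \<noteq> \<one>" using p(1,3) by (auto simp: \<Gamma>.inv_solve_right')
      have 2: "\<mu> w \<noteq> \<mu> x"
      proof
        assume "\<mu> w = \<mu> x"
        then have "\<mu> x \<otimes> (inv (\<mu> y) \<otimes> \<mu> z) = \<mu> x \<otimes> \<one>" using p(1,2) by (simp add: \<Gamma>.m_assoc)
        then have "inv (\<mu> y) \<otimes> \<mu> z = \<one>" using p(1) by (simp del: \<Gamma>.r_one)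
        then show False using p(1,4) by (simp add: \<Gamma>.inv_solve_left')
      qed
      have "b = b'" using ef(7) 1 2 1[symmetric] 2[symmetric] Patch_edge f q
        by (cases b; cases b'; cases c) (auto simp: g_def)
      then show ?thesis using Patch_edge f by simp
    qed (use ef(5) in auto)
    then show "m = n" using ef by simp
  qed
  have "load_indep kind_at ?g pair_gain Z = edge_indep Z" if Z: "Z \<subseteq> ?E" for Z
  proof (rule load_indep_relabel[OF _ _ \<mu>inj Z])
    fix n assume "n \<in> ?E" "kind_at n = Link"
    then obtain e where e: "n = to_nat e" "e \<in> D" "edge_kind e = Link" by auto
    then obtain l where "e = Link_edge l" by (cases e) auto
    then show "?g n = \<mu> (label_at n) \<and> label_at n \<in> \<Lambda>" using e D_link by (simp add: g_def)
  next
    fix m n i assume mn: "m \<in> ?E" "n \<in> ?E" "kind_at m = To True i" "kind_at n = To False i"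
    then obtain e f where ef: "m = to_nat e" "n = to_nat f" "e \<in> D" "f \<in> D" "edge_kind e = To True i"
      "edge_kind f = To False i" by auto
    obtain b q where e: "e = Patch_edge True b q" using ef(5,6)
      by (cases e; cases f) (auto simp: of_bool_def split: if_splits)
    obtain b' where f: "f = Patch_edge False b' q" using ef(5,6) e
      by (cases f) (auto simp: of_bool_def split: if_splits)
    obtain s x y z w where q: "q = (s, x, y, z, w)" by (cases q) auto
    have p: "{x, y, z, w} \<subseteq> \<Lambda>" "{\<mu> x, \<mu> y, \<mu> z, \<mu> w} \<subseteq> carrier \<Gamma>" "\<mu> w = \<mu> x \<otimes> inv (\<mu> y) \<otimes> \<mu> z"
      using D_patch[of True b s x y z w] ef(3) e q by auto
    have y: "inv (\<mu> x \<otimes> inv (\<mu> y)) \<otimes> \<mu> x = \<mu> y"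
      using p(2) by (simp add: \<Gamma>.inv_mult_group \<Gamma>.m_assoc)
    have z: "inv (\<mu> x \<otimes> inv (\<mu> y)) \<otimes> \<mu> w = \<mu> z"
    proof -
      have "\<mu> w = \<mu> x \<otimes> inv (\<mu> y) \<otimes> \<mu> z" "\<mu> x \<otimes> inv (\<mu> y) \<in> carrier \<Gamma>" using p(2,3) by auto
      then show ?thesis using p(2) by (metis \<Gamma>.inv_solve_left insert_subset)
    qed
    have "inv (g e) \<otimes> g f = \<mu> (pair_label e f)"
      using p(2) y z unfolding e f q by (cases b; cases b') (simp_all add: g_def)
    moreover have "pair_label e f \<in> \<Lambda>" using p(1) unfolding e f q by simp
    ultimately show "pair_gain m n = \<mu> (pair_label_at m n) \<and> pair_label_at m n \<in> \<Lambda>"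
      using ef(1,2) by simp
  qed
  then have "restricted_hypergraph edge_indep ?E = frame_matroid \<Gamma> (gadget kind_at ?E) (gadget_gain \<Gamma> ?g)"
    unfolding frame_matroid_gadget by (auto simp: restricted_hypergraph_def)
  then show ?thesis
    unfolding gain_graphic_matroids_def
    using is_multigraph_gadget[OF finE, of kind_at] gaining by blast
qed

text \<open>The link gains of any representation satisfy the relations of both sides, so each side
  yields a monomorphism by \<open>spread_extends\<close>. On \<open>F\<close> both are given by the
  same expression in gains of shared links, normalised by the link of the identity \<open>u\<close>.
  This is why they agree there.\<close>

lemma recovery:
  fixes \<Gamma> :: "('a, 'm) monoid_scheme" (structure)
    and K :: "bool \<Rightarrow> nat monoid"
  assumes \<Gamma>: "group \<Gamma>" and K: "\<And>s. group (K s)"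
    and h: "inj_on h F" and \<psi>: "\<And>s. inj_on (\<psi> s) F" "\<And>s. \<psi> s ` F \<subseteq> X s"
    and u: "u \<in> F" "\<And>s. \<psi> s u = \<one>\<^bsub>K s\<^esub>"
    and X: "\<And>s. spread (K s) (carrier (K s)) (X s)" "2 \<le> card (X True)"
  defines "D \<equiv> common_edges h F \<union> (\<Union>s. ext_edges h F s (K s) (\<psi> s) (X s))"
  assumes gg: "restricted_hypergraph edge_indep (to_nat ` D) \<in> gain_graphic_matroids \<Gamma>"
  obtains \<theta> where "\<And>s. \<theta> s \<in> mon (K s) \<Gamma>"
    "\<And>f. f \<in> F \<Longrightarrow> \<theta> True (\<psi> True f) = \<theta> False (\<psi> False f)"
proof -
  interpret \<Gamma>: group \<Gamma> by (rule \<Gamma>)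
  let ?l = "\<lambda>s. ext_label h F (\<psi> s) s"
  obtain G :: "(nat, nat) multigraph" and \<sigma> where G: "is_multigraph G" "is_gaining \<Gamma> G \<sigma>"
    "restricted_hypergraph edge_indep (to_nat ` D) = frame_matroid \<Gamma> G \<sigma>"
    using gg by (auto simp: gain_graphic_matroids_def)
  interpret frame_rep \<Gamma> G \<sigma> using G by unfold_locales
  have ED: "E = to_nat ` D" using G(3) by (simp add: restricted_hypergraph_def frame_matroid_def)
  have indep: "indep Z \<longleftrightarrow> edge_indep Z" if "Z \<subseteq> E" for Z
    using that unfolding G(3)[symmetric] ED by simp
  have common: "to_nat e \<in> E" if "e \<in> common_edges h F" for e using that by (auto simp: ED D_def)
  have ext: "to_nat e \<in> E" if "e \<in> ext_edges h F s (K s) (\<psi> s) (X s)" for e s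
    using that by (auto simp: ED D_def)
  let ?L = "{e \<in> E. kind_at e = Link}"
  let ?link = "\<lambda>s x. to_nat (Link_edge (?l s x))"
  have link: "?link s x \<in> ?L" if x: "x \<in> X s" for s x
  proof (cases "x \<in> \<psi> s ` F")
    case True
    then have "Link_edge (?l s x) \<in> common_edges h F"
      by (auto simp: ext_label_image[OF \<psi>(1)] common_edges_def)
    then show ?thesis using common by simp
  next
    case False
    then have "Link_edge (?l s x) \<in> ext_edges h F s (K s) (\<psi> s) (X s)" using x
      by (auto simp: ext_edges_def)
    then show ?thesis using ext by simp
  qed
  have linj: "x = y" if "?l s x = ?l s y" for s x y using injD[OF inj_ext_label[OF h] that] .
  have card_link: "2 \<le> card ?L"
  proof -
    have "inj_on (?link True) (X True)" by (rule inj_onI) (use linj in simp)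
    then have "card (X True) = card (?link True ` X True)" by (simp add: card_image)
    also have "\<dots> \<le> card ?L" using link finE by (intro card_mono) auto
    finally show ?thesis using X(2) by simp
  qed
  have lab_inj: "inj_on label_at ?L"
  proof (rule inj_onI)
    fix m n assume mn: "m \<in> ?L" "n \<in> ?L" "label_at m = label_at n"
    obtain e f where ef: "m = to_nat (e :: edge)" "n = to_nat (f :: edge)"
      using mn(1,2) unfolding ED by blast
    then have "e = f" using mn by (cases e; cases f) auto
    then show "m = n" using ef by simp
  qed
  have anchor: "card (to_nat ` Anchor c ` {..<3}) = 3" for c
    by (simp add: card_image inj_on_def)
  have anchorE: "to_nat ` Anchor c ` {..<3} \<subseteq> E" for c
    using common by (auto simp: common_edges_def)
  have jointE: "to_nat (Joint_edge c) \<in> E" for c by (rule common) (simp add: common_edges_def)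
  obtain \<eta> where \<eta>: "\<And>l. l \<in> ?L \<Longrightarrow> \<eta> l \<in> carrier \<Gamma>" "inj_on \<eta> ?L"
    and heap: "\<And>i s1 s2 t1 t2 x y z w. {s1, s2, t1, t2} \<subseteq> E \<Longrightarrow> s1 \<noteq> s2 \<Longrightarrow> t1 \<noteq> t2 \<Longrightarrow>
       kind_at s1 = To True i \<Longrightarrow> kind_at s2 = To True i \<Longrightarrow> kind_at t1 = To False i \<Longrightarrow>
         kind_at t2 = To False i \<Longrightarrow>
       {x, y, z, w} \<subseteq> ?L \<Longrightarrow> label_at x = pair_label_at s1 t1 \<Longrightarrow> label_at y = pair_label_at s2 t1 \<Longrightarrow>
         label_at z = pair_label_at s2 t2 \<Longrightarrow> label_at w = pair_label_at s1 t2 \<Longrightarrow>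
       \<eta> w = \<eta> x \<otimes> inv (\<eta> y) \<otimes> \<eta> z"
    by (rule link_gains[of kind_at label_at pair_label_at "\<lambda>c. to_nat (Joint_edge c)"
      "\<lambda>c. to_nat ` Anchor c ` {..<3}" of_bool ?L])
      (use indep jointE anchor anchorE lab_inj card_link in \<open>auto simp del: of_bool_eq_iff\<close>)
  have "\<exists>\<theta>. \<theta> \<in> mon (K s) \<Gamma> \<and> (\<forall>f \<in> F. \<theta> (\<psi> s f) =
      \<eta> (to_nat (Link_edge (Shared (h f)))) \<otimes> inv (\<eta> (to_nat (Link_edge (Shared (h u))))))" for s
  proof -
    interpret K: group "K s" by (rule K)
    have XK: "x \<in> carrier (K s)" if "x \<in> X s" for x using X(1)[of s] that by (auto simp: spread_def)
    obtain \<theta> where \<theta>: "\<theta> \<in> mon (K s) \<Gamma>"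
      "\<And>x y. x \<in> X s \<Longrightarrow> y \<in> X s \<Longrightarrow> \<theta> (x \<otimes>\<^bsub>K s\<^esub> inv\<^bsub>K s\<^esub> y) = \<eta> (?link s x) \<otimes> inv (\<eta> (?link s y))"
    proof (rule spread_extends[OF K \<Gamma> X(1), of s "\<lambda>x. \<eta> (?link s x)"])
      show "\<eta> (?link s x) \<in> carrier \<Gamma>" if "x \<in> X s" for x using \<eta>(1) link[OF that] by blast
      show "inj_on (\<lambda>x. \<eta> (?link s x)) (X s)"
      proof (rule inj_onI)
        fix x y assume xy: "x \<in> X s" "y \<in> X s" "\<eta> (?link s x) = \<eta> (?link s y)"
        then have "?link s x = ?link s y" using \<eta>(2) link by (meson inj_onD)
        then show "x = y" using linj by simp
      qed
      fix x y z w assume xyz: "{x, y, z, w} \<subseteq> X s" "x \<otimes>\<^bsub>K s\<^esub> inv\<^bsub>K s\<^esub> y \<otimes>\<^bsub>K s\<^esub> z = w"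
      then have mem: "x \<in> X s" "y \<in> X s" "z \<in> X s" "w \<in> X s" by auto
      have c\<eta>: "\<eta> (?link s x) \<in> carrier \<Gamma>" "\<eta> (?link s y) \<in> carrier \<Gamma>" "\<eta> (?link s z) \<in> carrier \<Gamma>"
        using \<eta>(1) link mem by blast+
      \<comment> \<open>Degenerate relations have no patch, but for them the equation of gains is
        trivial.\<close>
      consider "x = y" | "y = z" | "x \<noteq> y" "y \<noteq> z" by blast
      then show "\<eta> (?link s w) = \<eta> (?link s x) \<otimes> inv (\<eta> (?link s y)) \<otimes> \<eta> (?link s z)"
      proof cases
        case 1
        then have "w = z" using xyz(2) XK mem by simp
        then show ?thesis using 1 c\<eta> by simp
      next
        case 2
        then have "w = x" using xyz(2) XK mem by (simp add: K.m_assoc)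
        then show ?thesis using 2 c\<eta> by (simp add: \<Gamma>.m_assoc)
      next
        case 3
        let ?q = "(s, ?l s x, ?l s y, ?l s z, ?l s w)"
        have "to_nat (Patch_edge c b ?q) \<in> E" for c b
          by (rule ext[of _ s]) (use xyz 3 in \<open>auto simp: ext_edges_def\<close>)
        then show ?thesis
          by (intro heap[of "to_nat (Patch_edge True False ?q)" "to_nat (Patch_edge True True ?q)"
            "to_nat (Patch_edge False False ?q)" "to_nat (Patch_edge False True ?q)" "to_nat ?q + 2"])
            (use link[OF mem(1)] link[OF mem(2)] link[OF mem(3)] link[OF mem(4)] in auto)
      qed
    next
      fix \<theta> assume "\<theta> \<in> mon (K s) \<Gamma>" "\<And>x y. x \<in> X s \<Longrightarrow> y \<in> X s \<Longrightarrow>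
        \<theta> (x \<otimes>\<^bsub>K s\<^esub> inv\<^bsub>K s\<^esub> y) = \<eta> (?link s x) \<otimes> inv (\<eta> (?link s y))"
      then show thesis by (rule that)
    qed
    \<comment> \<open>As \<open>\<psi> s u\<close> is the identity, \<open>\<psi> s f\<close> is
      itself a quotient of two elements of \<open>X s\<close>, both with shared links.\<close>
    have "\<theta> (\<psi> s f) = \<eta> (to_nat (Link_edge (Shared (h f)))) \<otimes> inv (\<eta> (to_nat (Link_edge (Shared (h u)))))"
      if f: "f \<in> F" for f
    proof -
      have m: "\<psi> s f \<in> X s" "\<psi> s u \<in> X s" using \<psi>(2)[of s] f u(1) by auto
      have "\<psi> s f \<otimes>\<^bsub>K s\<^esub> inv\<^bsub>K s\<^esub> (\<psi> s u) = \<psi> s f" using XK m by (simp add: u(2))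
      then show ?thesis using \<theta>(2)[OF m] ext_label_image[OF \<psi>(1)] f u(1) by simp
    qed
    then show ?thesis using \<theta>(1) by blast
  qed
  then obtain \<theta> where "\<And>s. \<theta> s \<in> mon (K s) \<Gamma>" "\<And>s f. f \<in> F \<Longrightarrow> \<theta> s (\<psi> s f) =
      \<eta> (to_nat (Link_edge (Shared (h f)))) \<otimes> inv (\<eta> (to_nat (Link_edge (Shared (h u)))))" by metis
  then show ?thesis using that by metis
qed

section \<open>Finitely many types bound the conviviality graph\<close>

lemma finite_image_factor:
  assumes "finite (t ` W)" "\<And>A B. A \<in> W \<Longrightarrow> B \<in> W \<Longrightarrow> t A = t B \<Longrightarrow> f A = f B"
  shows "finite (f ` W)"
proof -
  have "f ` W \<subseteq> (\<lambda>x. f (SOME A. A \<in> W \<and> t A = x)) ` t ` W"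
  proof
    fix y assume "y \<in> f ` W"
    then obtain A where A: "A \<in> W" "y = f A" by auto
    let ?B = "SOME B. B \<in> W \<and> t B = t A"
    have "?B \<in> W \<and> t ?B = t A" by (rule someI[of _ A]) (use A in simp)
    then have "f ?B = y" using assms(2) A by metis
    then show "y \<in> (\<lambda>x. f (SOME A. A \<in> W \<and> t A = x)) ` t ` W" using A(1) by blast
  qed
  then show ?thesis using assms(1) finite_subset by blast
qed

text \<open>Supplies the two links that make the line through the joints long enough to be
  recognised.\<close>

lemma spread_card:
  assumes "group K" "spread K (carrier K) X" "finite (carrier K)" "2 \<le> card (carrier K)"
  shows "2 \<le> card X"
proof -
  interpret group K by (rule assms)
  have "\<not> carrier K \<subseteq> {\<one>\<^bsub>K\<^esub>}"
  proof
    assume "carrier K \<subseteq> {\<one>\<^bsub>K\<^esub>}"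
    then have "card (carrier K) \<le> card {\<one>\<^bsub>K\<^esub>}" by (intro card_mono) auto
    then show False using assms(4) by simp
  qed
  then obtain k where k: "k \<in> carrier K" "k \<noteq> \<one>\<^bsub>K\<^esub>" by auto
  then obtain y where y: "y \<in> X" "k \<otimes>\<^bsub>K\<^esub> y \<in> X" using assms(2) unfolding spread_def by meson
  have X: "X \<subseteq> carrier K" using assms(2) by (auto simp: spread_def)
  have "k \<otimes>\<^bsub>K\<^esub> y \<noteq> y"
  proof
    assume eq: "k \<otimes>\<^bsub>K\<^esub> y = y"
    have yK: "y \<in> carrier K" using y(1) X by blast
    have "k = k \<otimes>\<^bsub>K\<^esub> y \<otimes>\<^bsub>K\<^esub> inv\<^bsub>K\<^esub> y" using k(1) yK by (simp add: m_assoc)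
    then show False using eq k(2) yK by simp
  qed
  then have "card {k \<otimes>\<^bsub>K\<^esub> y, y} = 2" by simp
  moreover have "card {k \<otimes>\<^bsub>K\<^esub> y, y} \<le> card X"
    using y X assms(3) by (intro card_mono) (auto intro: finite_subset)
  ultimately show ?thesis by simp
qed

theorem theorem6p4:
  fixes \<Gamma> :: "('a, 'm) monoid_scheme"
  assumes "group \<Gamma>"
    and "\<exists>\<Gamma>0. subgroup \<Gamma>0 \<Gamma> \<and> finite \<Gamma>0 \<and>
           infinite (fst (conviviality_graph (\<Gamma>\<lparr>carrier := \<Gamma>0\<rparr>) \<Gamma>))"
  shows "\<not> cmso_definable (gain_graphic_matroids \<Gamma> :: nat hypergraph set)"
proof
  assume "cmso_definable (gain_graphic_matroids \<Gamma> :: nat hypergraph set)"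
  then obtain \<phi> where \<phi>: "wf_cmso \<phi>"
    "\<And>M :: nat hypergraph. is_hypergraph M \<Longrightarrow> models M \<phi> \<longleftrightarrow> M \<in> gain_graphic_matroids \<Gamma>"
    by (auto simp: cmso_definable_def is_sentence_def)
  interpret \<Gamma>: group \<Gamma> by (rule assms)
  obtain \<Gamma>0 where \<Gamma>0: "subgroup \<Gamma>0 \<Gamma>" "finite \<Gamma>0"
    and inf: "infinite (conv_verts (\<Gamma>\<lparr>carrier := \<Gamma>0\<rparr>) \<Gamma>)"
    using assms(2) by (auto simp: conviviality_graph_def)
  define F where "F = \<Gamma>\<lparr>carrier := \<Gamma>0\<rparr>"
  have cF: "carrier F = \<Gamma>0" by (simp add: F_def)
  have gF: "group F" unfolding F_def by (rule subgroup.subgroup_is_group[OF \<Gamma>0(1) assms(1)])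
  obtain h :: "'a \<Rightarrow> nat" where h: "inj_on h \<Gamma>0"
    using finite_imp_inj_to_nat_seg[OF \<Gamma>0(2)] by auto
  obtain N where N: "\<And>A B F'. subgroup A \<Gamma> \<Longrightarrow> subgroup B \<Gamma> \<Longrightarrow> finite A \<Longrightarrow> finite B \<Longrightarrow>
       F' \<subseteq> A \<inter> B \<Longrightarrow> N \<le> card A \<Longrightarrow> \<exists>X Y. spread \<Gamma> A X \<and> spread \<Gamma> B Y \<and> X \<inter> Y = F'"
    using spread_partition assms(1) by metis
  obtain \<tau> :: "nat set \<Rightarrow> nat" and T where T: "finite T"
    "\<And>E. finite E \<Longrightarrow> E \<subseteq> left_edges (h ` \<Gamma>0) \<Longrightarrow> \<tau> E \<in> T"
    and \<tau>: "\<And>E E' D. finite E \<Longrightarrow> E \<subseteq> left_edges (h ` \<Gamma>0) \<Longrightarrow> finite E' \<Longrightarrow> E' \<subseteq> left_edges (h ` \<Gamma>0) \<Longrightarrow>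
       finite D \<Longrightarrow> D \<subseteq> right_edges (h ` \<Gamma>0) \<Longrightarrow> \<tau> E = \<tau> E' \<Longrightarrow>
       models (restricted_hypergraph edge_indep (E \<union> D)) \<phi> \<longleftrightarrow> models (restricted_hypergraph edge_indep (E' \<union> D)) \<phi>"
    using models_left_index[OF finite_imageI[OF \<Gamma>0(2), of h] \<phi>(1)] by metis

  let ?V = "elem_verts F \<Gamma>"
  let ?left = "\<lambda>K \<psi> X. to_nat ` ext_edges h \<Gamma>0 True K \<psi> X"
  let ?right = "\<lambda>L \<chi> Y. to_nat ` (common_edges h \<Gamma>0 \<union> ext_edges h \<Gamma>0 False L \<chi> Y)"
  \<comment> \<open>\<open>N\<close> is for \<open>spread_partition\<close>; order at least 3 gives
    the anchors their gains in \<open>realization\<close> and provides two links in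
    \<open>recovery\<close>.\<close>
  define small where "small = {A \<in> ?V. \<exists>(K, \<psi>) \<in> A. card (carrier K) < max N 3}"
  define types where
    "types A = {\<tau> (?left K \<psi> X) | K \<psi> X. (K, \<psi>) \<in> A \<and> spread K (carrier K) X \<and> \<psi> ` \<Gamma>0 \<subseteq> X}"
    for A :: "'a extension set"
  have V_ext: "A \<subseteq> extensions F \<Gamma>" if "A \<in> ?V" for A
    using that in_quotient_imp_subset[OF equiv_ext_equiv] by (auto simp: elem_verts_def)
  have ext: "group K" "finite (carrier K)" "mon K \<Gamma> \<noteq> {}" "\<psi> \<in> mon F K" "inj_on \<psi> \<Gamma>0" "\<psi> \<one>\<^bsub>\<Gamma>\<^esub> = \<one>\<^bsub>K\<^esub>"
    "\<And>f. f \<in> \<Gamma>0 \<Longrightarrow> \<psi> f \<in> carrier K" if "A \<in> ?V" "(K, \<psi>) \<in> A" for A K \<psi>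
  proof -
    show *: "group K" "finite (carrier K)" "mon K \<Gamma> \<noteq> {}" "\<psi> \<in> mon F K"
      using V_ext[OF that(1)] that(2) mem_extensions by blast+
    show "inj_on \<psi> \<Gamma>0" "\<And>f. f \<in> \<Gamma>0 \<Longrightarrow> \<psi> f \<in> carrier K" using monD[OF *(4)] cF by auto
    have "\<psi> \<one>\<^bsub>F\<^esub> = \<one>\<^bsub>K\<^esub>" by (rule hom_one[OF monD(1)[OF *(4)] gF *(1)])
    then show "\<psi> \<one>\<^bsub>\<Gamma>\<^esub> = \<one>\<^bsub>K\<^esub>" by (simp add: F_def)
  qed
  have fin_left: "finite (?left K \<psi> X)" if "spread K (carrier K) X" "finite (carrier K)" for K \<psi> X
  proof -
    have "finite X" using that finite_subset unfolding spread_def by blast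
    then show ?thesis by (intro finite_imageI finite_ext_edges)
  qed
  have fin_right: "finite (?right L \<chi> Y)" if "spread L (carrier L) Y" "finite (carrier L)" for L \<chi> Y
  proof -
    have "finite Y" using that finite_subset unfolding spread_def by blast
    then show ?thesis by (intro finite_imageI finite_UnI finite_ext_edges finite_common_edges \<Gamma>0(2))
  qed
  have large: "max N 3 \<le> card (carrier K)" if A: "A \<in> ?V - small" and K: "(K, \<psi>) \<in> A" for A K \<psi>
  proof (rule ccontr)
    assume "\<not> ?thesis"
    then have "card (carrier K) < max N 3" by (rule not_le_imp_less)
    then have "\<exists>(K, \<psi>) \<in> A. card (carrier K) < max N 3" by (intro bexI[OF _ K]) (simp only: prod.case)
    then show False using A by (simp add: small_def)
  qed
  have parts: "to_nat ` (common_edges h \<Gamma>0 \<union>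
      (\<Union>s. ext_edges h \<Gamma>0 s (if s then K else L) (if s then \<psi> else \<chi>) (if s then X else Y)))
      = ?left K \<psi> X \<union> ?right L \<chi> Y" for K L \<psi> \<chi> X Y
    by (auto simp: UNIV_bool)

  \<comment> \<open>A common embedding of \<open>K\<close> and \<open>L\<close> yields spread sets
    that meet in the image of the subgroup, and so a gain-graphic matroid. Its left gadget is
    exchanged for one of \<open>B\<close> with the same type, the sentence remains true, and the new
    matroid yields a common embedding of \<open>K'\<close> and \<open>L\<close>. \<open>C\<close>
    need not be large, since only one of the groups must be large for the partition.\<close>
  have transfer: "elem_adj F \<Gamma> B C"
    if AB: "A \<in> ?V - small" "B \<in> ?V - small" "types A = types B" and adj: "elem_adj F \<Gamma> A C" for A B C
  proof -
    have CV: "C \<in> ?V" using adj by (simp add: elem_adj_def)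
    obtain K \<psi> L \<chi> where KL: "(K, \<psi>) \<in> A" "(L, \<chi>) \<in> C" "convivial F \<Gamma> (K, \<psi>) (L, \<chi>)"
      using adj by (auto simp: elem_adj_def)
    then obtain \<theta>1 \<theta>2 where \<theta>: "\<theta>1 \<in> mon K \<Gamma>" "\<theta>2 \<in> mon L \<Gamma>" "\<And>f. f \<in> \<Gamma>0 \<Longrightarrow> \<theta>1 (\<psi> f) = \<theta>2 (\<chi> f)"
      by (auto simp: convivial_def cF)
    have AV: "A \<in> ?V" and BV: "B \<in> ?V" using AB by auto
    note eK = ext[OF AV KL(1)] and eL = ext[OF CV KL(2)]
    have big: "max N 3 \<le> card (carrier K)" using large AB(1) KL(1) by blast
    have "N \<le> card (\<theta>1 ` carrier K)" using big monD(2)[OF \<theta>(1)] by (simp add: card_image)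
    moreover have "\<theta>1 ` \<psi> ` \<Gamma>0 \<subseteq> \<theta>1 ` carrier K \<inter> \<theta>2 ` carrier L"
      using eK(7) eL(7) \<theta>(3) by auto
    ultimately obtain X' Y' where XY': "spread \<Gamma> (\<theta>1 ` carrier K) X'" "spread \<Gamma> (\<theta>2 ` carrier L) Y'"
      "X' \<inter> Y' = \<theta>1 ` \<psi> ` \<Gamma>0"
      using N[of "\<theta>1 ` carrier K" "\<theta>2 ` carrier L" "\<theta>1 ` \<psi> ` \<Gamma>0"] eK(2) eL(2)
        mon_image_subgroup[OF eK(1) assms(1) \<theta>(1)] mon_image_subgroup[OF eL(1) assms(1) \<theta>(2)] by auto
    define X where "X = {k \<in> carrier K. \<theta>1 k \<in> X'}"
    define Y where "Y = {k \<in> carrier L. \<theta>2 k \<in> Y'}"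
    have X: "spread K (carrier K) X" "\<theta>1 ` X = X'" and Y: "spread L (carrier L) Y" "\<theta>2 ` Y = Y'"
      unfolding X_def Y_def
        using spread_pullback[OF \<theta>(1) eK(1) XY'(1)] spread_pullback[OF \<theta>(2) eL(1) XY'(2)] by auto
    have FX: "\<psi> ` \<Gamma>0 \<subseteq> X"
    proof (rule image_subsetI)
      fix f assume f: "f \<in> \<Gamma>0"
      then have "\<theta>1 (\<psi> f) \<in> X' \<inter> Y'" unfolding XY'(3) by blast
      then show "\<psi> f \<in> X" using eK(7)[OF f] by (simp add: X_def)
    qed
    have FY: "\<chi> ` \<Gamma>0 \<subseteq> Y"
    proof (rule image_subsetI)
      fix f assume f: "f \<in> \<Gamma>0"
      then have "\<theta>1 (\<psi> f) \<in> X' \<inter> Y'" unfolding XY'(3) by blast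
      then show "\<chi> f \<in> Y" using eL(7)[OF f] \<theta>(3)[OF f] by (simp add: Y_def)
    qed
    have Xc: "X \<subseteq> carrier K" and Yc: "Y \<subseteq> carrier L" by (auto simp: X_def Y_def)
    have "restricted_hypergraph edge_indep (to_nat ` (common_edges h \<Gamma>0 \<union>
      (\<Union>s. ext_edges h \<Gamma>0 s (if s then K else L) (if s then \<psi> else \<chi>) (if s then X else Y))))
      \<in> gain_graphic_matroids \<Gamma>"
    proof (rule realization[of \<Gamma> _ "\<lambda>s. if s then \<theta>1 else \<theta>2"])
      show "finite (if s then X else Y)" for s using Xc Yc eK(2) eL(2) finite_subset by (cases s) auto
      show "(if True then \<theta>1 else \<theta>2) ` (if True then X else Y) \<inter> (if False then \<theta>1 else \<theta>2)
        ` (if False then X else Y)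
          \<subseteq> (if True then \<theta>1 else \<theta>2) ` (if True then \<psi> else \<chi>) ` \<Gamma>0"
        using X(2) Y(2) XY'(3) by simp
      show "3 \<le> card (carrier (if True then K else L))" using big by simp
    qed (use assms(1) eK(1,5) eL(1,5) \<theta> h \<Gamma>0(2) FX FY Xc Yc in simp_all)
    then have "restricted_hypergraph edge_indep (?left K \<psi> X \<union> ?right L \<chi> Y) \<in> gain_graphic_matroids \<Gamma>"
      unfolding parts .
    then have sat: "models (restricted_hypergraph edge_indep (?left K \<psi> X \<union> ?right L \<chi> Y)) \<phi>"
      using \<phi>(2) is_hypergraph_restricted fin_left[OF X(1) eK(2)] fin_right[OF Y(1) eL(2)]
        by (meson finite_UnI)
    have "\<tau> (?left K \<psi> X) \<in> types A"
      unfolding types_def by (intro CollectI exI conjI) (rule refl KL(1) X(1) FX)+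
    then have "\<tau> (?left K \<psi> X) \<in> types B" by (simp only: AB(3))
    then obtain K' \<psi>' Z where Z: "\<tau> (?left K \<psi> X) = \<tau> (?left K' \<psi>' Z)" "(K', \<psi>') \<in> B"
      "spread K' (carrier K') Z" "\<psi>' ` \<Gamma>0 \<subseteq> Z"
      unfolding types_def mem_Collect_eq by (elim exE conjE)
    note eK' = ext[OF BV Z(2)]
    have "models (restricted_hypergraph edge_indep (?left K' \<psi>' Z \<union> ?right L \<chi> Y)) \<phi>"
      using sat \<tau>[OF fin_left[OF X(1) eK(2)] ext_edges_left fin_left[OF Z(3) eK'(2)] ext_edges_left
          fin_right[OF Y(1) eL(2)] right_part Z(1)] by blast
    then have "restricted_hypergraph edge_indep (?left K' \<psi>' Z \<union> ?right L \<chi> Y) \<in> gain_graphic_matroids \<Gamma>"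
      using \<phi>(2) is_hypergraph_restricted fin_left[OF Z(3) eK'(2)] fin_right[OF Y(1) eL(2)]
        by (meson finite_UnI)
    then have gg: "restricted_hypergraph edge_indep (to_nat ` (common_edges h \<Gamma>0 \<union>
      (\<Union>s. ext_edges h \<Gamma>0 s (if s then K' else L) (if s then \<psi>' else \<chi>) (if s then Z else Y))))
      \<in> gain_graphic_matroids \<Gamma>" unfolding parts .
    have "max N 3 \<le> card (carrier K')" using large AB(2) Z(2) by blast
    then have Z2: "2 \<le> card Z" using spread_card[OF eK'(1) Z(3) eK'(2)] by simp
    obtain \<theta> where \<theta>': "\<And>s. \<theta> s \<in> mon (if s then K' else L) \<Gamma>"
      "\<And>f. f \<in> \<Gamma>0 \<Longrightarrow> \<theta> True ((if True then \<psi>' else \<chi>) f) = \<theta> False ((if False then \<psi>' else \<chi>) f)"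
    proof (rule recovery[OF assms(1) _ h _ _ _ _ _ _ gg])
      show "\<one>\<^bsub>\<Gamma>\<^esub> \<in> \<Gamma>0" using \<Gamma>0(1) by (rule subgroup.one_closed)
      show "(if s then \<psi>' else \<chi>) \<one>\<^bsub>\<Gamma>\<^esub> = \<one>\<^bsub>if s then K' else L\<^esub>" for s using eK'(6) eL(6) by simp
      show "2 \<le> card (if True then Z else Y)" using Z2 by simp
    next
      fix \<theta> assume "\<And>s. \<theta> s \<in> mon (if s then K' else L) \<Gamma>"
        "\<And>f. f \<in> \<Gamma>0 \<Longrightarrow> \<theta> True ((if True then \<psi>' else \<chi>) f) = \<theta> False ((if False then \<psi>' else \<chi>) f)"
      then show thesis by (rule that)
    qed (use eK'(1,5) eL(1,5) Z(3,4) Y(1) FY in simp_all)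
    have "\<theta> True \<in> mon K' \<Gamma>" "\<theta> False \<in> mon L \<Gamma>" using \<theta>'(1)[of True] \<theta>'(1)[of False] by simp_all
    then have "convivial F \<Gamma> (K', \<psi>') (L, \<chi>)" using \<theta>'(2) by (auto simp: convivial_def cF)
    then show ?thesis unfolding elem_adj_def using BV CV Z(2) KL(2) by blast
  qed

  have same: "same_nbrs F \<Gamma> `` {A} = same_nbrs F \<Gamma> `` {B}"
    if AB: "A \<in> ?V - small" "B \<in> ?V - small" "types A = types B" for A B
  proof -
    have "{C. elem_adj F \<Gamma> A C} = {C. elem_adj F \<Gamma> B C}"
      using transfer[OF AB] transfer[OF AB(2,1) AB(3)[symmetric]] by blast
    then show ?thesis using AB by (simp add: same_nbrs_def)
  qed
  \<comment> \<open>On the large vertices \<open>types\<close> takes at most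
    \<open>2 ^ card T\<close> values, and equal values mean equal neighbours.\<close>
  have "types A \<subseteq> T" if "A \<in> ?V" for A
    using T(2)[OF fin_left ext_edges_left] ext(2)[OF that] unfolding types_def by blast
  then have "types ` (?V - small) \<subseteq> Pow T" by blast
  then have "finite (types ` (?V - small))" using T(1) finite_subset by blast
  then have "finite ((\<lambda>A. same_nbrs F \<Gamma> `` {A}) ` (?V - small))"
    by (rule finite_image_factor) (rule same)
  moreover have "finite small"
    unfolding small_def using finite_small_extensions[of F] \<Gamma>0(2) cF by simp
  moreover have
    "conv_verts F \<Gamma> \<subseteq> (\<lambda>A. same_nbrs F \<Gamma> `` {A}) ` (?V - small) \<union> (\<lambda>A. same_nbrs F \<Gamma> `` {A}) ` small"
    unfolding conv_verts_def quotient_def by blast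
  ultimately have "finite (conv_verts F \<Gamma>)" by (meson finite_UnI finite_imageI finite_subset)
  then show False using inf by (simp add: F_def)
qed

end
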